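(* Let $G$ be of type $D_n$, let $\mathbf{i}_0=(1\,2\cdots n-1\,n)^{n-1}$, and let $c=(c^{(m)}_i)_{1\le i\le n,\,1\le m\le n-1}=(c^{(1)}_1,c^{(1)}_2,\dots,c^{(n-1)}_{n-1},c^{(n-1)}_n)\in(\mathbb{C}^\times)^{n(n-1)}$. Put $c^{(m)}_0=1$. Then for $k=1,2,\dots,n-2$, $$\Delta_{w_0\Lambda_k,s_k\Lambda_k}(\Theta^-_{\mathbf{i}_0}(c))=\sum_{j=1}^{n-2}\frac{c^{(k)}_j}{c^{(k+1)}_{j-1}}+\frac{c^{(k)}_{n-1}c^{(k)}_n}{c^{(k+1)}_{n-2}}+\frac{c^{(k+1)}_{n-2}}{c^{(k+1)}_{n-1}c^{(k+1)}_n}+\frac{c^{(k)}_n}{c^{(k+1)}_{n-1}}+\frac{c^{(k)}_{n-1}}{c^{(k+1)}_n}+\sum_{j=k+1}^{n-2}\frac{c^{(n+k-j)}_{j-1}}{c^{(n+k-j)}_j}$$ (the last sum being $\frac{c^{(k+2)}_{n-3}}{c^{(k+2)}_{n-2}}+\cdots+\frac{c^{(n-1)}_k}{c^{(n-1)}_{k+1}}$), and $$\Delta_{w_0\Lambda_{n-1},s_{n-1}\Lambda_{n-1}}(\Theta^-_{\mathbf{i}_0}(c))=c^{(n-1)}_{n-1},\qquad \Delta_{w_0\Lambda_n,s_n\Lambda_n}(\Theta^-_{\mathbf{i}_0}(c))=c^{(n-1)}_n.$$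
   Context: $G$ is the simply connected simple algebraic group over $\mathbb{C}$ of type $D_n$ ($n\ge4$), $I=\{1,\dots,n\}$, with Chevalley generators $e_i,f_i,h_i$ of its Lie algebra, simple roots $\alpha_i$, fundamental weights $\Lambda_i$ ($\Lambda_i(h_j)=\delta_{ij}$), and Cartan matrix $a_{ij}=\alpha_j(h_i)$ given by $a_{ii}=2$; $a_{ij}=-1$ if $|i-j|=1$ and $\{i,j\}\ne\{n-1,n\}$, or $\{i,j\}=\{n-2,n\}$; $0$ otherwise. $T$ is the maximal torus, $U^{\pm}$ the unipotent subgroups generated by $x_i(t)=\exp(te_i)$, resp. $y_i(t)=\exp(tf_i)$; $\alpha_i^\vee:\mathbb{C}^\times\to T$ is the coroot one-parameter subgroup. $W$ is the Weyl group, $s_i$ the simple reflections, $w_0$ the longest element. Set $\overline{s}_i=x_i(-1)y_i(1)x_i(-1)$ and $\overline{w}=\overline{s}_{i_1}\cdots\overline{s}_{i_l}$ for any reduced expression $w=s_{i_1}\cdots s_{i_l}$. Generalized minors: $\Delta_{\Lambda_i}$ is the regular function on $G$ with $\Delta_{\Lambda_i}(u^-tu^+)=\Lambda_i(t)$ for $u^\pm\in U^\pm$, $t\in T$; for $u,v\in W$, $\Delta_{u\Lambda_i,v\Lambda_i}(g)=\Delta_{\Lambda_i}(\overline{u}^{-1}g\,\overline{v})$. Set $\mathbf{y}_i(c)=y_i(c)\alpha_i^\vee(c^{-1})$. The word $\mathbf{i}_0=(12\cdots n)^{n-1}$ is a reduced word of $w_0$ and $$\Theta^-_{\mathbf{i}_0}(c)=\prod_{m=1}^{n-1}\mathbf{y}_1(c^{(m)}_1)\mathbf{y}_2(c^{(m)}_2)\cdots\mathbf{y}_n(c^{(m)}_n),$$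 the factors for $m=1,2,\dots,n-1$ being multiplied from left to right. *)

theory Defs
  imports
    Complex_Main
    "HOL-Algebra.Generated_Groups"
    "HOL-Library.Nat_Bijection"
    "Jordan_Normal_Form.Matrix"
begin

section \<open>The Cartan matrix and the Weyl group\<close>

definition cartan :: "nat \<Rightarrow> nat \<Rightarrow> nat \<Rightarrow> int" where
  "cartan n i j =
     (if i \<in> {1..n} \<and> j \<in> {1..n} then
        if i = j then 2
        else if ((i = j + 1 \<or> j = i + 1) \<and> {i, j} \<noteq> {n - 1, n}) \<or> {i, j} = {n - 2, n} then - 1
        else 0
      else 0)"

text \<open>A weight is given by its coordinates \<open>\<mu> j = \<mu>(h\<^sub>j)\<close>, so that
  \<open>s\<^sub>i \<mu> = \<mu> - \<mu>(h\<^sub>i) \<alpha>\<^sub>i\<close> becomes the formula below, by \<open>\<alpha>\<^sub>i(h\<^sub>j) = a\<^sub>j\<^sub>i\<close>.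
  Coordinates outside \<open>{1..n}\<close> play no role and are left fixed.\<close>

definition simple_refl :: "nat \<Rightarrow> nat \<Rightarrow> (nat \<Rightarrow> int) \<Rightarrow> (nat \<Rightarrow> int)" where
  "simple_refl n i \<mu> = (\<lambda>j. \<mu> j - \<mu> i * cartan n j i)"

definition weyl_prod :: "nat \<Rightarrow> nat list \<Rightarrow> (nat \<Rightarrow> int) \<Rightarrow> (nat \<Rightarrow> int)" where
  "weyl_prod n ws = foldr (\<lambda>i w. simple_refl n i \<circ> w) ws id"

text \<open>The simple reflections are involutions, so the products of words form a group.\<close>

definition weyl_group :: "nat \<Rightarrow> ((nat \<Rightarrow> int) \<Rightarrow> (nat \<Rightarrow> int)) set" where
  "weyl_group n = weyl_prod n ` lists {1..n}"

definition weyl_length :: "nat \<Rightarrow> ((nat \<Rightarrow> int) \<Rightarrow> (nat \<Rightarrow> int)) \<Rightarrow> nat" where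
  "weyl_length n w = (LEAST l. \<exists>ws \<in> lists {1..n}. weyl_prod n ws = w \<and> length ws = l)"

definition reduced_word :: "nat \<Rightarrow> ((nat \<Rightarrow> int) \<Rightarrow> (nat \<Rightarrow> int)) \<Rightarrow> nat list \<Rightarrow> bool" where
  "reduced_word n w ws \<longleftrightarrow>
     ws \<in> lists {1..n} \<and> weyl_prod n ws = w \<and> length ws = weyl_length n w"

definition longest_elt :: "nat \<Rightarrow> (nat \<Rightarrow> int) \<Rightarrow> (nat \<Rightarrow> int)" where
  "longest_elt n =
     (THE w. w \<in> weyl_group n \<and> (\<forall>v \<in> weyl_group n. weyl_length n v \<le> weyl_length n w))"


section \<open>The simply connected group of type D\<close>

text \<open>
  The simply connected group of type \<open>D\<^sub>n\<close> is realised as the spin group in its spin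
  representation, the direct sum of both half-spin representations.  This is the Chevalley
  group of a faithful representation of the Lie algebra whose weights
  \<open>(\<plusminus>\<epsilon>\<^sub>1 \<plusminus> \<dots> \<plusminus> \<epsilon>\<^sub>n) / 2\<close> generate the full weight lattice, hence the simply connected one.

  The representation space has a basis \<open>v\<^sub>A\<close> indexed by the subsets \<open>A\<close> of \<open>{1..n}\<close>, where
  \<open>v\<^sub>A\<close> has weight \<open>(\<Sum>i\<in>A. \<epsilon>\<^sub>i) / 2 - (\<Sum>i\<in>{1..n} - A. \<epsilon>\<^sub>i) / 2\<close>.  Matrix index \<open>r < 2 ^ n\<close>
  stands for the subset \<open>subset_of r\<close> given by the binary digits of \<open>r\<close>.  With
  \<open>\<alpha>\<^sub>i = \<epsilon>\<^sub>i - \<epsilon>\<^sub>i\<^sub>+\<^sub>1\<close> for \<open>i < n\<close> and \<open>\<alpha>\<^sub>n = \<epsilon>\<^sub>n\<^sub>-\<^sub>1 + \<epsilon>\<^sub>n\<close>, the generator \<open>e\<^sub>i\<close> sends \<open>v\<^sub>B\<close> to the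
  basis vector of weight \<open>wt(v\<^sub>B) + \<alpha>\<^sub>i\<close> if there is one, and to \<open>0\<close> otherwise; \<open>f\<^sub>i\<close> is
  the transpose of \<open>e\<^sub>i\<close>.
\<close>

definition subset_of :: "nat \<Rightarrow> nat set" where
  "subset_of r = Suc ` set_decode r"

definition chev_e :: "nat \<Rightarrow> nat \<Rightarrow> complex mat" where
  "chev_e n i = mat (2 ^ n) (2 ^ n) (\<lambda>(r, c).
     let A = subset_of r; B = subset_of c in
     if i < n then
       (if i \<notin> B \<and> i + 1 \<in> B \<and> A = insert i (B - {i + 1}) then 1 else 0)
     else
       (if n - 1 \<notin> B \<and> n \<notin> B \<and> A = insert (n - 1) (insert n B) then 1 else 0))"

definition chev_f :: "nat \<Rightarrow> nat \<Rightarrow> complex mat" where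
  "chev_f n i = transpose_mat (chev_e n i)"

text \<open>The eigenvalue of \<open>h\<^sub>i = [e\<^sub>i, f\<^sub>i]\<close> on the basis vector \<open>v\<^sub>A\<close>.\<close>

definition h_eigenvalue :: "nat \<Rightarrow> nat \<Rightarrow> nat set \<Rightarrow> int" where
  "h_eigenvalue n i A =
     (if i < n then of_bool (i \<in> A) - of_bool (i + 1 \<in> A)
      else of_bool (n - 1 \<in> A) + of_bool (n \<in> A) - 1)"

definition mat_exp :: "nat \<Rightarrow> complex mat \<Rightarrow> complex mat" where
  "mat_exp d A = mat d d (\<lambda>(r, c). \<Sum>k. (A ^\<^sub>m k) $$ (r, c) / fact k)"

definition x_elt :: "nat \<Rightarrow> nat \<Rightarrow> complex \<Rightarrow> complex mat" where
  "x_elt n i t = mat_exp (2 ^ n) (t \<cdot>\<^sub>m chev_e n i)"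

definition y_elt :: "nat \<Rightarrow> nat \<Rightarrow> complex \<Rightarrow> complex mat" where
  "y_elt n i t = mat_exp (2 ^ n) (t \<cdot>\<^sub>m chev_f n i)"

definition coroot_elt :: "nat \<Rightarrow> nat \<Rightarrow> complex \<Rightarrow> complex mat" where
  "coroot_elt n i t = mat (2 ^ n) (2 ^ n) (\<lambda>(r, c).
     if r = c then t powi h_eigenvalue n i (subset_of c) else 0)"

definition GL :: "nat \<Rightarrow> complex mat monoid" where
  "GL d = units_of (ring_mat TYPE(complex) d ())"

definition mat_list_prod :: "nat \<Rightarrow> complex mat list \<Rightarrow> complex mat" where
  "mat_list_prod d As = foldr (*) As (1\<^sub>m d)"

definition spin_group :: "nat \<Rightarrow> complex mat monoid" where
  "spin_group n = (GL (2 ^ n))\<lparr>carrier := generate (GL (2 ^ n))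
     ({x_elt n i t | i t. i \<in> {1..n}} \<union> {y_elt n i t | i t. i \<in> {1..n}})\<rparr>"

definition U_plus :: "nat \<Rightarrow> complex mat set" where
  "U_plus n = generate (spin_group n) {x_elt n i t | i t. i \<in> {1..n}}"

definition U_minus :: "nat \<Rightarrow> complex mat set" where
  "U_minus n = generate (spin_group n) {y_elt n i t | i t. i \<in> {1..n}}"

text \<open>As the group is simply connected, every element of the maximal torus is of the
  following form for a unique family \<open>\<tau> 1, \<dots>, \<tau> n\<close> of nonzero numbers, and
  \<open>\<Lambda>\<^sub>i(torus_elt n \<tau>) = \<tau> i\<close> because of \<open>\<Lambda>\<^sub>i(h\<^sub>j) = \<delta>\<^sub>i\<^sub>j\<close>.\<close>

definition torus_elt :: "nat \<Rightarrow> (nat \<Rightarrow> complex) \<Rightarrow> complex mat" where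
  "torus_elt n \<tau> = mat_list_prod (2 ^ n) (map (\<lambda>j. coroot_elt n j (\<tau> j)) [1..<n + 1])"


section \<open>Generalized minors\<close>

inductive_set mat_polynomials :: "nat \<Rightarrow> (complex mat \<Rightarrow> complex) set" for d where
  const: "(\<lambda>_. a) \<in> mat_polynomials d"
| entry: "r < d \<Longrightarrow> c < d \<Longrightarrow> (\<lambda>g. g $$ (r, c)) \<in> mat_polynomials d"
| add: "p \<in> mat_polynomials d \<Longrightarrow> q \<in> mat_polynomials d \<Longrightarrow> (\<lambda>g. p g + q g) \<in> mat_polynomials d"
| mult: "p \<in> mat_polynomials d \<Longrightarrow> q \<in> mat_polynomials d \<Longrightarrow> (\<lambda>g. p g * q g) \<in> mat_polynomials d"

text \<open>The spin group is a closed subgroup of the special linear group, so polynomials in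
  the matrix entries (without the inverse determinant) give all its regular functions.\<close>

definition regular_functions :: "nat \<Rightarrow> (complex mat \<Rightarrow> complex) set" where
  "regular_functions n = (\<lambda>p. restrict p (carrier (spin_group n))) ` mat_polynomials (2 ^ n)"

definition principal_minor :: "nat \<Rightarrow> nat \<Rightarrow> complex mat \<Rightarrow> complex" where
  "principal_minor n i = (THE \<Delta>. \<Delta> \<in> regular_functions n \<and>
     (\<forall>u \<in> U_minus n. \<forall>\<tau>. \<forall>v \<in> U_plus n.
        (\<forall>j \<in> {1..n}. \<tau> j \<noteq> 0) \<longrightarrow> \<Delta> (u * torus_elt n \<tau> * v) = \<tau> i))"

definition s_bar :: "nat \<Rightarrow> nat \<Rightarrow> complex mat" where
  "s_bar n i = x_elt n i (- 1) * y_elt n i 1 * x_elt n i (- 1)"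

text \<open>The value does not depend on the reduced word chosen.\<close>

definition w_bar :: "nat \<Rightarrow> ((nat \<Rightarrow> int) \<Rightarrow> (nat \<Rightarrow> int)) \<Rightarrow> complex mat" where
  "w_bar n w = mat_list_prod (2 ^ n) (map (s_bar n) (SOME ws. reduced_word n w ws))"

text \<open>\<open>gen_minor n i u v\<close> is \<open>\<Delta>\<close> with subscripts \<open>u \<Lambda>\<^sub>i\<close> and \<open>v \<Lambda>\<^sub>i\<close>.\<close>

definition gen_minor ::
  "nat \<Rightarrow> nat \<Rightarrow> ((nat \<Rightarrow> int) \<Rightarrow> (nat \<Rightarrow> int)) \<Rightarrow> ((nat \<Rightarrow> int) \<Rightarrow> (nat \<Rightarrow> int))
     \<Rightarrow> complex mat \<Rightarrow> complex" where
  "gen_minor n i u v g = principal_minor n i (inv\<^bsub>spin_group n\<^esub> (w_bar n u) * g * w_bar n v)"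


section \<open>The map Theta\<close>

definition y_bold :: "nat \<Rightarrow> nat \<Rightarrow> complex \<Rightarrow> complex mat" where
  "y_bold n i a = y_elt n i a * coroot_elt n i (inverse a)"

text \<open>The argument \<open>c m i\<close> is the coordinate with superscript \<open>m\<close> and subscript \<open>i\<close>.\<close>

definition Theta_minus :: "nat \<Rightarrow> (nat \<Rightarrow> nat \<Rightarrow> complex) \<Rightarrow> complex mat" where
  "Theta_minus n c = mat_list_prod (2 ^ n)
     (concat (map (\<lambda>m. map (\<lambda>i. y_bold n i (c m i)) [1..<n + 1]) [1..<n]))"

end

theory Submission
  imports Defs "HOL-Computational_Algebra.Polynomial"
begin

text \<open>
  A matrix of the spin group is handled through its action on row vectors, where all generators
  have simple formulas.

  The minors are explicit polynomials.  For the two half-spin weights they are matrix entries.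
  For \<open>k \<le> n - 2\<close> the highest weight vector of \<open>V(\<Lambda>\<^sub>k)\<close> is found in the tensor square of the spin
  representation, by applying the Clifford operators \<open>a\<^sub>1\<^sup>*, \<dots>, a\<^sub>k\<^sup>*\<close> to the invariant pairing.  They are
  determined by their values on \<open>U\<^sup>- T U\<^sup>+\<close>, because \<open>y\<^sub>i(s)\<close> can be moved to the left through \<open>U\<^sup>+\<close> for all
  but finitely many \<open>s\<close>, so that the Zariski closure of the cell is stable under the generators.

  Along a reduced word of \<open>w\<^sub>0\<close> each letter corresponds to one positive root, which fixes the sign in
  the action of the representative of \<open>w\<^sub>0\<close> on each weight vector, whatever reduced word is chosen.

  In Theta, the rows starting from a lowest weight vector stay extremal: up to lower terms every
  block moves one extremal weight vector to the next with coefficient \<open>1\<close>.  Hence the first \<open>k - 1\<close>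
  blocks can be peeled off together with one Clifford operator each, and what remains is a single
  matrix entry of the product of the blocks \<open>k, \<dots>, n - 1\<close> in the vector representation.  There the
  particle has to move in all blocks but one, which leaves exactly the terms of the formula.
\<close>

text \<open>The group is given by its spin matrices only, so every minor has to be exhibited as a
  polynomial in their entries. Exterior powers of the vector representation therefore enter only
  through Clifford operators between spin rows. Row \<open>A\<close> of a product is
  \<open>delta A\<close> pushed through the factors from left to right, and on rows the lowering
  elements raise weights. This is why the computation starts at lowest weights and follows the top
  of the support. The torus factor in \<open>y_bold\<close> cancels the parameter of
  \<open>y_elt\<close> on the raised vector, so the coefficients along an extremal path are exactly
  1 and the parameters appear only where a path deviates from it. The sign \<open>jsg\<close> is
  forced by the invariance of the pairing. It is also the sign with which the representative of the
  longest element acts at \<open>{1..k}\<close>: it comes once from normalising the minor and once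
  from this action, and the two cancel.\<close>

declare One_nat_def [simp del]

section \<open>Subsets as matrix indices\<close>

lemma set_decode_lt: "set_decode r \<subseteq> {..<n} \<longleftrightarrow> r < 2 ^ n"
proof
  assume "r < 2 ^ n"
  show "set_decode r \<subseteq> {..<n}"
  proof (intro subsetI, rule ccontr)
    fix x assume x: "x \<in> set_decode r" "x \<notin> {..<n}"
    then have "(2::nat) ^ n \<le> 2 ^ x" by (intro power_increasing) auto
    with \<open>r < 2 ^ n\<close> have "r div 2 ^ x = 0" by (intro div_less) linarith
    with x show False by (simp add: set_decode_def)
  qed
next
  assume *: "set_decode r \<subseteq> {..<n}"
  have "r = set_encode (set_decode r)" by simp
  also have "\<dots> \<le> sum ((^) 2) {..<n}"
    unfolding set_encode_def using * by (intro sum_mono2) auto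
  also have "\<dots> < 2 ^ n"
    by (induction n) auto
  finally show "r < 2 ^ n" .
qed

text \<open>Inverse of \<open>subset_of\<close> on subsets of \<open>{1..n}\<close>. Binary digits
  are counted from 0 and coordinates from 1, hence the shift.\<close>

definition idx :: "nat set \<Rightarrow> nat" where
  "idx A = set_encode ((\<lambda>a. a - 1) ` A)"

lemma subset_of_subset: "r < 2 ^ n \<Longrightarrow> subset_of r \<subseteq> {1..n}"
  using set_decode_lt[of r n] by (auto simp: subset_of_def)

lemma subset_of_idx: "A \<subseteq> {1..n} \<Longrightarrow> subset_of (idx A) = A"
proof -
  assume A: "A \<subseteq> {1..n}"
  then have "finite A" by (rule finite_subset) auto
  then show ?thesis
    unfolding subset_of_def idx_def using A by (force simp: image_image image_iff)
qed

lemma idx_subset_of: "idx (subset_of r) = r"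
  by (simp add: subset_of_def idx_def image_image)

lemma idx_eq_iff: "A \<subseteq> {1..n} \<Longrightarrow> B \<subseteq> {1..n} \<Longrightarrow> idx A = idx B \<longleftrightarrow> A = B"
  by (metis subset_of_idx)

lemma idx_lt: assumes "A \<subseteq> {1..n}" shows "idx A < 2 ^ n"
proof -
  have "finite A" using assms by (rule finite_subset) auto
  then have "set_decode (idx A) = (\<lambda>a. a - 1) ` A" by (simp add: idx_def)
  also have "\<dots> \<subseteq> {..<n}" using assms by force
  finally show ?thesis using set_decode_lt by blast
qed

lemma sum_idx: "(\<Sum>k<2 ^ n. f k) = (\<Sum>A\<in>Pow {1..n}. f (idx A))"
  by (rule sum.reindex_bij_witness[of _ idx subset_of])
     (auto simp: subset_of_idx idx_subset_of idx_lt dest: subset_of_subset)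

section \<open>Matrices acting on row vectors\<close>

type_synonym row = "nat set \<Rightarrow> complex"

definition ent :: "complex mat \<Rightarrow> nat set \<Rightarrow> nat set \<Rightarrow> complex" where
  "ent M A B = M $$ (idx A, idx B)"

text \<open>A row is a total function on sets, but only its values at subsets of
  \<open>{1..n}\<close> correspond to matrix entries. Agreement with \<open>F\<close> is therefore
  demanded only there.\<close>

definition row_rep :: "nat \<Rightarrow> complex mat \<Rightarrow> (row \<Rightarrow> row) \<Rightarrow> bool" where
  "row_rep n M F \<longleftrightarrow> M \<in> carrier_mat (2 ^ n) (2 ^ n) \<and>
     (\<forall>r D. D \<subseteq> {1..n} \<longrightarrow> (\<Sum>A\<in>Pow {1..n}. r A * ent M A D) = F r D)"

definition delta :: "nat set \<Rightarrow> row" where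
  "delta A = (\<lambda>D. of_bool (D = A))"

lemma row_rep_carrier: "row_rep n M F \<Longrightarrow> M \<in> carrier_mat (2 ^ n) (2 ^ n)"
  by (simp add: row_rep_def)

lemma row_rep_ent:
  assumes "row_rep n M F" "A \<subseteq> {1..n}" "D \<subseteq> {1..n}"
  shows "ent M A D = F (delta A) D"
proof -
  have "F (delta A) D = (\<Sum>C\<in>Pow {1..n}. delta A C * ent M C D)"
    using assms by (simp add: row_rep_def)
  also have "\<dots> = (\<Sum>C\<in>{A}. delta A C * ent M C D)"
    by (rule sum.mono_neutral_right) (use assms in \<open>auto simp: delta_def\<close>)
  finally show ?thesis by (simp add: delta_def)
qed

lemma mat_eqI_ent:
  assumes "M \<in> carrier_mat (2 ^ n) (2 ^ n)" "M' \<in> carrier_mat (2 ^ n) (2 ^ n)"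
    and "\<And>A B. A \<subseteq> {1..n} \<Longrightarrow> B \<subseteq> {1..n} \<Longrightarrow> ent M A B = ent M' A B"
  shows "M = M'"
proof (rule eq_matI)
  fix i j assume "i < dim_row M'" "j < dim_col M'"
  then have "i < 2 ^ n" "j < 2 ^ n" using assms by auto
  then have "ent M (subset_of i) (subset_of j) = ent M' (subset_of i) (subset_of j)"
    using assms(3) subset_of_subset by blast
  then show "M $$ (i, j) = M' $$ (i, j)" by (simp add: ent_def idx_subset_of)
qed (use assms in auto)

lemma row_rep_unique:
  assumes "row_rep n M F" "row_rep n M' F'"
    and "\<And>r D. D \<subseteq> {1..n} \<Longrightarrow> F r D = F' r D"
  shows "M = M'"
  using assms by (intro mat_eqI_ent[of M n]) (auto simp: row_rep_carrier row_rep_ent)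

lemma ent_mult:
  assumes "M \<in> carrier_mat (2 ^ n) (2 ^ n)" "M' \<in> carrier_mat (2 ^ n) (2 ^ n)"
    and "A \<subseteq> {1..n}" "B \<subseteq> {1..n}"
  shows "ent (M * M') A B = (\<Sum>C\<in>Pow {1..n}. ent M A C * ent M' C B)"
proof -
  have "ent (M * M') A B = (\<Sum>k\<in>{0..<2 ^ n}. M $$ (idx A, k) * M' $$ (k, idx B))"
    using assms(1,2) idx_lt[OF assms(3)] idx_lt[OF assms(4)]
    by (auto simp: ent_def scalar_prod_def intro!: sum.cong)
  then show ?thesis
    unfolding atLeast0LessThan sum_idx by (simp only: ent_def)
qed

text \<open>A row meets the left factor first, so a product read from left to right gives the
  operators in their order of application.\<close>

lemma row_rep_mult:
  assumes "row_rep n M F" "row_rep n M' F'"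
  shows "row_rep n (M * M') (\<lambda>r. F' (F r))"
  unfolding row_rep_def
proof (intro conjI allI impI)
  show "M * M' \<in> carrier_mat (2 ^ n) (2 ^ n)"
    using row_rep_carrier[OF assms(1)] row_rep_carrier[OF assms(2)] by auto
  fix r :: row and D assume D: "D \<subseteq> {1..n}"
  have "(\<Sum>A\<in>Pow {1..n}. r A * ent (M * M') A D) =
      (\<Sum>A\<in>Pow {1..n}. \<Sum>C\<in>Pow {1..n}. r A * ent M A C * ent M' C D)"
    using D ent_mult[OF row_rep_carrier[OF assms(1)] row_rep_carrier[OF assms(2)]]
    by (intro sum.cong refl) (simp add: sum_distrib_left mult.assoc)
  also have "\<dots> = (\<Sum>C\<in>Pow {1..n}. (\<Sum>A\<in>Pow {1..n}. r A * ent M A C) * ent M' C D)"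
    by (subst sum.swap) (simp add: sum_distrib_right)
  also have "\<dots> = (\<Sum>C\<in>Pow {1..n}. F r C * ent M' C D)"
    using assms by (intro sum.cong) (auto simp: row_rep_def)
  also have "\<dots> = F' (F r) D" using assms D by (simp add: row_rep_def)
  finally show "(\<Sum>A\<in>Pow {1..n}. r A * ent (M * M') A D) = F' (F r) D" .
qed

lemma row_rep_one: "row_rep n (1\<^sub>m (2 ^ n)) (\<lambda>r. r)"
  unfolding row_rep_def
proof (intro conjI allI impI)
  fix r :: row and D assume D: "D \<subseteq> {1..n}"
  have "(\<Sum>A\<in>Pow {1..n}. r A * ent (1\<^sub>m (2 ^ n)) A D) =
      (\<Sum>A\<in>{D}. r A * ent (1\<^sub>m (2 ^ n)) A D)"
    using D by (intro sum.mono_neutral_right) (auto simp: ent_def idx_lt idx_eq_iff)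
  then show "(\<Sum>A\<in>Pow {1..n}. r A * ent (1\<^sub>m (2 ^ n)) A D) = r D"
    using D by (simp add: ent_def idx_lt)
qed simp

lemma row_rep_zero: "row_rep n (0\<^sub>m (2 ^ n) (2 ^ n)) (\<lambda>r D. 0)"
  by (auto simp: row_rep_def ent_def idx_lt intro!: sum.neutral)

lemma row_rep_add:
  assumes "row_rep n M F" "row_rep n M' F'"
  shows "row_rep n (M + M') (\<lambda>r D. F r D + F' r D)"
  unfolding row_rep_def
proof (intro conjI allI impI)
  show "M + M' \<in> carrier_mat (2 ^ n) (2 ^ n)"
    using row_rep_carrier[OF assms(1)] row_rep_carrier[OF assms(2)] by auto
  fix r :: row and D assume D: "D \<subseteq> {1..n}"
  have "(\<Sum>A\<in>Pow {1..n}. r A * ent (M + M') A D) =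
      (\<Sum>A\<in>Pow {1..n}. r A * ent M A D + r A * ent M' A D)"
    using row_rep_carrier[OF assms(1)] row_rep_carrier[OF assms(2)] D
    by (intro sum.cong refl) (auto simp: ent_def idx_lt distrib_left)
  then show "(\<Sum>A\<in>Pow {1..n}. r A * ent (M + M') A D) = F r D + F' r D"
    using assms D by (simp add: sum.distrib row_rep_def)
qed

lemma row_rep_smult:
  "row_rep n M F \<Longrightarrow> row_rep n (t \<cdot>\<^sub>m M) (\<lambda>r D. t * F r D)"
  unfolding row_rep_def
proof (intro conjI allI impI; elim conjE)
  fix r :: row and D
  assume M: "M \<in> carrier_mat (2 ^ n) (2 ^ n)" and D: "D \<subseteq> {1..n}"
    and F: "\<forall>r D. D \<subseteq> {1..n} \<longrightarrow> (\<Sum>A\<in>Pow {1..n}. r A * ent M A D) = F r D"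
  have "(\<Sum>A\<in>Pow {1..n}. r A * ent (t \<cdot>\<^sub>m M) A D) = (\<Sum>A\<in>Pow {1..n}. t * (r A * ent M A D))"
    using M D by (intro sum.cong) (auto simp: ent_def idx_lt)
  then show "(\<Sum>A\<in>Pow {1..n}. r A * ent (t \<cdot>\<^sub>m M) A D) = t * F r D"
    using F D by (simp add: sum_distrib_left[symmetric])
qed auto

text \<open>Weight spaces of the spin representation are lines, so a Chevalley generator or torus
  element has at most one nonzero entry in each column, and the sum over \<open>A\<close>
  collapses.\<close>

lemma row_rep_pull:
  assumes M: "M \<in> carrier_mat (2 ^ n) (2 ^ n)"
    and T: "\<And>D. D \<subseteq> {1..n} \<Longrightarrow> P D \<Longrightarrow> T D \<subseteq> {1..n}"
    and e: "\<And>A D. A \<subseteq> {1..n} \<Longrightarrow> D \<subseteq> {1..n} \<Longrightarrow> ent M A D = (if P D \<and> A = T D then s D else 0)"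
  shows "row_rep n M (\<lambda>r D. if P D then s D * r (T D) else 0)"
  unfolding row_rep_def
proof (intro conjI allI impI)
  fix r :: row and D assume D: "D \<subseteq> {1..n}"
  show "(\<Sum>A\<in>Pow {1..n}. r A * ent M A D) = (if P D then s D * r (T D) else 0)"
  proof (cases "P D")
    case True
    have "(\<Sum>A\<in>Pow {1..n}. r A * ent M A D) = (\<Sum>A\<in>{T D}. r A * ent M A D)"
      using D True T by (intro sum.mono_neutral_right) (auto simp: e)
    with True D T show ?thesis by (simp add: e)
  qed (use D in \<open>auto simp: e intro!: sum.neutral\<close>)
qed (rule M)

section \<open>Generators as row operators\<close>

text \<open>The simple root with index \<open>i\<close> is the sum of the
  \<open>\<epsilon>\<^sub>a\<close> with \<open>a\<close> in \<open>up n i\<close>, minus those in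
  \<open>dn n i\<close>. In this encoding the branch node \<open>n\<close>, whose root is a sum,
  obeys the same set-theoretic arguments as the other nodes.\<close>

definition up :: "nat \<Rightarrow> nat \<Rightarrow> nat set" where
  "up n i = (if i < n then {i} else {n - 1, n})"

definition dn :: "nat \<Rightarrow> nat \<Rightarrow> nat set" where
  "dn n i = (if i < n then {i + 1} else {})"

definition cane :: "nat \<Rightarrow> nat \<Rightarrow> nat set \<Rightarrow> bool" where
  "cane n i D \<longleftrightarrow> up n i \<inter> D = {} \<and> dn n i \<subseteq> D"

definition canf :: "nat \<Rightarrow> nat \<Rightarrow> nat set \<Rightarrow> bool" where
  "canf n i D \<longleftrightarrow> up n i \<subseteq> D \<and> dn n i \<inter> D = {}"

definition eset :: "nat \<Rightarrow> nat \<Rightarrow> nat set \<Rightarrow> nat set" where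
  "eset n i D = (D - dn n i) \<union> up n i"

definition fset :: "nat \<Rightarrow> nat \<Rightarrow> nat set \<Rightarrow> nat set" where
  "fset n i D = (D - up n i) \<union> dn n i"

lemma up_dn_disj: "up n i \<inter> dn n i = {}"
  by (auto simp: up_def dn_def)

lemma up_dn_subset: "i \<in> {1..n} \<Longrightarrow> 2 \<le> n \<Longrightarrow> up n i \<subseteq> {1..n} \<and> dn n i \<subseteq> {1..n}"
  by (auto simp: up_def dn_def)

lemma up_nonempty: "up n i \<noteq> {}"
  by (simp add: up_def)

lemma eset_subset: "i \<in> {1..n} \<Longrightarrow> 2 \<le> n \<Longrightarrow> D \<subseteq> {1..n} \<Longrightarrow> eset n i D \<subseteq> {1..n}"
  using up_dn_subset[of i n] by (auto simp: eset_def)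

lemma fset_subset: "i \<in> {1..n} \<Longrightarrow> 2 \<le> n \<Longrightarrow> D \<subseteq> {1..n} \<Longrightarrow> fset n i D \<subseteq> {1..n}"
  using up_dn_subset[of i n] by (auto simp: fset_def)

lemma cane_imp:
  assumes "cane n i D"
  shows "\<not> canf n i D" "canf n i (eset n i D)" "\<not> cane n i (eset n i D)"
    "fset n i (eset n i D) = D" "eset n i D \<noteq> D"
  using assms up_dn_disj[of n i] up_nonempty[of n i]
  unfolding cane_def canf_def eset_def fset_def by blast+

lemma canf_imp:
  assumes "canf n i D"
  shows "\<not> cane n i D" "cane n i (fset n i D)" "\<not> canf n i (fset n i D)"
    "eset n i (fset n i D) = D" "fset n i D \<noteq> D"
  using assms up_dn_disj[of n i] up_nonempty[of n i]
  unfolding cane_def canf_def eset_def fset_def by blast+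

lemma h_eigenvalue_eq:
  assumes "i \<le> n" "2 \<le> n"
  shows "h_eigenvalue n i D = of_bool (canf n i D) - of_bool (cane n i D)"
  using assms by (auto simp: h_eigenvalue_def canf_def cane_def up_def dn_def)

text \<open>The entry at \<open>D\<close> of \<open>r\<close> times \<open>chev_e n i\<close> is the
  value of \<open>r\<close> at the set to which \<open>chev_e n i\<close> sends \<open>D\<close>.
  Hence the raising set appears as an argument, and the support of the row moves down.\<close>

definition xrow :: "nat \<Rightarrow> nat \<Rightarrow> complex \<Rightarrow> row \<Rightarrow> row" where
  "xrow n i t r D = r D + (if cane n i D then t * r (eset n i D) else 0)"

definition yrow :: "nat \<Rightarrow> nat \<Rightarrow> complex \<Rightarrow> row \<Rightarrow> row" where
  "yrow n i t r D = r D + (if canf n i D then t * r (fset n i D) else 0)"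

definition hrow :: "nat \<Rightarrow> nat \<Rightarrow> complex \<Rightarrow> row \<Rightarrow> row" where
  "hrow n i t r D = t powi h_eigenvalue n i D * r D"

lemma chev_e_carrier: "chev_e n i \<in> carrier_mat (2 ^ n) (2 ^ n)"
  by (simp add: chev_e_def)

lemma chev_f_carrier: "chev_f n i \<in> carrier_mat (2 ^ n) (2 ^ n)"
  by (simp add: chev_f_def chev_e_carrier)

lemma ent_chev_e:
  assumes "A \<subseteq> {1..n}" "D \<subseteq> {1..n}" "i \<in> {1..n}"
  shows "ent (chev_e n i) A D = (if cane n i D \<and> A = eset n i D then 1 else 0)"
proof (cases "i < n")
  case True
  then show ?thesis
    using assms(1,2)
    by (auto simp: ent_def chev_e_def idx_lt subset_of_idx cane_def eset_def up_def dn_def)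
next
  case False
  then have [simp]: "i = n" using assms(3) by simp
  show ?thesis
    using assms(1,2)
    by (simp add: ent_def chev_e_def idx_lt subset_of_idx cane_def eset_def up_def dn_def Un_commute)
qed

lemma ent_chev_f:
  assumes "A \<subseteq> {1..n}" "D \<subseteq> {1..n}" "i \<in> {1..n}"
  shows "ent (chev_f n i) A D = (if canf n i D \<and> A = fset n i D then 1 else 0)"
proof -
  have "ent (chev_f n i) A D = ent (chev_e n i) D A"
    using assms chev_e_carrier[of n i] by (simp add: ent_def chev_f_def idx_lt)
  then show ?thesis
    using assms by (auto simp: ent_chev_e cane_imp canf_imp)
qed

lemma row_rep_chev_e:
  "i \<in> {1..n} \<Longrightarrow> 2 \<le> n \<Longrightarrow> row_rep n (chev_e n i) (\<lambda>r D. if cane n i D then 1 * r (eset n i D) else 0)"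
  by (rule row_rep_pull) (simp_all add: chev_e_carrier ent_chev_e eset_subset)

lemma row_rep_chev_f:
  "i \<in> {1..n} \<Longrightarrow> 2 \<le> n \<Longrightarrow> row_rep n (chev_f n i) (\<lambda>r D. if canf n i D then 1 * r (fset n i D) else 0)"
  by (rule row_rep_pull) (simp_all add: chev_f_carrier fset_subset ent_chev_f)

text \<open>A simple coroot takes only the values -1, 0, 1 on the spin weights, so the generators
  square to zero there and the exponential series stops after two terms.\<close>

lemma mat_exp_square_zero:
  assumes A: "A \<in> carrier_mat d d" and sq: "A * A = 0\<^sub>m d d"
  shows "mat_exp d A = 1\<^sub>m d + A"
proof (rule eq_matI)
  fix i j assume "i < dim_row (1\<^sub>m d + A)" "j < dim_col (1\<^sub>m d + A)"
  then have ij: "i < d" "j < d" using A by auto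
  have pow0: "(A ^\<^sub>m k) = 0\<^sub>m d d" if "k \<ge> 2" for k
    using that
  proof (induction k rule: dec_induct)
    case base then show ?case using A sq by (simp add: numeral_2_eq_2)
  next
    case (step k) then show ?case using A by simp
  qed
  have "(\<Sum>k. (A ^\<^sub>m k) $$ (i, j) / fact k) = (\<Sum>k\<in>{0,1}. (A ^\<^sub>m k) $$ (i, j) / fact k)"
  proof (rule suminf_finite)
    fix k :: nat assume "k \<notin> {0,1}"
    then have "k \<ge> 2" by auto
    then show "(A ^\<^sub>m k) $$ (i, j) / fact k = 0" using ij by (simp add: pow0)
  qed simp
  then show "mat_exp d A $$ (i, j) = (1\<^sub>m d + A) $$ (i, j)"
    using ij A by (simp add: mat_exp_def One_nat_def)
qed (use A in \<open>auto simp: mat_exp_def\<close>)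

lemma x_elt_eq:
  assumes "i \<in> {1..n}" "2 \<le> n"
  shows "x_elt n i t = 1\<^sub>m (2 ^ n) + t \<cdot>\<^sub>m chev_e n i"
  unfolding x_elt_def
proof (rule mat_exp_square_zero)
  note r = row_rep_smult[OF row_rep_chev_e[OF assms], of t]
  show "t \<cdot>\<^sub>m chev_e n i * (t \<cdot>\<^sub>m chev_e n i) = 0\<^sub>m (2 ^ n) (2 ^ n)"
    by (rule row_rep_unique[OF row_rep_mult[OF r r] row_rep_zero]) (simp add: cane_imp)
qed (simp add: chev_e_carrier)

lemma y_elt_eq:
  assumes "i \<in> {1..n}" "2 \<le> n"
  shows "y_elt n i t = 1\<^sub>m (2 ^ n) + t \<cdot>\<^sub>m chev_f n i"
  unfolding y_elt_def
proof (rule mat_exp_square_zero)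
  note r = row_rep_smult[OF row_rep_chev_f[OF assms], of t]
  show "t \<cdot>\<^sub>m chev_f n i * (t \<cdot>\<^sub>m chev_f n i) = 0\<^sub>m (2 ^ n) (2 ^ n)"
    by (rule row_rep_unique[OF row_rep_mult[OF r r] row_rep_zero]) (simp add: canf_imp)
qed (simp add: chev_f_def chev_e_carrier)

lemma row_rep_eqI:
  "row_rep n M F \<Longrightarrow> (\<And>r D. D \<subseteq> {1..n} \<Longrightarrow> F r D = F' r D) \<Longrightarrow> row_rep n M F'"
  by (simp add: row_rep_def)

lemma row_rep_x:
  assumes "i \<in> {1..n}" "2 \<le> n"
  shows "row_rep n (x_elt n i t) (xrow n i t)"
  unfolding x_elt_eq[OF assms]
  by (rule row_rep_eqI[OF row_rep_add[OF row_rep_one row_rep_smult[OF row_rep_chev_e[OF assms]]]])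
     (simp add: xrow_def)

lemma row_rep_y:
  assumes "i \<in> {1..n}" "2 \<le> n"
  shows "row_rep n (y_elt n i t) (yrow n i t)"
  unfolding y_elt_eq[OF assms]
  by (rule row_rep_eqI[OF row_rep_add[OF row_rep_one row_rep_smult[OF row_rep_chev_f[OF assms]]]])
     (simp add: yrow_def)

lemma row_rep_h: "row_rep n (coroot_elt n i t) (hrow n i t)"
proof -
  have "row_rep n (coroot_elt n i t)
    (\<lambda>r D. if True then t powi h_eigenvalue n i D * r D else 0)"
  proof (rule row_rep_pull)
    fix A D assume "A \<subseteq> {1..n}" "D \<subseteq> {1..n}"
    moreover from this have "idx A = idx D \<longleftrightarrow> A = D" using subset_of_idx by metis
    ultimately show "ent (coroot_elt n i t) A D =
        (if True \<and> A = D then t powi h_eigenvalue n i D else 0)"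
      by (auto simp: ent_def coroot_elt_def idx_lt subset_of_idx)
  qed (simp_all add: coroot_elt_def)
  then show ?thesis by (rule row_rep_eqI) (simp add: hrow_def)
qed

section \<open>Relations between the generators\<close>

text \<open>Raising by \<open>j\<close> adds the root \<open>\<alpha>\<^sub>j\<close> to the weight,
  and \<open>\<alpha>\<^sub>j(h\<^sub>l)\<close> is the Cartan integer. This is where the explicit
  matrices are tied to the Cartan matrix and its branching.\<close>

lemma h_eset:
  assumes "cane n j D" "j \<in> {1..n}" "l \<in> {1..n}" "4 \<le> n"
  shows "h_eigenvalue n l (eset n j D) = h_eigenvalue n l D + cartan n l j"
proof -
  \<comment> \<open>Writing \<open>n\<close> as \<open>m + 2\<close> keeps truncated subtraction out
    of the case analysis around the branch node.\<close>
  obtain m where m: "n = m + 2" using assms(4) by (intro that[of "n - 2"]) simp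
  consider "l < n" "j < n" | "l < n" "j = n" | "l = n" "j < n" | "l = n" "j = n"
    using assms by fastforce
  then show ?thesis
  proof cases
    case 1
    consider "l = j" | "l = j + 1" | "j = l + 1" | "l \<noteq> j" "l \<noteq> j + 1" "j \<noteq> l + 1" by blast
    then show ?thesis using assms 1
      by cases (simp_all add: h_eigenvalue_def eset_def cane_def up_def dn_def cartan_def doubleton_eq_iff)
  next
    case 2
    consider "l = m + 1" | "l = m" | "l < m" using 2 m by linarith
    then show ?thesis using assms 2 m
      by cases (auto simp: h_eigenvalue_def eset_def cane_def up_def dn_def cartan_def doubleton_eq_iff One_nat_def)
  next
    case 3
    consider "j = m + 1" | "j = m" | "j < m" using 3 m by linarith
    then show ?thesis using assms 3 m
      by cases (auto simp: h_eigenvalue_def eset_def cane_def up_def dn_def cartan_def doubleton_eq_iff One_nat_def)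
  next
    case 4 then show ?thesis using assms
      by (auto simp: h_eigenvalue_def eset_def cane_def up_def dn_def cartan_def doubleton_eq_iff)
  qed
qed

lemma x_elt_add:
  assumes "i \<in> {1..n}" "2 \<le> n"
  shows "x_elt n i s * x_elt n i t = x_elt n i (s + t)"
  by (rule row_rep_unique[OF row_rep_mult[OF row_rep_x[OF assms] row_rep_x[OF assms]] row_rep_x[OF assms]])
     (simp add: xrow_def cane_imp algebra_simps)

lemma y_elt_add:
  assumes "i \<in> {1..n}" "2 \<le> n"
  shows "y_elt n i s * y_elt n i t = y_elt n i (s + t)"
  by (rule row_rep_unique[OF row_rep_mult[OF row_rep_y[OF assms] row_rep_y[OF assms]] row_rep_y[OF assms]])
     (simp add: yrow_def canf_imp algebra_simps)

lemma x_elt_zero: "i \<in> {1..n} \<Longrightarrow> 2 \<le> n \<Longrightarrow> x_elt n i 0 = 1\<^sub>m (2 ^ n)"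
  by (rule row_rep_unique[OF row_rep_x row_rep_one]) (simp_all add: xrow_def)

lemma y_elt_zero: "i \<in> {1..n} \<Longrightarrow> 2 \<le> n \<Longrightarrow> y_elt n i 0 = 1\<^sub>m (2 ^ n)"
  by (rule row_rep_unique[OF row_rep_y row_rep_one]) (simp_all add: yrow_def)

text \<open>A difference of two distinct simple roots is not a root, so \<open>e\<^sub>j\<close> and
  \<open>f\<^sub>i\<close> commute. On basis vectors this means that both orders are possible
  simultaneously and end in the same set.\<close>

lemma cane_canf_commute:
  assumes "i \<in> {1..n}" "j \<in> {1..n}" "i \<noteq> j" "4 \<le> n"
  shows "(canf n i D \<and> cane n j (fset n i D)) = (cane n j D \<and> canf n i (eset n j D)) \<and>
    (canf n i D \<and> cane n j (fset n i D) \<longrightarrow> eset n j (fset n i D) = fset n i (eset n j D))"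
proof -
  obtain m where m: "n = m + 2" using assms(4) by (intro that[of "n - 2"]) simp
  consider "i < n" "j < n" | "i < n" "j = n" | "i = n" "j < n"
    using assms by fastforce
  then show ?thesis
  proof cases
    case 1
    consider "i = j + 1" | "j = i + 1" | "i \<noteq> j + 1" "j \<noteq> i + 1" by blast
    then show ?thesis using assms 1
      by cases (auto simp: cane_def canf_def eset_def fset_def up_def dn_def)
  next
    case 2
    consider "i = m + 1" | "i = m" | "i < m" using 2 m by linarith
    then show ?thesis using assms 2 m
      by cases (auto simp: cane_def canf_def eset_def fset_def up_def dn_def)
  next
    case 3
    consider "j = m + 1" | "j = m" | "j < m" using 3 m by linarith
    then show ?thesis using assms 3 m
      by cases (auto simp: cane_def canf_def eset_def fset_def up_def dn_def)
  qed
qed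

lemma x_y_commute:
  assumes "i \<in> {1..n}" "j \<in> {1..n}" "i \<noteq> j" "4 \<le> n"
  shows "x_elt n j a * y_elt n i s = y_elt n i s * x_elt n j a"
proof -
  have n: "2 \<le> n" using assms by simp
  note rx = row_rep_x[OF assms(2) n, of a] and ry = row_rep_y[OF assms(1) n, of s]
  show ?thesis
  proof (rule row_rep_unique[OF row_rep_mult[OF rx ry] row_rep_mult[OF ry rx]])
    fix r :: row and D
    show "yrow n i s (xrow n j a r) D = xrow n j a (yrow n i s r) D"
      using cane_canf_commute[OF assms, of D]
      by (auto simp: xrow_def yrow_def algebra_simps)
  qed
qed

lemma hrow_cases:
  assumes "i \<le> n" "2 \<le> n"
  shows "hrow n i t r D = (if canf n i D then t * r D else if cane n i D then r D / t else r D)"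
  using assms
  by (auto simp: hrow_def h_eigenvalue_eq canf_imp cane_imp power_int_minus field_simps)

text \<open>Factorisation of a 2 by 2 matrix of determinant 1 into lower triangular, diagonal and
  upper triangular part. It suffices because the rank-one subgroup acts on every pair
  \<open>D\<close>, \<open>eset n i D\<close> as on its natural module, and trivially on the
  remaining basis vectors.\<close>

lemma x_y_same:
  assumes "i \<in> {1..n}" "2 \<le> n" "1 + a * s \<noteq> 0"
  shows "x_elt n i a * y_elt n i s =
    y_elt n i (s / (1 + a * s)) * coroot_elt n i (1 + a * s) * x_elt n i (a / (1 + a * s))"
proof -
  note rx = row_rep_x[OF assms(1,2)] and ry = row_rep_y[OF assms(1,2)]
  have i: "i \<le> n" using assms by simp
  show ?thesis
  proof (rule row_rep_unique[OF row_rep_mult[OF rx ry]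
        row_rep_mult[OF row_rep_mult[OF ry row_rep_h] rx]])
    fix r :: row and D
    define q where "q = 1 + a * s"
    have q: "q \<noteq> 0" using assms q_def by simp
    have [simp]: "r D / q + a * (s * r D) / q = r D"
    proof -
      have "r D / q + a * (s * r D) / q = r D * q / q"
        unfolding q_def by (simp add: add_divide_distrib[symmetric] algebra_simps)
      then show ?thesis using q by simp
    qed
    show "yrow n i s (xrow n i a r) D = xrow n i (a / (1 + a * s))
        (hrow n i (1 + a * s) (yrow n i (s / (1 + a * s)) r)) D"
      unfolding q_def[symmetric]
      using q i assms(2)
      by (cases "canf n i D"; cases "cane n i D")
         (auto simp: xrow_def yrow_def hrow_cases canf_imp cane_imp distrib_left distrib_right,
          auto simp: q_def algebra_simps)
  qed
qed

text \<open>With n(t) = x(t) y(-1/t) x(t), the coroot element is n(t) times the inverse of n(1).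
  This puts the torus inside the group generated by the root elements.\<close>

lemma coroot_eq:
  assumes "i \<in> {1..n}" "2 \<le> n" "t \<noteq> 0"
  shows "coroot_elt n i t =
    x_elt n i t * y_elt n i (- 1 / t) * x_elt n i t * (x_elt n i (- 1) * y_elt n i 1 * x_elt n i (- 1))"
proof -
  note rx = row_rep_x[OF assms(1,2)] and ry = row_rep_y[OF assms(1,2)]
  have i: "i \<le> n" using assms by simp
  show ?thesis
  proof (rule row_rep_unique[OF row_rep_h row_rep_mult[OF row_rep_mult[OF row_rep_mult[OF rx ry] rx]
        row_rep_mult[OF row_rep_mult[OF rx ry] rx]]])
    fix r :: row and D
    show "hrow n i t r D =
         xrow n i (- 1) (yrow n i 1 (xrow n i (- 1)
             (xrow n i t (yrow n i (- 1 / t) (xrow n i t r))))) D"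
      using assms i
      by (cases "canf n i D"; cases "cane n i D")
         (auto simp: xrow_def yrow_def hrow_cases canf_imp cane_imp field_simps)
  qed
qed

lemma row_rep_list:
  "(\<And>x. x \<in> set xs \<Longrightarrow> row_rep n (M x) (F x)) \<Longrightarrow>
    row_rep n (mat_list_prod (2 ^ n) (map M xs)) (fold F xs)"
proof (induction xs)
  case Nil
  show ?case unfolding mat_list_prod_def list.map foldr.simps id_apply by (rule row_rep_eqI[OF row_rep_one]) simp
next
  case (Cons a xs)
  have "row_rep n (M a * mat_list_prod (2 ^ n) (map M xs)) (\<lambda>r. fold F xs (F a r))"
    by (rule row_rep_mult) (use Cons in auto)
  then show ?case by (simp add: mat_list_prod_def comp_def)
qed

section \<open>The maximal torus and its characters\<close>

definition torus_char :: "nat \<Rightarrow> (nat \<Rightarrow> complex) \<Rightarrow> nat set \<Rightarrow> complex" where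
  "torus_char n \<tau> D = (\<Prod>j = 1..n. \<tau> j powi h_eigenvalue n j D)"

definition trow :: "nat \<Rightarrow> (nat \<Rightarrow> complex) \<Rightarrow> row \<Rightarrow> row" where
  "trow n \<tau> r D = torus_char n \<tau> D * r D"

lemma fold_hrow:
  "fold (\<lambda>j. hrow n j (\<tau> j)) xs r D = prod_list (map (\<lambda>j. \<tau> j powi h_eigenvalue n j D) xs) * r D"
  by (induction xs arbitrary: r) (simp_all add: hrow_def)

lemma row_rep_torus: "row_rep n (torus_elt n \<tau>) (trow n \<tau>)"
  unfolding torus_elt_def
proof (rule row_rep_eqI[OF row_rep_list])
  fix r :: row and D
  have "prod_list (map (\<lambda>j. \<tau> j powi h_eigenvalue n j D) [1..<n + 1]) = torus_char n \<tau> D"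
    unfolding torus_char_def
    by (subst prod.distinct_set_conv_list[symmetric]) (auto intro!: prod.cong)
  then show "fold (\<lambda>j. hrow n j (\<tau> j)) [1..<n + 1] r D = trow n \<tau> r D"
    by (simp only: fold_hrow trow_def)
qed (rule row_rep_h)

lemma torus_carrier: "torus_elt n \<tau> \<in> carrier_mat (2 ^ n) (2 ^ n)"
  by (rule row_rep_carrier[OF row_rep_torus])

lemma torus_mult: "torus_elt n \<tau> * torus_elt n \<sigma> = torus_elt n (\<lambda>j. \<tau> j * \<sigma> j)"
  by (rule row_rep_unique[OF row_rep_mult[OF row_rep_torus row_rep_torus] row_rep_torus])
     (simp add: trow_def torus_char_def power_int_mult_distrib prod.distrib)

lemma torus_one: "torus_elt n (\<lambda>_. 1) = 1\<^sub>m (2 ^ n)"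
  by (rule row_rep_unique[OF row_rep_torus row_rep_one]) (simp add: trow_def torus_char_def)

lemma coroot_torus:
  assumes "i \<in> {1..n}"
  shows "coroot_elt n i t = torus_elt n (\<lambda>j. if j = i then t else 1)"
proof (rule row_rep_unique[OF row_rep_h row_rep_torus])
  fix r :: row and D
  have "torus_char n (\<lambda>j. if j = i then t else 1) D =
      (\<Prod>j = 1..n. if j = i then t powi h_eigenvalue n j D else 1)"
    unfolding torus_char_def by (intro prod.cong) auto
  also have "\<dots> = t powi h_eigenvalue n i D" using assms by simp
  finally show "hrow n i t r D = trow n (\<lambda>j. if j = i then t else 1) r D"
    by (simp add: hrow_def trow_def)
qed

definition torus_root :: "nat \<Rightarrow> (nat \<Rightarrow> complex) \<Rightarrow> nat \<Rightarrow> complex" where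
  "torus_root n \<tau> j = (\<Prod>l = 1..n. \<tau> l powi cartan n l j)"

lemma torus_char_eset:
  assumes "cane n j D" "j \<in> {1..n}" "4 \<le> n" "\<And>l. l \<in> {1..n} \<Longrightarrow> \<tau> l \<noteq> 0"
  shows "torus_char n \<tau> (eset n j D) = torus_root n \<tau> j * torus_char n \<tau> D"
  unfolding torus_char_def torus_root_def prod.distrib[symmetric]
  using assms by (intro prod.cong refl) (simp add: h_eset power_int_add)

lemma torus_root_nonzero:
  "(\<And>l. l \<in> {1..n} \<Longrightarrow> \<tau> l \<noteq> 0) \<Longrightarrow> torus_root n \<tau> j \<noteq> 0"
  by (auto simp: torus_root_def power_int_eq_0_iff)

lemma x_torus:
  assumes "j \<in> {1..n}" "4 \<le> n" "\<And>l. l \<in> {1..n} \<Longrightarrow> \<tau> l \<noteq> 0"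
  shows "x_elt n j b * torus_elt n \<tau> = torus_elt n \<tau> * x_elt n j (b / torus_root n \<tau> j)"
proof -
  have n: "2 \<le> n" using assms by simp
  show ?thesis
  proof (rule row_rep_unique[OF row_rep_mult[OF row_rep_x[OF assms(1) n] row_rep_torus]
          row_rep_mult[OF row_rep_torus row_rep_x[OF assms(1) n]]])
    fix r :: row and D
    have "torus_char n \<tau> (eset n j D) = torus_root n \<tau> j * torus_char n \<tau> D" if "cane n j D"
      using torus_char_eset[of n j D \<tau>] assms that by simp
    then show "trow n \<tau> (xrow n j b r) D = xrow n j (b / torus_root n \<tau> j) (trow n \<tau> r) D"
      using torus_root_nonzero[of n \<tau> j] assms(3)
      by (auto simp: xrow_def trow_def distrib_left)
  qed
qed

lemma torus_y:
  assumes "j \<in> {1..n}" "4 \<le> n" "\<And>l. l \<in> {1..n} \<Longrightarrow> \<tau> l \<noteq> 0"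
  shows "torus_elt n \<tau> * y_elt n j b = y_elt n j (b / torus_root n \<tau> j) * torus_elt n \<tau>"
proof -
  have n: "2 \<le> n" using assms by simp
  show ?thesis
  proof (rule row_rep_unique[OF row_rep_mult[OF row_rep_torus row_rep_y[OF assms(1) n]]
          row_rep_mult[OF row_rep_y[OF assms(1) n] row_rep_torus]])
    fix r :: row and D
    have "torus_char n \<tau> D = torus_root n \<tau> j * torus_char n \<tau> (fset n j D)" if "canf n j D"
      using torus_char_eset[of n j "fset n j D" \<tau>] assms that by (simp add: canf_imp)
    then show "yrow n j b (trow n \<tau> r) D = trow n \<tau> (yrow n j (b / torus_root n \<tau> j) r) D"
      using torus_root_nonzero[of n \<tau> j] assms(3)
      by (auto simp: yrow_def trow_def distrib_left)
  qed
qed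

section \<open>Density of the big cell\<close>

lemma mat_poly_sum:
  "finite A \<Longrightarrow> (\<And>a. a \<in> A \<Longrightarrow> f a \<in> mat_polynomials d) \<Longrightarrow>
    (\<lambda>g. \<Sum>a\<in>A. f a g) \<in> mat_polynomials d"
proof (induction rule: finite_induct)
  case empty then show ?case using mat_polynomials.const[of 0] by simp
next
  case (insert x F)
  then have "(\<lambda>g. f x g + (\<Sum>a\<in>F. f a g)) \<in> mat_polynomials d"
    by (intro mat_polynomials.add) auto
  with insert show ?case by simp
qed

text \<open>Right translation preserves polynomial functions. This is what transports vanishing
  conditions along the group.\<close>

lemma mat_poly_right_mult:
  assumes "p \<in> mat_polynomials d" "C \<in> carrier_mat d d"
  shows "\<exists>p'\<in>mat_polynomials d. \<forall>g\<in>carrier_mat d d. p' g = p (g * C)"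
  using assms(1)
proof induction
  case (const a)
  show ?case by (rule bexI[OF _ mat_polynomials.const[of a]]) simp
next
  case (entry r c)
  have "(\<lambda>g. \<Sum>k\<in>{0..<d}. g $$ (r, k) * C $$ (k, c)) \<in> mat_polynomials d"
    using entry by (intro mat_poly_sum mat_polynomials.mult mat_polynomials.entry mat_polynomials.const) auto
  moreover have "(\<Sum>k\<in>{0..<d}. g $$ (r, k) * C $$ (k, c)) = (g * C) $$ (r, c)"
    if "g \<in> carrier_mat d d" for g
    using that assms(2) entry by (auto simp: scalar_prod_def intro!: sum.cong)
  ultimately show ?case by (intro bexI[of _ "\<lambda>g. \<Sum>k\<in>{0..<d}. g $$ (r, k) * C $$ (k, c)"]) auto
next
  case (add p q)
  then obtain p' q' where "p' \<in> mat_polynomials d" "q' \<in> mat_polynomials d"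
    "\<forall>g\<in>carrier_mat d d. p' g = p (g * C)" "\<forall>g\<in>carrier_mat d d. q' g = q (g * C)" by blast
  then show ?case by (intro bexI[of _ "\<lambda>g. p' g + q' g"]) (auto intro: mat_polynomials.add)
next
  case (mult p q)
  then obtain p' q' where "p' \<in> mat_polynomials d" "q' \<in> mat_polynomials d"
    "\<forall>g\<in>carrier_mat d d. p' g = p (g * C)" "\<forall>g\<in>carrier_mat d d. q' g = q (g * C)" by blast
  then show ?case by (intro bexI[of _ "\<lambda>g. p' g * q' g"]) (auto intro: mat_polynomials.mult)
qed

text \<open>\<open>y_elt n i s\<close> is affine in \<open>s\<close>, so along a root subgroup a
  polynomial on matrices becomes a polynomial in one variable, with finitely many roots unless it is
  zero.\<close>

lemma mat_poly_line:
  assumes "p \<in> mat_polynomials d" "A \<in> carrier_mat d d" "B \<in> carrier_mat d d"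
  shows "\<exists>q. \<forall>s. p (A + s \<cdot>\<^sub>m B) = poly q s"
  using assms(1)
proof induction
  case (const a)
  show ?case by (rule exI[of _ "[:a:]"]) simp
next
  case (entry r c)
  show ?case by (rule exI[of _ "[:A $$ (r, c), B $$ (r, c):]"]) (use entry assms in auto)
next
  case (add p q)
  then obtain p' q' where "\<forall>s. p (A + s \<cdot>\<^sub>m B) = poly p' s" "\<forall>s. q (A + s \<cdot>\<^sub>m B) = poly q' s" by blast
  then show ?case by (intro exI[of _ "p' + q'"]) simp
next
  case (mult p q)
  then obtain p' q' where "\<forall>s. p (A + s \<cdot>\<^sub>m B) = poly p' s" "\<forall>s. q (A + s \<cdot>\<^sub>m B) = poly q' s" by blast
  then show ?case by (intro exI[of _ "p' * q'"]) simp
qed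

text \<open>If the generating set is closed under inverses, the inverse case of
  \<open>generate\<close> is again a generator, and only products remain to be checked.\<close>

lemma generate_closed:
  assumes G: "group G" and S: "S \<subseteq> carrier G" "\<And>s. s \<in> S \<Longrightarrow> inv\<^bsub>G\<^esub> s \<in> S"
    and Q: "\<one>\<^bsub>G\<^esub> \<in> Q" "S \<subseteq> Q"
      "\<And>a b. a \<in> generate G S \<Longrightarrow> b \<in> generate G S \<Longrightarrow> a \<in> Q \<Longrightarrow> b \<in> Q \<Longrightarrow> a \<otimes>\<^bsub>G\<^esub> b \<in> Q"
  shows "generate G S \<subseteq> Q"
proof
  fix g assume "g \<in> generate G S"
  then show "g \<in> Q"
  proof induction
    case (eng h1 h2) then show ?case using Q(3) by blast
  qed (use Q S in auto)
qed

section \<open>The spin group and its unipotent subgroups\<close>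

lemma group_GL: "group (GL d)"
  unfolding GL_def by (intro monoid.units_group ring.is_monoid ring_mat)

lemma GL_simps: "x \<otimes>\<^bsub>GL d\<^esub> y = x * y" "\<one>\<^bsub>GL d\<^esub> = 1\<^sub>m d"
  by (simp_all add: GL_def units_of_def ring_mat_def)

lemma GL_carrierI:
  assumes "x \<in> carrier_mat d d" "y \<in> carrier_mat d d" "x * y = 1\<^sub>m d" "y * x = 1\<^sub>m d"
  shows "x \<in> carrier (GL d)"
  using assms by (auto simp: GL_def units_of_def Units_def ring_mat_def)

lemma GL_carrierD: "x \<in> carrier (GL d) \<Longrightarrow> x \<in> carrier_mat d d"
  by (auto simp: GL_def units_of_def Units_def ring_mat_def)

lemma spin_simps: "x \<otimes>\<^bsub>spin_group n\<^esub> y = x * y" "\<one>\<^bsub>spin_group n\<^esub> = 1\<^sub>m (2 ^ n)"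
  by (simp_all add: spin_group_def GL_simps)

locale type_d =
  fixes n :: nat
  assumes n4: "4 \<le> n"
begin

lemma n2: "2 \<le> n" using n4 by simp

abbreviation CM where "CM \<equiv> carrier_mat (2 ^ n) (2 ^ n) :: complex mat set"
abbreviation GG where "GG \<equiv> spin_group n"

lemma x_CM: "i \<in> {1..n} \<Longrightarrow> x_elt n i t \<in> CM"
  by (rule row_rep_carrier[OF row_rep_x[OF _ n2]])

lemma y_CM: "i \<in> {1..n} \<Longrightarrow> y_elt n i t \<in> CM"
  by (rule row_rep_carrier[OF row_rep_y[OF _ n2]])

lemma x_inv: "i \<in> {1..n} \<Longrightarrow> x_elt n i t * x_elt n i (- t) = 1\<^sub>m (2 ^ n)"
  by (simp add: x_elt_add x_elt_zero n2)

lemma y_inv: "i \<in> {1..n} \<Longrightarrow> y_elt n i t * y_elt n i (- t) = 1\<^sub>m (2 ^ n)"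
  by (simp add: y_elt_add y_elt_zero n2)

abbreviation XS where "XS \<equiv> {x_elt n i t | i t. i \<in> {1..n}}"
abbreviation YS where "YS \<equiv> {y_elt n i t | i t. i \<in> {1..n}}"

lemma gens_GL: "XS \<union> YS \<subseteq> carrier (GL (2 ^ n))"
proof
  fix g assume "g \<in> XS \<union> YS"
  then obtain i t where i: "i \<in> {1..n}" and "g = x_elt n i t \<or> g = y_elt n i t" by blast
  then show "g \<in> carrier (GL (2 ^ n))"
    using x_inv[OF i, of t] x_inv[OF i, of "- t"] y_inv[OF i, of t] y_inv[OF i, of "- t"]
      GL_carrierI[OF x_CM[OF i] x_CM[OF i], of t "- t"] GL_carrierI[OF y_CM[OF i] y_CM[OF i], of t "- t"]
    by auto
qed

lemma spin_carrier: "carrier GG = generate (GL (2 ^ n)) (XS \<union> YS)"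
  by (simp add: spin_group_def)

lemma group_spin: "group GG"
proof -
  interpret group "GL (2 ^ n)" by (rule group_GL)
  have "subgroup (generate (GL (2 ^ n)) (XS \<union> YS)) (GL (2 ^ n))"
    by (rule generate_is_subgroup[OF gens_GL])
  then show ?thesis
    unfolding spin_group_def by (rule subgroup.subgroup_is_group) (rule group_GL)
qed

lemma gens_spin: "XS \<union> YS \<subseteq> carrier GG"
  unfolding spin_carrier by (intro subsetI generate.incl)

lemma spin_CM: "g \<in> carrier GG \<Longrightarrow> g \<in> CM"
proof -
  interpret group "GL (2 ^ n)" by (rule group_GL)
  assume "g \<in> carrier GG"
  then have "g \<in> carrier (GL (2 ^ n))"
    unfolding spin_carrier using generate_incl[OF gens_GL] by blast
  then show ?thesis by (rule GL_carrierD)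
qed

lemma spin_inv_eq: "x \<in> carrier GG \<Longrightarrow> y \<in> carrier GG \<Longrightarrow> y * x = 1\<^sub>m (2 ^ n) \<Longrightarrow> inv\<^bsub>GG\<^esub> x = y"
  using group.inv_equality[OF group_spin] by (simp add: spin_simps)

lemma spin_mult: "x \<in> carrier GG \<Longrightarrow> y \<in> carrier GG \<Longrightarrow> x * y \<in> carrier GG"
  using monoid.m_closed[OF group.is_monoid[OF group_spin]] by (simp add: spin_simps)

lemma spin_one: "1\<^sub>m (2 ^ n) \<in> carrier GG"
  using monoid.one_closed[OF group.is_monoid[OF group_spin]] by (simp add: spin_simps)

lemma x_spin: "i \<in> {1..n} \<Longrightarrow> x_elt n i t \<in> carrier GG"
  using gens_spin by blast

lemma y_spin: "i \<in> {1..n} \<Longrightarrow> y_elt n i t \<in> carrier GG"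
  using gens_spin by blast

lemma inv_x: "i \<in> {1..n} \<Longrightarrow> inv\<^bsub>GG\<^esub> x_elt n i t = x_elt n i (- t)"
  using x_inv[of i "- t"] by (intro spin_inv_eq x_spin) auto

lemma inv_y: "i \<in> {1..n} \<Longrightarrow> inv\<^bsub>GG\<^esub> y_elt n i t = y_elt n i (- t)"
  using y_inv[of i "- t"] by (intro spin_inv_eq y_spin) auto

lemma coroot_spin:
  assumes "i \<in> {1..n}" "t \<noteq> 0"
  shows "coroot_elt n i t \<in> carrier GG"
  unfolding coroot_eq[OF assms(1) n2 assms(2)]
  using assms by (intro spin_mult x_spin y_spin)

lemma spin_list: "(\<And>x. x \<in> set xs \<Longrightarrow> M x \<in> carrier GG) \<Longrightarrow> mat_list_prod (2 ^ n) (map M xs) \<in> carrier GG"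
  by (induction xs) (auto simp: mat_list_prod_def spin_one spin_mult)

lemma torus_spin: "(\<And>j. j \<in> {1..n} \<Longrightarrow> \<tau> j \<noteq> 0) \<Longrightarrow> torus_elt n \<tau> \<in> carrier GG"
  unfolding torus_elt_def by (intro spin_list coroot_spin) auto

lemma U_plus_spin: "U_plus n \<subseteq> carrier GG"
  unfolding U_plus_def using gens_spin by (intro group.generate_incl[OF group_spin]) auto

lemma U_minus_spin: "U_minus n \<subseteq> carrier GG"
  unfolding U_minus_def using gens_spin by (intro group.generate_incl[OF group_spin]) auto

lemma U_plus_mult: "u \<in> U_plus n \<Longrightarrow> v \<in> U_plus n \<Longrightarrow> u * v \<in> U_plus n"
  unfolding U_plus_def using generate.eng[of u GG XS v] by (simp add: spin_simps)

lemma U_minus_mult: "u \<in> U_minus n \<Longrightarrow> v \<in> U_minus n \<Longrightarrow> u * v \<in> U_minus n"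
  unfolding U_minus_def using generate.eng[of u GG YS v] by (simp add: spin_simps)

lemma x_U_plus: "i \<in> {1..n} \<Longrightarrow> x_elt n i t \<in> U_plus n"
  unfolding U_plus_def by (intro generate.incl) blast

lemma y_U_minus: "i \<in> {1..n} \<Longrightarrow> y_elt n i t \<in> U_minus n"
  unfolding U_minus_def by (intro generate.incl) blast

lemma one_U_plus: "1\<^sub>m (2 ^ n) \<in> U_plus n"
  unfolding U_plus_def using generate.one[of GG XS] by (simp add: spin_simps)

lemma one_U_minus: "1\<^sub>m (2 ^ n) \<in> U_minus n"
  unfolding U_minus_def using generate.one[of GG YS] by (simp add: spin_simps)

lemma mm_assoc: "A \<in> CM \<Longrightarrow> B \<in> CM \<Longrightarrow> C \<in> CM \<Longrightarrow> A * B * C = A * (B * C)"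
  by (rule assoc_mult_mat)

lemma mm_closed: "A \<in> CM \<Longrightarrow> B \<in> CM \<Longrightarrow> A * B \<in> CM"
  by (rule mult_carrier_mat)

lemma U_plus_closed:
  assumes "1\<^sub>m (2 ^ n) \<in> Q" "\<And>i t. i \<in> {1..n} \<Longrightarrow> x_elt n i t \<in> Q"
    "\<And>a b. a \<in> U_plus n \<Longrightarrow> b \<in> U_plus n \<Longrightarrow> a \<in> Q \<Longrightarrow> b \<in> Q \<Longrightarrow> a * b \<in> Q"
  shows "U_plus n \<subseteq> Q"
  unfolding U_plus_def
proof (rule generate_closed[OF group_spin])
  fix s assume "s \<in> XS"
  then obtain i t where "i \<in> {1..n}" "s = x_elt n i t" by blast
  then show "inv\<^bsub>GG\<^esub> s \<in> XS" using inv_x[of i t] by blast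
next
  show "a \<otimes>\<^bsub>GG\<^esub> b \<in> Q" if "a \<in> generate GG XS" "b \<in> generate GG XS" "a \<in> Q" "b \<in> Q" for a b
    unfolding spin_simps by (rule assms(3)) (use that in \<open>simp_all only: U_plus_def\<close>)
qed (use assms(1,2) gens_spin in \<open>auto simp: spin_simps\<close>)

lemma U_minus_closed:
  assumes "1\<^sub>m (2 ^ n) \<in> Q" "\<And>i t. i \<in> {1..n} \<Longrightarrow> y_elt n i t \<in> Q"
    "\<And>a b. a \<in> U_minus n \<Longrightarrow> b \<in> U_minus n \<Longrightarrow> a \<in> Q \<Longrightarrow> b \<in> Q \<Longrightarrow> a * b \<in> Q"
  shows "U_minus n \<subseteq> Q"
  unfolding U_minus_def
proof (rule generate_closed[OF group_spin])
  fix s assume "s \<in> YS"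
  then obtain i t where "i \<in> {1..n}" "s = y_elt n i t" by blast
  then show "inv\<^bsub>GG\<^esub> s \<in> YS" using inv_y[of i t] by blast
next
  show "a \<otimes>\<^bsub>GG\<^esub> b \<in> Q" if "a \<in> generate GG YS" "b \<in> generate GG YS" "a \<in> Q" "b \<in> Q" for a b
    unfolding spin_simps by (rule assms(3)) (use that in \<open>simp_all only: U_minus_def\<close>)
qed (use assms(1,2) gens_spin in \<open>auto simp: spin_simps\<close>)

abbreviation nz :: "(nat \<Rightarrow> complex) \<Rightarrow> bool" where
  "nz \<tau> \<equiv> \<forall>j\<in>{1..n}. \<tau> j \<noteq> 0"

lemma U_plus_torus:
  assumes "v \<in> U_plus n" "nz \<tau>"
  shows "\<exists>v'\<in>U_plus n. v * torus_elt n \<tau> = torus_elt n \<tau> * v'"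
proof -
  note T = torus_carrier[of n \<tau>]
  have "U_plus n \<subseteq> {v \<in> CM. \<exists>v'\<in>U_plus n. v * torus_elt n \<tau> = torus_elt n \<tau> * v'}"
  proof (rule U_plus_closed)
    show "1\<^sub>m (2 ^ n) \<in> {v \<in> CM. \<exists>v'\<in>U_plus n. v * torus_elt n \<tau> = torus_elt n \<tau> * v'}"
      using T one_U_plus by (auto intro!: bexI[of _ "1\<^sub>m (2 ^ n)"])
  next
    fix i t assume "i \<in> {1..n}"
    then show "x_elt n i t \<in> {v \<in> CM. \<exists>v'\<in>U_plus n. v * torus_elt n \<tau> = torus_elt n \<tau> * v'}"
      using x_torus[of i n \<tau> t] n4 assms(2) x_U_plus x_CM by auto
  next
    fix a b assume "a \<in> {v \<in> CM. \<exists>v'\<in>U_plus n. v * torus_elt n \<tau> = torus_elt n \<tau> * v'}"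
      "b \<in> {v \<in> CM. \<exists>v'\<in>U_plus n. v * torus_elt n \<tau> = torus_elt n \<tau> * v'}"
    then obtain a' b' where ab: "a \<in> CM" "b \<in> CM" "a' \<in> U_plus n" "b' \<in> U_plus n"
      "a * torus_elt n \<tau> = torus_elt n \<tau> * a'" "b * torus_elt n \<tau> = torus_elt n \<tau> * b'" by blast
    then have c: "a' \<in> CM" "b' \<in> CM" using U_plus_spin spin_CM by auto
    have "a * b * torus_elt n \<tau> = a * (torus_elt n \<tau> * b')"
      using ab c T by (simp add: mm_assoc)
    also have "\<dots> = a * torus_elt n \<tau> * b'"
      by (rule mm_assoc[symmetric]) (use ab c T in auto)
    also have "\<dots> = torus_elt n \<tau> * (a' * b')"
      unfolding ab(5) by (rule mm_assoc) (use ab c T in auto)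
    finally show "a * b \<in> {v \<in> CM. \<exists>v'\<in>U_plus n. v * torus_elt n \<tau> = torus_elt n \<tau> * v'}"
      using ab U_plus_mult by auto
  qed
  then show ?thesis using assms by blast
qed

text \<open>\<open>a\<close> is the coordinate of \<open>v\<close> along the simple root
  \<open>i\<close>: if \<open>v\<close> is a product of root elements, it is the sum of the
  parameters of those with index \<open>i\<close>. The lowering element can pass through
  \<open>v\<close> unless \<open>1 + a * s\<close> vanishes.\<close>

definition ymoves :: "nat \<Rightarrow> complex \<Rightarrow> complex mat \<Rightarrow> complex \<Rightarrow> bool" where
  "ymoves i a v s \<longleftrightarrow> 1 + a * s \<noteq> 0 \<and> (\<exists>\<tau> v'. nz \<tau> \<and> v' \<in> U_plus n \<and>
     v * y_elt n i s = y_elt n i (s / (1 + a * s)) * torus_elt n \<tau> * v')"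

lemma finite_linear_zero: "finite {s :: complex. 1 + a * s = 0}"
proof (cases "a = 0")
  case False
  then have "{s. 1 + a * s = 0} \<subseteq> {- 1 / a}"
    by (auto simp: field_simps eq_neg_iff_add_eq_0 add.commute)
  then show ?thesis by (rule finite_subset) simp
qed simp

lemma ymoves_one: "i \<in> {1..n} \<Longrightarrow> ymoves i 0 (1\<^sub>m (2 ^ n)) s"
  unfolding ymoves_def using one_U_plus y_CM[of i s]
  by (auto intro!: exI[of _ "\<lambda>_. 1"] exI[of _ "1\<^sub>m (2 ^ n)"] simp: torus_one)

text \<open>For \<open>j\<close> different from \<open>i\<close> the new factor commutes with the
  lowering element that arrives. For \<open>j = i\<close> the rank-one factorisation is applied with
  \<open>s / (1 + a * s)\<close> in place of \<open>s\<close>, and the two denominators combine to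
  \<open>1 + (a + b) * s\<close>.\<close>

lemma ymoves_x:
  assumes i: "i \<in> {1..n}" and j: "j \<in> {1..n}" and v: "v \<in> CM" and m: "ymoves i a v s"
    and nz': "j = i \<longrightarrow> 1 + (a + b) * s \<noteq> 0"
  shows "ymoves i (if j = i then a + b else a) (x_elt n j b * v) s"
proof -
  from m obtain \<tau> v' where q: "1 + a * s \<noteq> 0" and \<tau>: "nz \<tau>" and v': "v' \<in> U_plus n"
    and e: "v * y_elt n i s = y_elt n i (s / (1 + a * s)) * torus_elt n \<tau> * v'"
    by (auto simp: ymoves_def)
  let ?s = "s / (1 + a * s)" and ?T = "torus_elt n \<tau>"
  have c: "v' \<in> CM" "?T \<in> CM" "x_elt n j b \<in> CM" "\<And>s. y_elt n i s \<in> CM" "v \<in> CM" "\<And>b. x_elt n j b \<in> CM"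
    using v' U_plus_spin spin_CM torus_carrier x_CM[OF j] y_CM[OF i] v by auto
  have 1: "x_elt n j b * v * y_elt n i s = x_elt n j b * y_elt n i ?s * (?T * v')"
    using c e by (simp add: mm_assoc mm_closed)
  show ?thesis
  proof (cases "j = i")
    case False
    obtain v2 where v2: "v2 \<in> U_plus n" "x_elt n j b * ?T = ?T * v2"
      using U_plus_torus[OF x_U_plus[OF j] \<tau>] by blast
    have c2: "v2 \<in> CM" using v2 U_plus_spin spin_CM by auto
    have "x_elt n j b * v * y_elt n i s = y_elt n i ?s * (x_elt n j b * ?T) * v'"
      unfolding 1 x_y_commute[OF i j False[symmetric] n4] using c by (simp add: mm_assoc mm_closed)
    also have "\<dots> = y_elt n i ?s * ?T * (v2 * v')"
      unfolding v2(2) using c c2 by (simp add: mm_assoc mm_closed)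
    finally show ?thesis
      using False q \<tau> U_plus_mult[OF v2(1) v'] by (auto simp: ymoves_def)
  next
    case True
    have nz2: "1 + (a + b) * s \<noteq> 0" using nz' True by simp
    have q2: "1 + b * ?s = (1 + (a + b) * s) / (1 + a * s)"
      using q by (simp add: field_simps)
    then have q3: "1 + b * ?s \<noteq> 0" using nz2 q by simp
    let ?q = "1 + b * ?s"
    let ?S = "torus_elt n (\<lambda>l. if l = i then ?q else 1)"
    have S: "?S \<in> CM" by (rule torus_carrier)
    obtain v2 where v2: "v2 \<in> U_plus n" "x_elt n j (b / ?q) * ?T = ?T * v2"
      using U_plus_torus[OF x_U_plus[OF j] \<tau>] by blast
    have c2: "v2 \<in> CM" using v2 U_plus_spin spin_CM by auto
    have sq: "?s / ?q = s / (1 + (a + b) * s)"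
      unfolding q2 using q nz2 by simp
    have "x_elt n j b * y_elt n i ?s = y_elt n i (?s / ?q) * ?S * x_elt n j (b / ?q)"
      using x_y_same[OF i n2 q3] unfolding True coroot_torus[OF i] .
    then have "x_elt n j b * v * y_elt n i s = y_elt n i (?s / ?q) * ?S * (x_elt n j (b / ?q) * ?T) * v'"
      unfolding 1 using c S by (simp add: mm_assoc mm_closed)
    also have "\<dots> = y_elt n i (?s / ?q) * (?S * ?T) * (v2 * v')"
      unfolding v2(2) using c c2 S by (simp add: mm_assoc mm_closed)
    finally have "x_elt n j b * v * y_elt n i s = y_elt n i (s / (1 + (a + b) * s)) *
        torus_elt n (\<lambda>l. (if l = i then ?q else 1) * \<tau> l) * (v2 * v')"
      unfolding torus_mult sq .
    moreover have "nz (\<lambda>l. (if l = i then ?q else 1) * \<tau> l)" using \<tau> q3 by simp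
    ultimately show ?thesis
      using True nz2 U_plus_mult[OF v2(1) v'] unfolding ymoves_def
      by (intro conjI exI[of _ "\<lambda>l. (if l = i then ?q else 1) * \<tau> l"] exI[of _ "v2 * v'"]) simp_all
  qed
qed

text \<open>The passage of a lowering element is controlled for one root element at a time, so
  elements are written as words. A finite word then excludes only finitely many parameters.\<close>

lemma U_plus_prod:
  "v \<in> U_plus n \<Longrightarrow> \<exists>L. (\<forall>p\<in>set L. fst p \<in> {1..n}) \<and> v = mat_list_prod (2 ^ n) (map (\<lambda>p. x_elt n (fst p) (snd p)) L)"
proof -
  let ?P = "\<lambda>v. \<exists>L. (\<forall>p\<in>set L. fst p \<in> {1..n}) \<and> v = mat_list_prod (2 ^ n) (map (\<lambda>p. x_elt n (fst p) (snd p)) L)"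
  have app: "mat_list_prod (2 ^ n) (map (\<lambda>p. x_elt n (fst p) (snd p)) (L @ L')) =
      mat_list_prod (2 ^ n) (map (\<lambda>p. x_elt n (fst p) (snd p)) L) * mat_list_prod (2 ^ n) (map (\<lambda>p. x_elt n (fst p) (snd p)) L')"
    if "\<forall>p\<in>set L. fst p \<in> {1..n}" "\<forall>p\<in>set L'. fst p \<in> {1..n}" for L L'
  proof -
    have c: "mat_list_prod (2 ^ n) (map (\<lambda>p. x_elt n (fst p) (snd p)) L) \<in> CM" if "\<forall>p\<in>set L. fst p \<in> {1..n}" for L
      using that by (intro spin_CM spin_list x_spin) auto
    show ?thesis using that
    proof (induction L)
      case Nil then show ?case using c[of L'] by (auto simp: mat_list_prod_def)
    next
      case (Cons p L)
      then show ?case using c[of L] c[of L'] x_CM[of "fst p" "snd p"]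
        by (cases p) (auto simp: mat_list_prod_def mm_assoc mm_closed)
    qed
  qed
  have "U_plus n \<subseteq> Collect ?P"
  proof (rule U_plus_closed)
    show "1\<^sub>m (2 ^ n) \<in> Collect ?P" by (auto intro!: exI[of _ "[]"] simp: mat_list_prod_def)
  next
    fix i t assume i: "i \<in> {1..n}"
    then show "x_elt n i t \<in> Collect ?P"
      using x_CM[OF i, of t] by (auto intro!: exI[of _ "[(i, t)]"] simp: mat_list_prod_def)
  next
    fix a b assume "a \<in> Collect ?P" "b \<in> Collect ?P"
    then obtain L L' where "\<forall>p\<in>set L. fst p \<in> {1..n}" "\<forall>p\<in>set L'. fst p \<in> {1..n}"
      "a = mat_list_prod (2 ^ n) (map (\<lambda>p. x_elt n (fst p) (snd p)) L)"
      "b = mat_list_prod (2 ^ n) (map (\<lambda>p. x_elt n (fst p) (snd p)) L')" by auto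
    then show "a * b \<in> Collect ?P"
      using app[of L L'] by (intro CollectI exI[of _ "L @ L'"]) auto
  qed
  then show "v \<in> U_plus n \<Longrightarrow> ?P v" by blast
qed

lemma U_plus_ymoves:
  assumes "v \<in> U_plus n" "i \<in> {1..n}"
  shows "\<exists>a. finite {s. \<not> ymoves i a v s}"
proof -
  from U_plus_prod[OF assms(1)] obtain L where L: "\<forall>p\<in>set L. fst p \<in> {1..n}"
    and v: "v = mat_list_prod (2 ^ n) (map (\<lambda>p. x_elt n (fst p) (snd p)) L)" by blast
  from L show ?thesis unfolding v
  proof (induction L)
    case Nil
    then show ?case using ymoves_one[OF assms(2)] by (intro exI[of _ 0]) (simp add: mat_list_prod_def)
  next
    case (Cons p L)
    obtain j b where p: "p = (j, b)" by fastforce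
    let ?v = "mat_list_prod (2 ^ n) (map (\<lambda>p. x_elt n (fst p) (snd p)) L)"
    have vc: "?v \<in> CM"
      using Cons.prems by (intro spin_CM spin_list x_spin) auto
    from Cons obtain a where a: "finite {s. \<not> ymoves i a ?v s}" by auto
    have j: "j \<in> {1..n}" using Cons.prems p by auto
    have "{s. \<not> ymoves i (if j = i then a + b else a) (x_elt n j b * ?v) s} \<subseteq>
        {s. \<not> ymoves i a ?v s} \<union> {s. 1 + (a + b) * s = 0}"
      using ymoves_x[OF assms(2) j vc] by blast
    then have "finite {s. \<not> ymoves i (if j = i then a + b else a) (x_elt n j b * ?v) s}"
      using a finite_linear_zero by (meson finite_UnI finite_subset)
    then show ?case using p by (auto simp: mat_list_prod_def)
  qed
qed

section \<open>The big cell and its Zariski closure\<close>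

definition cell :: "complex mat set" where
  "cell = {u * torus_elt n \<tau> * v | u \<tau> v. u \<in> U_minus n \<and> nz \<tau> \<and> v \<in> U_plus n}"

lemma cell_spin: "cell \<subseteq> carrier GG"
  using U_minus_spin U_plus_spin torus_spin by (auto simp: cell_def intro!: spin_mult)

lemma cell_one: "1\<^sub>m (2 ^ n) \<in> cell"
  unfolding cell_def using one_U_minus one_U_plus
  by (auto intro!: exI[of _ "1\<^sub>m (2 ^ n)"] exI[of _ "\<lambda>_. 1"] simp: torus_one)

lemma cell_mult_x: "g \<in> cell \<Longrightarrow> i \<in> {1..n} \<Longrightarrow> g * x_elt n i t \<in> cell"
proof -
  assume "g \<in> cell" and i: "i \<in> {1..n}"
  then obtain u \<tau> v where "u \<in> U_minus n" "nz \<tau>" "v \<in> U_plus n" and g: "g = u * torus_elt n \<tau> * v"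
    by (auto simp: cell_def)
  moreover from this have "u \<in> CM" "v \<in> CM" using U_plus_spin U_minus_spin spin_CM by auto
  then have "g * x_elt n i t = u * torus_elt n \<tau> * (v * x_elt n i t)"
    unfolding g using torus_carrier x_CM[OF i] by (intro mm_assoc) auto
  moreover have "v * x_elt n i t \<in> U_plus n" using \<open>v \<in> U_plus n\<close> x_U_plus[OF i] by (rule U_plus_mult)
  ultimately show ?thesis by (auto simp: cell_def)
qed

text \<open>After passing through \<open>v\<close>, the lowering element is conjugated through the
  torus, which rescales its parameter, and is absorbed by \<open>u\<close>.\<close>

lemma cell_mult_y:
  assumes "g \<in> cell" "i \<in> {1..n}"
  shows "finite {s. g * y_elt n i s \<notin> cell}"
proof -
  from assms obtain u \<tau> v where uv: "u \<in> U_minus n" "nz \<tau>" "v \<in> U_plus n" and g: "g = u * torus_elt n \<tau> * v"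
    by (auto simp: cell_def)
  obtain a where a: "finite {s. \<not> ymoves i a v s}" using U_plus_ymoves[OF uv(3) assms(2)] by blast
  have "g * y_elt n i s \<in> cell" if "ymoves i a v s" for s
  proof -
    from that obtain \<sigma> v' where s: "nz \<sigma>" "v' \<in> U_plus n"
      and e: "v * y_elt n i s = y_elt n i (s / (1 + a * s)) * torus_elt n \<sigma> * v'"
      by (auto simp: ymoves_def)
    have c: "u \<in> CM" "v \<in> CM" "v' \<in> CM" "\<And>\<tau>. torus_elt n \<tau> \<in> CM" "\<And>s. y_elt n i s \<in> CM"
      using uv s U_plus_spin U_minus_spin spin_CM torus_carrier y_CM assms(2) by auto
    obtain s' where s': "torus_elt n \<tau> * y_elt n i (s / (1 + a * s)) = y_elt n i s' * torus_elt n \<tau>"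
      using torus_y[OF assms(2) n4] uv(2) by blast
    have "g * y_elt n i s = u * (torus_elt n \<tau> * y_elt n i (s / (1 + a * s))) * torus_elt n \<sigma> * v'"
      unfolding g using c e by (simp add: mm_assoc mm_closed)
    also have "\<dots> = (u * y_elt n i s') * (torus_elt n \<tau> * torus_elt n \<sigma>) * v'"
      unfolding s' using c by (simp add: mm_assoc mm_closed)
    also have "\<dots> = (u * y_elt n i s') * torus_elt n (\<lambda>j. \<tau> j * \<sigma> j) * v'"
      by (simp only: torus_mult)
    finally show ?thesis
      unfolding cell_def using U_minus_mult[OF uv(1) y_U_minus[OF assms(2)]] uv s
      by (intro CollectI exI[of _ "u * y_elt n i s'"] exI[of _ "\<lambda>j. \<tau> j * \<sigma> j"] exI[of _ v']) auto
  qed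
  then have "{s. g * y_elt n i s \<notin> cell} \<subseteq> {s. \<not> ymoves i a v s}" by blast
  then show ?thesis using a by (rule finite_subset)
qed

definition zclosure :: "complex mat set" where
  "zclosure = {g \<in> CM. \<forall>p\<in>mat_polynomials (2 ^ n). (\<forall>h\<in>cell. p h = 0) \<longrightarrow> p g = 0}"

text \<open>The hypothesis concerns vanishing of polynomials and does not ask that translation by
  \<open>C\<close> preserve the cell, because a lowering element does carry some points out of
  it.\<close>

lemma zclosure_mult:
  assumes C: "C \<in> CM"
    and v: "\<And>p h. p \<in> mat_polynomials (2 ^ n) \<Longrightarrow> \<forall>h\<in>cell. p h = 0 \<Longrightarrow> h \<in> cell \<Longrightarrow> p (h * C) = 0"
    and g: "g \<in> zclosure"
  shows "g * C \<in> zclosure"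
  unfolding zclosure_def
proof (intro CollectI conjI ballI impI)
  show "g * C \<in> CM" using g C by (auto simp: zclosure_def)
  fix p assume p: "p \<in> mat_polynomials (2 ^ n)" "\<forall>h\<in>cell. p h = 0"
  obtain p' where p': "p' \<in> mat_polynomials (2 ^ n)" "\<forall>g\<in>CM. p' g = p (g * C)"
    using mat_poly_right_mult[OF p(1) C] by blast
  have "p' h = 0" if "h \<in> cell" for h
    using v[OF p that] p'(2) cell_spin spin_CM that by auto
  then show "p (g * C) = 0" using g p' by (auto simp: zclosure_def)
qed

lemma y_elt_line: "i \<in> {1..n} \<Longrightarrow> h \<in> CM \<Longrightarrow> h * y_elt n i s = h + s \<cdot>\<^sub>m (h * chev_f n i)"
  using chev_f_carrier[of n i] by (simp add: y_elt_eq[OF _ n2] mult_add_distrib_mat[of _ "2^n" "2^n" _ "2^n"]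
      mult_smult_distrib[of _ "2^n" "2^n" _ "2^n"])

lemma zclosure_gens:
  assumes "g \<in> zclosure" "i \<in> {1..n}"
  shows "g * x_elt n i t \<in> zclosure" "g * y_elt n i t \<in> zclosure"
proof -
  show "g * x_elt n i t \<in> zclosure"
    by (rule zclosure_mult[OF x_CM[OF assms(2)] _ assms(1)]) (use cell_mult_x assms(2) in blast)
  show "g * y_elt n i t \<in> zclosure"
  proof (rule zclosure_mult[OF y_CM[OF assms(2)] _ assms(1)])
    fix p h assume p: "p \<in> mat_polynomials (2 ^ n)" "\<forall>h\<in>cell. p h = 0" and h: "h \<in> cell"
    have hC: "h \<in> CM" using h cell_spin spin_CM by auto
    obtain q where q: "\<And>s. p (h + s \<cdot>\<^sub>m (h * chev_f n i)) = poly q s"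
      using mat_poly_line[OF p(1) hC, of "h * chev_f n i"] hC chev_f_carrier[of n i] by auto
    \<comment> \<open>For all but finitely many \<open>s\<close> the translate stays in the cell,
      where \<open>p\<close> vanishes. A polynomial with infinitely many roots is zero, so the
      exceptional parameters are covered as well.\<close>
    have "- {s. h * y_elt n i s \<notin> cell} \<subseteq> {s. poly q s = 0}"
      using p(2) q y_elt_line[OF assms(2) hC] by (auto simp flip: q)
    moreover have "infinite (- {s. h * y_elt n i s \<notin> cell})"
      using cell_mult_y[OF h assms(2)] infinite_UNIV_char_0 by (simp add: finite_compl)
    ultimately have "infinite {s. poly q s = 0}" using finite_subset by blast
    then have "q = 0" using poly_roots_finite by blast
    then show "p (h * y_elt n i t) = 0" using q[of t] y_elt_line[OF assms(2) hC] by simp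
  qed
qed

text \<open>The identity lies in the cell, and right translation by the generators never leaves its
  closure.\<close>

lemma spin_zclosure: "carrier GG \<subseteq> zclosure"
proof -
  have "carrier GG \<subseteq> {g \<in> CM. \<forall>z\<in>zclosure. z * g \<in> zclosure}" (is "_ \<subseteq> ?Q")
    unfolding spin_carrier
  proof (rule generate_closed[OF group_GL gens_GL])
    fix s assume "s \<in> XS \<union> YS"
    then obtain i t where i: "i \<in> {1..n}" and s: "s = x_elt n i t \<or> s = y_elt n i t" by blast
    have "inv\<^bsub>GL (2 ^ n)\<^esub> x_elt n i t = x_elt n i (- t)" "inv\<^bsub>GL (2 ^ n)\<^esub> y_elt n i t = y_elt n i (- t)"
      using x_inv[OF i, of "- t"] y_inv[OF i, of "- t"] gens_GL i
      by (auto intro!: group.inv_equality[OF group_GL] simp: GL_simps)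
    with s i show "inv\<^bsub>GL (2 ^ n)\<^esub> s \<in> XS \<union> YS" by auto
  next
    show "\<one>\<^bsub>GL (2 ^ n)\<^esub> \<in> ?Q" by (auto simp: GL_simps zclosure_def)
  next
    show "XS \<union> YS \<subseteq> ?Q" using zclosure_gens x_CM y_CM by auto
  next
    fix a b assume ab: "a \<in> ?Q" "b \<in> ?Q"
    then have "z * (a * b) = z * a * b" if "z \<in> zclosure" for z
      using that mm_assoc[of z a b] by (auto simp: zclosure_def)
    then show "a \<otimes>\<^bsub>GL (2 ^ n)\<^esub> b \<in> ?Q" using ab by (auto simp: GL_simps)
  qed
  moreover have "1\<^sub>m (2 ^ n) \<in> zclosure" using cell_one by (auto simp: zclosure_def)
  ultimately show ?thesis by (smt (verit, best) left_mult_one_mat mem_Collect_eq subset_iff)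
qed

text \<open>One polynomial with the right values on the cell resolves the definite description,
  since density forces every competitor to agree with it on the group. Restriction to the carrier
  turns this agreement into equality of functions.\<close>

lemma principal_minor_eqI:
  assumes p: "p \<in> mat_polynomials (2 ^ n)"
    and e: "\<And>u \<tau> v. u \<in> U_minus n \<Longrightarrow> nz \<tau> \<Longrightarrow> v \<in> U_plus n \<Longrightarrow> p (u * torus_elt n \<tau> * v) = \<tau> i"
    and g: "g \<in> carrier GG"
  shows "principal_minor n i g = p g"
proof -
  have cellI: "u * torus_elt n \<tau> * v \<in> cell" if "u \<in> U_minus n" "nz \<tau>" "v \<in> U_plus n" for u \<tau> v
    using that by (auto simp: cell_def)
  have "principal_minor n i = restrict p (carrier GG)"
    unfolding principal_minor_def
  proof (rule the_equality)
    show "restrict p (carrier GG) \<in> regular_functions n \<and>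
      (\<forall>u\<in>U_minus n. \<forall>\<tau>. \<forall>v\<in>U_plus n. nz \<tau> \<longrightarrow> restrict p (carrier GG) (u * torus_elt n \<tau> * v) = \<tau> i)"
      using p e subsetD[OF cell_spin cellI] by (auto simp: regular_functions_def)
  next
    fix \<Delta> assume \<Delta>: "\<Delta> \<in> regular_functions n \<and>
      (\<forall>u\<in>U_minus n. \<forall>\<tau>. \<forall>v\<in>U_plus n. nz \<tau> \<longrightarrow> \<Delta> (u * torus_elt n \<tau> * v) = \<tau> i)"
    then obtain q where q: "q \<in> mat_polynomials (2 ^ n)" "\<Delta> = restrict q (carrier GG)"
      by (auto simp: regular_functions_def)
    \<comment> \<open>The difference of the two polynomials, written with the constructors of
      \<open>mat_polynomials\<close>.\<close>
    let ?d = "\<lambda>g. p g + (\<lambda>_. - 1) g * q g"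
    have d: "?d \<in> mat_polynomials (2 ^ n)"
      using p q by (intro mat_polynomials.intros)
    have cell0: "?d h = 0" if "h \<in> cell" for h
    proof -
      from that obtain u \<tau> v where *: "u \<in> U_minus n" "nz \<tau>" "v \<in> U_plus n" "h = u * torus_elt n \<tau> * v"
        by (auto simp: cell_def)
      have "q h = \<Delta> h" using q(2) that cell_spin by auto
      then show ?thesis using * \<Delta> e by auto
    qed
    have "?d h = 0" if "h \<in> carrier GG" for h
    proof -
      have z: "\<forall>p\<in>mat_polynomials (2 ^ n). (\<forall>h\<in>cell. p h = 0) \<longrightarrow> p h = 0"
        using subsetD[OF spin_zclosure that] by (simp add: zclosure_def)
      from bspec[OF z d] show ?thesis using cell0 by blast
    qed
    then show "\<Delta> = restrict p (carrier GG)"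
      unfolding q(2) by (intro restrict_ext) auto
  qed
  then show ?thesis using g by simp
qed

end

section \<open>The Weyl group as signed permutations\<close>

text \<open>Simple reflections in \<epsilon>-coordinates, where the Weyl group becomes the group of
  signed permutations with an even number of sign changes.\<close>

definition sp :: "nat \<Rightarrow> nat \<Rightarrow> (nat \<Rightarrow> int) \<Rightarrow> (nat \<Rightarrow> int)" where
  "sp n p x = (\<lambda>i. if p < n then (if i = p then x (p + 1) else if i = p + 1 then x p else x i)
     else (if i = n - 1 then - x n else if i = n then - x (n - 1) else x i))"

definition root :: "nat \<Rightarrow> nat \<Rightarrow> (nat \<Rightarrow> int) \<Rightarrow> int" where
  "root n p x = (if p < n then x p - x (p + 1) else x (n - 1) + x n)"

text \<open>Here \<open>x\<close> are the \<open>\<epsilon>\<close>-coordinates of the weight; integral \<open>x\<close> only give weights with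
  \<open>\<mu> (n - 1) + \<mu> n\<close> even, which is why other weights are doubled below.\<close>

definition wt :: "nat \<Rightarrow> (nat \<Rightarrow> int) \<Rightarrow> (nat \<Rightarrow> int) \<Rightarrow> (nat \<Rightarrow> int)" where
  "wt n x ot j = (if j \<in> {1..n} then root n j x else ot j)"

lemma root_sp:
  assumes "j \<in> {1..n}" "p \<in> {1..n}" "4 \<le> n"
  shows "root n j (sp n p x) = root n j x - root n p x * cartan n j p"
proof -
  consider "j < n" "p < n" | "j < n" "p = n" | "j = n" "p < n" | "j = n" "p = n"
    using assms by fastforce
  then show ?thesis
  proof cases
    case 1
    consider "j = p" | "j = p + 1" | "p = j + 1" | "j \<noteq> p" "j \<noteq> p + 1" "p \<noteq> j + 1" by blast
    then show ?thesis using assms 1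
      by cases (simp_all add: root_def sp_def cartan_def doubleton_eq_iff)
  next
    case 2 then show ?thesis using assms
      by (cases "j = n - 1"; cases "j = n - 2")
         (auto simp: root_def sp_def cartan_def doubleton_eq_iff)
  next
    case 3 then show ?thesis using assms
      by (cases "p = n - 1"; cases "p = n - 2")
         (auto simp: root_def sp_def cartan_def doubleton_eq_iff)
  next
    case 4 then show ?thesis using assms
      by (auto simp: root_def sp_def cartan_def doubleton_eq_iff)
  qed
qed

lemma root_sp_self: "p \<in> {1..n} \<Longrightarrow> 4 \<le> n \<Longrightarrow> root n p (sp n p x) = - root n p x"
  by (auto simp: root_def sp_def)

lemma simple_refl_wt:
  assumes "p \<in> {1..n}" "4 \<le> n"
  shows "simple_refl n p (wt n x ot) = wt n (sp n p x) ot"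
proof
  fix j
  show "simple_refl n p (wt n x ot) j = wt n (sp n p x) ot j"
    using assms root_sp[of j n p x] by (auto simp: simple_refl_def wt_def cartan_def)
qed

definition spw :: "nat \<Rightarrow> nat list \<Rightarrow> (nat \<Rightarrow> int) \<Rightarrow> (nat \<Rightarrow> int)" where
  "spw n ws x = foldr (sp n) ws x"

lemma spw_simps [simp]: "spw n [] x = x" "spw n (p # ws) x = sp n p (spw n ws x)"
  by (simp_all add: spw_def)

lemma weyl_prod_Nil: "weyl_prod n [] = id"
  by (simp add: weyl_prod_def)

lemma weyl_prod_Cons: "weyl_prod n (p # ws) \<mu> = simple_refl n p (weyl_prod n ws \<mu>)"
  by (simp add: weyl_prod_def)

lemma weyl_prod_wt:
  assumes "ws \<in> lists {1..n}" "4 \<le> n"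
  shows "weyl_prod n ws (wt n x ot) = wt n (spw n ws x) ot"
  using assms by (induction ws) (auto simp: weyl_prod_Nil weyl_prod_Cons simple_refl_wt)

lemma weyl_prod_double: "weyl_prod n ws (\<lambda>j. 2 * \<mu> j) = (\<lambda>j. 2 * weyl_prod n ws \<mu> j)"
  by (induction ws) (auto simp: weyl_prod_Nil weyl_prod_Cons simple_refl_def algebra_simps)

lemma wt_cong:
  "(\<And>i. i \<in> {1..n} \<Longrightarrow> x i = y i) \<Longrightarrow> 4 \<le> n \<Longrightarrow> wt n x ot = wt n y ot"
  by (auto simp: wt_def root_def fun_eq_iff)

lemma double_wt:
  assumes "4 \<le> n"
  shows "\<exists>x ot. (\<lambda>j. 2 * \<mu> j) = wt n x ot"
proof -
  \<comment> \<open>Solution of \<open>root n j x = 2 * \<mu> j\<close>, found from the last two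
    coordinates downwards; for \<open>i = n - 1\<close> the sum is empty.\<close>
  define x where "x i = (if i = n then \<mu> n - \<mu> (n - 1)
     else 2 * (\<Sum>l = i..n - 2. \<mu> l) + \<mu> (n - 1) + \<mu> n)" for i
  have "2 * \<mu> j = wt n x (\<lambda>j. 2 * \<mu> j) j" for j
  proof -
    consider "j \<notin> {1..n}" | "j = n" | "j = n - 1" | "1 \<le> j" "j \<le> n - 2" using assms by fastforce
    then show ?thesis
    proof cases
      case 1 then show ?thesis by (auto simp: wt_def)
    next
      case 2 then show ?thesis using assms by (simp add: wt_def root_def x_def)
    next
      case 3 then show ?thesis using assms by (simp add: wt_def root_def x_def)
    next
      case 4
      then have "(\<Sum>l = j..n - 2. \<mu> l) = \<mu> j + (\<Sum>l = j + 1..n - 2. \<mu> l)"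
        using sum.atLeast_Suc_atMost[of j "n - 2" \<mu>] by (simp add: One_nat_def)
      with 4 assms show ?thesis by (simp add: wt_def root_def x_def One_nat_def)
    qed
  qed
  then show ?thesis by blast
qed

text \<open>Weyl group elements act linearly, so equality can be tested on doubled weights, all of
  which have integral \<epsilon>-coordinates.\<close>

lemma weyl_prod_eqI:
  assumes "ws \<in> lists {1..n}" "ws' \<in> lists {1..n}" "4 \<le> n"
    and "\<And>x i. i \<in> {1..n} \<Longrightarrow> spw n ws x i = spw n ws' x i"
  shows "weyl_prod n ws = weyl_prod n ws'"
proof
  fix \<mu>
  obtain x ot where x: "(\<lambda>j. 2 * \<mu> j) = wt n x ot" using double_wt[OF assms(3)] by blast
  have "(\<lambda>j. 2 * weyl_prod n ws \<mu> j) = (\<lambda>j. 2 * weyl_prod n ws' \<mu> j)"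
    unfolding weyl_prod_double[symmetric] x weyl_prod_wt[OF assms(1,3)] weyl_prod_wt[OF assms(2,3)]
    by (rule wt_cong) (use assms in auto)
  then show "weyl_prod n ws \<mu> = weyl_prod n ws' \<mu>" by (simp add: fun_eq_iff)
qed

lemma wt_inj:
  assumes "wt n x ot = wt n y ot" "4 \<le> n" "i \<in> {1..n}"
  shows "x i = y i"
proof -
  have r: "root n j x = root n j y" if "j \<in> {1..n}" for j
    using fun_cong[OF assms(1), of j] that by (simp add: wt_def)
  have n: "x n = y n" "x (n - 1) = y (n - 1)"
    using r[of n] r[of "n - 1"] assms(2) order.trans[of 1 3 "n - 1"] by (auto simp: root_def)
  have "x i = y i" if "1 \<le> i" "i \<le> n - 1" for i
    using that(2,1)
  proof (induction rule: inc_induct)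
    case base then show ?case using n by simp
  next
    case (step m)
    then have "m \<in> {1..n}" "m < n" by auto
    then show ?case using r[of m] step by (auto simp: root_def One_nat_def)
  qed
  then show ?thesis using assms(3) n by (cases "i = n") auto
qed

lemma weyl_prod_eqD:
  assumes "weyl_prod n ws = weyl_prod n ws'"
    and "ws \<in> lists {1..n}" "ws' \<in> lists {1..n}" "4 \<le> n" "i \<in> {1..n}"
  shows "spw n ws x i = spw n ws' x i"
proof (rule wt_inj)
  show "wt n (spw n ws x) (\<lambda>_. 0) = wt n (spw n ws' x) (\<lambda>_. 0)"
    using assms by (simp flip: weyl_prod_wt)
qed (use assms in auto)

lemma simple_refl_invol: "p \<in> {1..n} \<Longrightarrow> simple_refl n p (simple_refl n p \<mu>) = \<mu>"
  by (auto simp: simple_refl_def cartan_def fun_eq_iff algebra_simps)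

text \<open>The condition on the product says that the number of sign changes is even. It singles
  out type D inside the group of all signed permutations.\<close>

definition signed :: "nat \<Rightarrow> (nat \<Rightarrow> int) \<Rightarrow> (nat \<Rightarrow> nat) \<Rightarrow> bool" where
  "signed n s \<pi> \<longleftrightarrow> bij_betw \<pi> {1..n} {1..n} \<and> (\<forall>i\<in>{1..n}. s i = 1 \<or> s i = - 1) \<and> prod s {1..n} = 1"

lemma spw_signed:
  assumes "ws \<in> lists {1..n}" "4 \<le> n"
  shows "\<exists>s \<pi>. signed n s \<pi> \<and> (\<forall>x. \<forall>i\<in>{1..n}. spw n ws x i = s i * x (\<pi> i))"
  using assms(1)
proof (induction ws)
  case Nil
  show ?case by (rule exI[of _ "\<lambda>_. 1"], rule exI[of _ id]) (auto simp: signed_def bij_betw_def)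
next
  case (Cons p ws)
  then obtain s \<pi> where s: "signed n s \<pi>" and e: "\<And>x i. i \<in> {1..n} \<Longrightarrow> spw n ws x i = s i * x (\<pi> i)"
    by auto
  have p: "p \<in> {1..n}" using Cons by auto
  \<comment> \<open>The last reflection exchanges the same two coordinates as the one before it;
    only the signs \<open>t\<close> tell them apart.\<close>
  define q where "q = (if p < n then p else n - 1)"
  define \<tau> where "\<tau> i = (if i = q then q + 1 else if i = q + 1 then q else i)" for i
  define t :: "nat \<Rightarrow> int" where "t i = (if p < n \<or> i < n - 1 then 1 else - 1)" for i
  have q: "1 \<le> q" "q + 1 \<le> n" using p assms(2) by (auto simp: q_def)
  have sp: "sp n p x i = t i * x (\<tau> i)" if "i \<in> {1..n}" for x i
    using p assms(2) that by (auto simp: sp_def t_def \<tau>_def q_def)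
  have \<tau>: "bij_betw \<tau> {1..n} {1..n}"
    by (rule bij_betw_byWitness[of _ \<tau>]) (use q in \<open>auto simp: \<tau>_def\<close>)
  have \<tau>_in: "\<tau> i \<in> {1..n}" if "i \<in> {1..n}" for i using \<tau> that by (auto simp: bij_betw_def)
  have t: "prod t {1..n} = 1"
  proof -
    have "n \<noteq> n - 1" "\<not> n \<le> n - 2" "\<not> n - 1 \<le> n - 2" using assms(2) by linarith+
    moreover have "{1..n} = insert n (insert (n - 1) {1..n - 2})" using assms(2) by auto
    ultimately have "prod t {1..n} = t n * (t (n - 1) * prod t {1..n - 2})" by simp
    moreover have "prod t {1..n - 2} = 1" by (rule prod.neutral) (auto simp: t_def)
    moreover have "\<not> n < n - 1" by linarith
    ultimately show ?thesis by (simp add: t_def)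
  qed
  show ?case
  proof (intro exI conjI allI ballI)
    show "signed n (\<lambda>i. t i * s (\<tau> i)) (\<pi> \<circ> \<tau>)"
      unfolding signed_def
    proof (intro conjI ballI)
      show "bij_betw (\<pi> \<circ> \<tau>) {1..n} {1..n}"
        using bij_betw_trans[OF \<tau>, of \<pi>] s by (simp add: signed_def)
      show "(\<Prod>i = 1..n. t i * s (\<tau> i)) = 1"
        using t s prod.reindex_bij_betw[OF \<tau>, of s] by (simp add: prod.distrib signed_def)
      show "t i * s (\<tau> i) = 1 \<or> t i * s (\<tau> i) = - 1" if "i \<in> {1..n}" for i
        using s \<tau>_in[OF that] by (auto simp: signed_def t_def)
    qed
    show "spw n (p # ws) x i = t i * s (\<tau> i) * x ((\<pi> \<circ> \<tau>) i)" if "i \<in> {1..n}" for x i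
      using sp[OF that] e[OF \<tau>_in[OF that]] by simp
  qed
qed

section \<open>Counting positive roots\<close>

definition pairs :: "nat \<Rightarrow> (nat \<times> nat) set" where
  "pairs n = {(i, j). 1 \<le> i \<and> i < j \<and> j \<le> n}"

lemma finite_pairs [simp]: "finite (pairs n)"
  by (rule finite_subset[of _ "{..n} \<times> {..n}"]) (auto simp: pairs_def)

text \<open>Each pair stands for the two positive roots
  \<open>\<epsilon>\<^sub>i - \<epsilon>\<^sub>j\<close> and
  \<open>\<epsilon>\<^sub>i + \<epsilon>\<^sub>j\<close>, evaluated at two weights at once. In this
  way the length of an element and the later count of signs are instances of one statistic.\<close>

definition rsum :: "nat \<Rightarrow> (int \<Rightarrow> int \<Rightarrow> int) \<Rightarrow> (nat \<Rightarrow> int) \<Rightarrow> (nat \<Rightarrow> int) \<Rightarrow> int" where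
  "rsum n f x a = (\<Sum>(i, j)\<in>pairs n. f (x i - x j) (a i - a j) + f (x i + x j) (a i + a j))"

lemma rsum_cong:
  "(\<And>i. i \<in> {1..n} \<Longrightarrow> x i = x' i) \<Longrightarrow> (\<And>i. i \<in> {1..n} \<Longrightarrow> a i = a' i) \<Longrightarrow> rsum n f x a = rsum n f x' a'"
  unfolding rsum_def by (intro sum.cong refl) (auto simp: pairs_def)

text \<open>A simple reflection permutes the positive roots other than its own root, which it
  negates. Hence the sum changes only in one term.\<close>

lemma rsum_sp:
  assumes p: "p \<in> {1..n}" and n: "4 \<le> n"
  shows "rsum n f (sp n p x) (sp n p a) =
    rsum n f x a - f (root n p x) (root n p a) + f (- root n p x) (- root n p a)"
proof -
  define q where "q = (if p < n then p else n - 1)"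
  define \<tau> where "\<tau> i = (if i = q then q + 1 else if i = q + 1 then q else i)" for i
  define \<phi> where "\<phi> x a = (\<lambda>(i, j). f (x i - x j) (a i - a j) + f (x i + x j) (a i + a j))"
    for x a :: "nat \<Rightarrow> int"
  have q: "1 \<le> q" "q + 1 \<le> n" using p n by (auto simp: q_def)
  have qp: "(q, q + 1) \<in> pairs n" using q by (auto simp: pairs_def)
  have split: "rsum n f x a = \<phi> x a (q, q + 1) + sum (\<phi> x a) (pairs n - {(q, q + 1)})" for x a
    unfolding rsum_def \<phi>_def by (subst sum.remove[OF _ qp]) auto
  have "sum (\<phi> (sp n p x) (sp n p a)) (pairs n - {(q, q + 1)}) = sum (\<phi> x a) (pairs n - {(q, q + 1)})"
  proof (rule sum.reindex_bij_witness[of _ "map_prod \<tau> \<tau>" "map_prod \<tau> \<tau>"])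
    fix c assume c: "c \<in> pairs n - {(q, q + 1)}"
    show "map_prod \<tau> \<tau> (map_prod \<tau> \<tau> c) = c" by (cases c) (auto simp: \<tau>_def)
    show "map_prod \<tau> \<tau> c \<in> pairs n - {(q, q + 1)}" using c q by (cases c) (auto simp: \<tau>_def pairs_def)
    obtain i j where ij: "c = (i, j)" by fastforce
    have "1 \<le> i" "i < j" "j \<le> n" "(i, j) \<noteq> (q, q + 1)" using c ij by (auto simp: pairs_def)
    then show "\<phi> x a (map_prod \<tau> \<tau> c) = \<phi> (sp n p x) (sp n p a) c"
      unfolding ij using p n by (cases "p < n") (auto simp: \<phi>_def \<tau>_def sp_def q_def algebra_simps)
  next
    fix c assume c: "c \<in> pairs n - {(q, q + 1)}"
    show "map_prod \<tau> \<tau> (map_prod \<tau> \<tau> c) = c" by (cases c) (auto simp: \<tau>_def)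
    show "map_prod \<tau> \<tau> c \<in> pairs n - {(q, q + 1)}" using c q by (cases c) (auto simp: \<tau>_def pairs_def)
  qed
  \<comment> \<open>The removed pair carries the simple root \<open>p\<close> together with one root
    that the reflection fixes.\<close>
  moreover have "\<phi> (sp n p x) (sp n p a) (q, q + 1) =
      \<phi> x a (q, q + 1) - f (root n p x) (root n p a) + f (- root n p x) (- root n p a)"
  proof (cases "p < n")
    case True then show ?thesis by (simp add: \<phi>_def q_def sp_def root_def add.commute)
  next
    case False
    have "f (- x (n - 1) - x n) (- a (n - 1) - a n) = f (- x n - x (n - 1)) (- a n - a (n - 1))"
      by (rule arg_cong2[of _ _ _ _ f]) auto
    then show ?thesis
      using False n p by (simp add: \<phi>_def q_def sp_def root_def add.commute)
  qed
  ultimately show ?thesis by (simp add: split)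
qed

text \<open>The half-sum of the positive roots with every coordinate increased by 1. It stays
  strictly dominant and has no zero coordinate, so the signs of a signed permutation can be read off
  from its image.\<close>

definition rho :: "nat \<Rightarrow> nat \<Rightarrow> int" where
  "rho n i = int (n + 1) - int i"

text \<open>At the image of \<open>rho\<close> under a Weyl group element this counts the inverted
  positive roots, that is, the length.\<close>

definition ninv :: "nat \<Rightarrow> (nat \<Rightarrow> int) \<Rightarrow> int" where
  "ninv n x = rsum n (\<lambda>x _. of_bool (x < 0)) x (\<lambda>_. 0)"

lemma ninv_sp:
  assumes "p \<in> {1..n}" "4 \<le> n"
  shows "ninv n (sp n p x) = ninv n x - of_bool (root n p x < 0) + of_bool (root n p x > 0)"
proof -
  have "rsum n (\<lambda>x _. of_bool (x < 0)) (sp n p x) (\<lambda>_. 0) =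
      rsum n (\<lambda>x _. of_bool (x < 0)) (sp n p x) (sp n p (\<lambda>_. 0))"
    by (rule rsum_cong) (auto simp: sp_def)
  then show ?thesis unfolding ninv_def using rsum_sp[OF assms] by simp
qed

lemma ninv_cong: "(\<And>i. i \<in> {1..n} \<Longrightarrow> x i = y i) \<Longrightarrow> ninv n x = ninv n y"
  unfolding ninv_def by (rule rsum_cong) auto

lemma ninv_rho: "ninv n (rho n) = 0"
  unfolding ninv_def rsum_def by (rule sum.neutral) (auto simp: pairs_def rho_def)

lemma ninv_nonneg: "0 \<le> ninv n x"
  unfolding ninv_def rsum_def by (intro sum_nonneg) auto

lemma ninv_le_length:
  "ws \<in> lists {1..n} \<Longrightarrow> 4 \<le> n \<Longrightarrow> ninv n (spw n (ws @ vs) (rho n)) \<le> int (length ws) + ninv n (spw n vs (rho n))"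
proof (induction ws)
  case (Cons p ws)
  then show ?case using ninv_sp[of p n "spw n (ws @ vs) (rho n)"] by (auto simp: of_bool_def)
qed simp

lemma ninv_bound: "ninv n x \<le> 2 * int (card (pairs n))"
  unfolding ninv_def rsum_def
  by (rule order.trans[OF sum_bounded_above[where K = 2]]) auto

text \<open>The absolute values are distinct and lie between 1 and \<open>n\<close>, and dominance
  makes the coordinates strictly decreasing, the last one also in absolute value. Counting up from
  the end and down from the beginning pins every coordinate except the sign of the last.\<close>

lemma signed_dominant:
  assumes n: "4 \<le> n" and \<pi>: "bij_betw \<pi> {1..n} {1..n}"
    and s: "\<And>i. i \<in> {1..n} \<Longrightarrow> s i = 1 \<or> s i = - 1" and y: "\<And>i. i \<in> {1..n} \<Longrightarrow> y i = s i * rho n (\<pi> i)"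
    and d: "\<And>p. p \<in> {1..n} \<Longrightarrow> 0 \<le> root n p y"
  shows "i \<in> {1..n - 1} \<Longrightarrow> y i = rho n i" "\<bar>y n\<bar> = 1"
proof -
  have a: "\<bar>y i\<bar> = rho n (\<pi> i)" "1 \<le> \<pi> i" "\<pi> i \<le> n" if "i \<in> {1..n}" for i
  proof -
    show *: "1 \<le> \<pi> i" "\<pi> i \<le> n" using \<pi> that by (auto simp: bij_betw_def)
    show "\<bar>y i\<bar> = rho n (\<pi> i)"
    proof -
      have "rho n (\<pi> i) > 0" using * by (simp add: rho_def)
      then show ?thesis using s[OF that] unfolding y[OF that] by (elim disjE) simp_all
    qed
  qed
  have b: "1 \<le> \<bar>y i\<bar>" "\<bar>y i\<bar> \<le> int n" if "i \<in> {1..n}" for i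
    using a[OF that] by (auto simp: rho_def)
  have ne: "\<bar>y i\<bar> \<noteq> \<bar>y j\<bar>" if "i \<in> {1..n}" "j \<in> {1..n}" "i \<noteq> j" for i j
  proof -
    have "\<pi> i \<noteq> \<pi> j"
      by (rule inj_on_contraD[OF bij_betw_imp_inj_on[OF \<pi>] that(3,1,2)])
    then show ?thesis using a(1)[OF that(1)] a(1)[OF that(2)] by (simp add: rho_def)
  qed
  have lt: "y (p + 1) < y p" if "1 \<le> p" "p < n" for p
    using d[of p] ne[of p "p + 1"] that by (auto simp: root_def)
  have last: "\<bar>y n\<bar> < y (n - 1)"
  proof -
    have f: "1 \<le> n - 1" "n - 1 \<noteq> n" "n - 1 < n" "n - 1 + 1 = n" using n by linarith+
    have 1: "y n < y (n - 1)" using lt[OF f(1,3)] unfolding f(4) .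
    have 2: "\<bar>y (n - 1)\<bar> \<noteq> \<bar>y n\<bar>" by (rule ne) (use f n in auto)
    have 3: "0 \<le> y (n - 1) + y n" using d[of n] n by (simp add: root_def)
    from 1 2 3 show ?thesis by linarith
  qed
  have low: "rho n i \<le> y i" if "1 \<le> i" "i \<le> n - 1" for i
    using that(2,1)
  proof (induction rule: inc_induct)
    case base then show ?case using last b(1)[of n] n by (simp add: rho_def)
  next
    case (step m)
    then have "1 \<le> m" "m < n" by auto
    with step lt[of m] show ?case by (simp add: rho_def One_nat_def)
  qed
  have high: "y i \<le> rho n i" if "1 \<le> i" "i \<le> n - 1" for i
    using that
  proof (induction rule: dec_induct)
    case base then show ?case using b(2)[of 1] n by (simp add: rho_def)
  next
    case (step m)
    then have "1 \<le> m" "m < n" by auto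
    with step lt[of m] show ?case by (simp add: rho_def One_nat_def)
  qed
  show eq: "y i = rho n i" if "i \<in> {1..n - 1}" for i
    using low[of i] high[of i] that by simp
  show "\<bar>y n\<bar> = 1"
    using last b(1)[of n] eq[of "n - 1"] n by (simp add: rho_def)
qed

section \<open>Lengths and the longest element\<close>

locale weyl =
  fixes n :: nat
  assumes n4: "4 \<le> n"
begin

abbreviation W where "W \<equiv> lists {1..n}"
abbreviation xw where "xw ws \<equiv> spw n ws (rho n)"

text \<open>An even number of sign changes preserves the product of the coordinates; this is how the
  sign of the last coordinate is recovered.\<close>

lemma xw_prod:
  assumes "ws \<in> W"
  shows "(\<Prod>i = 1..n. xw ws i) = (\<Prod>i = 1..n. rho n i)"
proof -
  obtain s \<pi> where s: "signed n s \<pi>" "\<And>i. i \<in> {1..n} \<Longrightarrow> xw ws i = s i * rho n (\<pi> i)"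
    using spw_signed[OF assms n4] by blast
  have "(\<Prod>i = 1..n. xw ws i) = prod s {1..n} * (\<Prod>i = 1..n. rho n (\<pi> i))"
    using s(2) by (simp add: prod.distrib)
  then show ?thesis using s(1) prod.reindex_bij_betw[of \<pi> "{1..n}" "{1..n}" "rho n"]
    by (simp add: signed_def)
qed

text \<open>The coordinates of \<open>rho\<close> are positive and distinct, so its image determines
  both the permutation and the signs.\<close>

lemma signed_unique:
  assumes "\<And>i. i \<in> {1..n} \<Longrightarrow> xw ws i = xw ws' i" "ws \<in> W" "ws' \<in> W"
  shows "weyl_prod n ws = weyl_prod n ws'"
proof (rule weyl_prod_eqI[OF assms(2,3) n4])
  fix x i assume i: "i \<in> {1..n}"
  obtain s \<pi> where s: "signed n s \<pi>" "\<And>x i. i \<in> {1..n} \<Longrightarrow> spw n ws x i = s i * x (\<pi> i)"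
    using spw_signed[OF assms(2) n4] by blast
  obtain s' \<pi>' where s': "signed n s' \<pi>'" "\<And>x i. i \<in> {1..n} \<Longrightarrow> spw n ws' x i = s' i * x (\<pi>' i)"
    using spw_signed[OF assms(3) n4] by blast
  have \<pi>: "1 \<le> \<pi> i" "\<pi> i \<le> n" "1 \<le> \<pi>' i" "\<pi>' i \<le> n"
    using s(1) s'(1) i by (auto simp: signed_def bij_betw_def)
  have "s i * rho n (\<pi> i) = s' i * rho n (\<pi>' i)"
    using assms(1)[OF i] s(2)[OF i] s'(2)[OF i] by simp
  moreover have "s i = 1 \<or> s i = - 1" "s' i = 1 \<or> s' i = - 1" using s(1) s'(1) i by (auto simp: signed_def)
  ultimately have "s i = s' i \<and> \<pi> i = \<pi>' i" using \<pi> by (auto simp: rho_def)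
  then show "spw n ws x i = spw n ws' x i" using s(2)[OF i] s'(2)[OF i] by simp
qed

lemma prod_last_eq:
  assumes "ws \<in> W" "ws' \<in> W" "\<And>i. i \<in> {1..n - 1} \<Longrightarrow> xw ws i = xw ws' i"
    and "\<And>i. i \<in> {1..n - 1} \<Longrightarrow> xw ws i \<noteq> 0" "i \<in> {1..n}"
  shows "xw ws i = xw ws' i"
proof (cases "i = n")
  case True
  have e: "{1..n} = insert n {1..n - 1}" using n4 by auto
  have "xw ws n * (\<Prod>i = 1..n - 1. xw ws i) = xw ws' n * (\<Prod>i = 1..n - 1. xw ws' i)"
    using xw_prod[OF assms(1)] xw_prod[OF assms(2)] unfolding e using n4 by simp
  moreover have "(\<Prod>i = 1..n - 1. xw ws i) = (\<Prod>i = 1..n - 1. xw ws' i)"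
    using assms(3) by (intro prod.cong) auto
  moreover have "(\<Prod>i = 1..n - 1. xw ws i) \<noteq> 0" using assms(4) by auto
  ultimately show ?thesis using True by simp
qed (use assms in auto)

lemma dominant_id:
  assumes "ws \<in> W" "\<And>p. p \<in> {1..n} \<Longrightarrow> 0 \<le> root n p (xw ws)"
  shows "weyl_prod n ws = weyl_prod n []" "ninv n (xw ws) = 0"
proof -
  obtain s \<pi> where s: "signed n s \<pi>" "\<And>i. i \<in> {1..n} \<Longrightarrow> xw ws i = s i * rho n (\<pi> i)"
    using spw_signed[OF assms(1) n4] by blast
  have pi: "bij_betw \<pi> {1..n} {1..n}" and si: "\<And>i. i \<in> {1..n} \<Longrightarrow> s i = 1 \<or> s i = - 1"
    using s(1) by (auto simp: signed_def)
  have d: "xw ws i = rho n i" if "i \<in> {1..n - 1}" for i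
    using signed_dominant(1)[of n \<pi> s "xw ws", OF n4 pi si s(2) assms(2) that] .
  have e: "xw ws i = xw [] i" if "i \<in> {1..n}" for i
    using prod_last_eq[OF assms(1), of "[]" i] that d by (force simp: rho_def)
  show "weyl_prod n ws = weyl_prod n []" by (rule signed_unique) (use e assms in auto)
  have "ninv n (xw ws) = ninv n (rho n)" by (rule ninv_cong) (use e in auto)
  then show "ninv n (xw ws) = 0" by (simp add: ninv_rho)
qed

lemma antidominant:
  assumes "ws \<in> W" "\<And>p. p \<in> {1..n} \<Longrightarrow> root n p (xw ws) \<le> 0"
  shows "i \<in> {1..n - 1} \<Longrightarrow> xw ws i = - rho n i" "\<bar>xw ws n\<bar> = 1"
proof -
  obtain s \<pi> where s: "signed n s \<pi>" "\<And>i. i \<in> {1..n} \<Longrightarrow> xw ws i = s i * rho n (\<pi> i)"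
    using spw_signed[OF assms(1) n4] by blast
  define y where "y i = - xw ws i" for i
  have r: "root n p y = - root n p (xw ws)" for p by (simp add: root_def y_def)
  have pi: "bij_betw \<pi> {1..n} {1..n}" and si: "\<And>i. i \<in> {1..n} \<Longrightarrow> - s i = 1 \<or> - s i = - 1"
    using s(1) by (auto simp: signed_def)
  have y: "y i = - s i * rho n (\<pi> i)" if "i \<in> {1..n}" for i
    using s(2)[OF that] by (simp add: y_def)
  have d: "0 \<le> root n p y" if "p \<in> {1..n}" for p
    using assms(2)[OF that] by (simp add: r)
  show "xw ws i = - rho n i" if "i \<in> {1..n - 1}"
    using signed_dominant(1)[of n \<pi> "\<lambda>i. - s i" y, OF n4 pi si y d that] by (simp add: y_def)
  show "\<bar>xw ws n\<bar> = 1"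
    using signed_dominant(2)[of n \<pi> "\<lambda>i. - s i" y, OF n4 pi si y d] by (simp add: y_def)
qed

text \<open>As long as some simple root is negative on the image of \<open>rho\<close>, prepending
  its reflection lowers \<open>ninv\<close> by 1. The descent ends in the dominant chamber, where
  only the identity is left.\<close>

lemma exists_word:
  "ws \<in> W \<Longrightarrow> \<exists>ws'\<in>W. weyl_prod n ws' = weyl_prod n ws \<and> int (length ws') = ninv n (xw ws)"
proof (induction "nat (ninv n (xw ws))" arbitrary: ws rule: less_induct)
  case less
  show ?case
  proof (cases "\<forall>p\<in>{1..n}. 0 \<le> root n p (xw ws)")
    case True
    then show ?thesis using dominant_id[OF less.prems] by (intro bexI[of _ "[]"]) auto
  next
    case False
    then obtain p where p: "p \<in> {1..n}" "root n p (xw ws) < 0" by fastforce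
    then have N: "ninv n (xw (p # ws)) = ninv n (xw ws) - 1" using ninv_sp[OF p(1) n4, of "xw ws"] by simp
    have W: "p # ws \<in> W" using p less.prems by auto
    have "nat (ninv n (xw (p # ws))) < nat (ninv n (xw ws))"
      using N ninv_nonneg[of n "xw (p # ws)"] by linarith
    from less.hyps[OF this W] obtain ws' where ws': "ws' \<in> W"
      "weyl_prod n ws' = weyl_prod n (p # ws)" "int (length ws') = ninv n (xw ws) - 1"
      using N by auto
    have "weyl_prod n (p # ws') = weyl_prod n ws"
    proof
      fix \<mu>
      show "weyl_prod n (p # ws') \<mu> = weyl_prod n ws \<mu>"
        unfolding weyl_prod_Cons ws'(2) by (rule simple_refl_invol[OF p(1)])
    qed
    then show ?thesis using ws' p by (intro bexI[of _ "p # ws'"]) auto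
  qed
qed

lemma weyl_length_eq:
  assumes "ws \<in> W"
  shows "int (weyl_length n (weyl_prod n ws)) = ninv n (xw ws)"
proof -
  have "weyl_length n (weyl_prod n ws) = nat (ninv n (xw ws))"
    unfolding weyl_length_def
  proof (rule Least_equality)
    show "\<exists>ws'\<in>W. weyl_prod n ws' = weyl_prod n ws \<and> length ws' = nat (ninv n (xw ws))"
      using exists_word[OF assms] by force
  next
    fix l assume "\<exists>ws'\<in>W. weyl_prod n ws' = weyl_prod n ws \<and> length ws' = l"
    then obtain ws' where ws': "ws' \<in> W" "weyl_prod n ws' = weyl_prod n ws" "length ws' = l" by blast
    have "ninv n (xw ws') = ninv n (xw ws)"
      by (rule ninv_cong) (use weyl_prod_eqD[OF ws'(2,1) assms n4] in blast)
    then show "nat (ninv n (xw ws)) \<le> l"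
      using ninv_le_length[OF ws'(1) n4, of "[]"] ws'(3) by (simp add: ninv_rho)
  qed
  then show ?thesis using ninv_nonneg[of n "xw ws"] by simp
qed

text \<open>Words for the longest element, recognised by sending \<open>rho\<close> into the
  antidominant chamber.\<close>

definition top_word :: "nat list \<Rightarrow> bool" where
  "top_word ws \<longleftrightarrow> ws \<in> W \<and> (\<forall>p\<in>{1..n}. root n p (xw ws) \<le> 0)"

text \<open>If a simple root were positive on the image of \<open>rho\<close>, one more letter would
  increase \<open>ninv\<close>.\<close>

lemma top_wordI:
  assumes "ws \<in> W" "\<And>ws'. ws' \<in> W \<Longrightarrow> ninv n (xw ws') \<le> ninv n (xw ws)"
  shows "top_word ws"
  unfolding top_word_def
proof (intro conjI ballI)
  fix p assume p: "p \<in> {1..n}"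
  then have "p # ws \<in> W" using assms by auto
  from assms(2)[OF this] show "root n p (xw ws) \<le> 0"
    using ninv_sp[OF p n4, of "xw ws"] by (auto simp: of_bool_def split: if_splits)
qed (rule assms)

lemma ex_max_word: "\<exists>ws\<in>W. \<forall>ws'\<in>W. ninv n (xw ws') \<le> ninv n (xw ws)"
proof -
  have "\<exists>ws. ws \<in> W \<and> (\<forall>ws'. ws' \<in> W \<longrightarrow> nat (ninv n (xw ws')) \<le> nat (ninv n (xw ws)))"
  proof (rule ex_has_greatest_nat[of "\<lambda>ws. ws \<in> W" "[]" "\<lambda>ws. nat (ninv n (xw ws))" "2 * card (pairs n) + 1"])
    show "\<forall>ws. ws \<in> W \<longrightarrow> nat (ninv n (xw ws)) < 2 * card (pairs n) + 1"
    proof (intro allI impI)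
      show "nat (ninv n (xw ws)) < 2 * card (pairs n) + 1" for ws
        using ninv_bound[of n "xw ws"] ninv_nonneg[of n "xw ws"] by linarith
    qed
  qed simp
  then show ?thesis using ninv_nonneg[of n] by (meson nat_le_eq_zle order.trans eq_nat_nat_iff nat_le_iff)
qed

lemma top_word_unique:
  assumes "top_word ws" "top_word ws'"
  shows "weyl_prod n ws = weyl_prod n ws'"
proof -
  have W: "ws \<in> W" "ws' \<in> W" and a: "\<And>p. p \<in> {1..n} \<Longrightarrow> root n p (xw ws) \<le> 0"
    "\<And>p. p \<in> {1..n} \<Longrightarrow> root n p (xw ws') \<le> 0"
    using assms by (auto simp: top_word_def)
  have "xw ws i = xw ws' i" if "i \<in> {1..n}" for i
    by (rule prod_last_eq[OF W _ _ that])
       (use antidominant(1)[OF W(1) a(1)] antidominant(1)[OF W(2) a(2)] in \<open>auto simp: rho_def\<close>)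
  then show ?thesis by (rule signed_unique[OF _ W])
qed

lemma longest_elt_eq: "\<exists>wt. top_word wt \<and> longest_elt n = weyl_prod n wt"
proof -
  obtain wt where wt: "wt \<in> W" and m: "\<And>ws'. ws' \<in> W \<Longrightarrow> ninv n (xw ws') \<le> ninv n (xw wt)"
    using ex_max_word by blast
  have top: "top_word wt" by (rule top_wordI[OF wt m])
  have "longest_elt n = weyl_prod n wt"
    unfolding longest_elt_def
  proof (rule the_equality)
    have "weyl_length n (weyl_prod n ws) \<le> weyl_length n (weyl_prod n wt)" if "ws \<in> W" for ws
      using m[OF that] weyl_length_eq[OF that] weyl_length_eq[OF wt] by linarith
    then show "weyl_prod n wt \<in> weyl_group n \<and> (\<forall>v\<in>weyl_group n. weyl_length n v \<le> weyl_length n (weyl_prod n wt))"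
      using wt by (auto simp: weyl_group_def)
  next
    fix w assume w: "w \<in> weyl_group n \<and> (\<forall>v\<in>weyl_group n. weyl_length n v \<le> weyl_length n w)"
    then obtain vs where vs: "vs \<in> W" "w = weyl_prod n vs" by (auto simp: weyl_group_def)
    have "weyl_length n (weyl_prod n wt) \<le> weyl_length n w" using w wt by (auto simp: weyl_group_def)
    then have "ninv n (xw wt) \<le> ninv n (xw vs)"
      unfolding vs(2) using weyl_length_eq[OF wt] weyl_length_eq[OF vs(1)] by linarith
    then have "top_word vs" using m by (intro top_wordI[OF vs(1)]) force
    then show "w = weyl_prod n wt" unfolding vs(2) by (rule top_word_unique[OF _ top])
  qed
  then show ?thesis using top by blast
qed

lemma longest_word:
  assumes "ws \<in> W" "weyl_prod n ws = longest_elt n"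
  shows "top_word ws"
proof -
  obtain wt where top: "top_word wt" and l: "longest_elt n = weyl_prod n wt"
    using longest_elt_eq by blast
  have e: "weyl_prod n ws = weyl_prod n wt" using assms(2) l by simp
  have wt: "wt \<in> W" using top by (simp add: top_word_def)
  have "xw ws i = xw wt i" if "i \<in> {1..n}" for i
    by (rule weyl_prod_eqD[OF e assms(1) wt n4 that])
  then have "root n p (xw ws) = root n p (xw wt)" if "p \<in> {1..n}" for p
    using that n4 by (auto simp: root_def)
  then show ?thesis using top assms(1) by (auto simp: top_word_def)
qed

lemma longest_reduced:
  assumes "reduced_word n (longest_elt n) ws"
  shows "top_word ws" "int (length ws) = ninv n (xw ws)"
proof -
  have W: "ws \<in> W" "weyl_prod n ws = longest_elt n" "length ws = weyl_length n (longest_elt n)"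
    using assms by (auto simp: reduced_word_def)
  show "top_word ws" by (rule longest_word[OF W(1,2)])
  show "int (length ws) = ninv n (xw ws)" using weyl_length_eq[OF W(1)] W by simp
qed

lemma ex_longest_reduced: "\<exists>ws. reduced_word n (longest_elt n) ws"
proof -
  have "longest_elt n \<in> weyl_group n"
    using longest_elt_eq by (auto simp: weyl_group_def top_word_def)
  then obtain ws where ws: "ws \<in> W" "weyl_prod n ws = longest_elt n"
    unfolding weyl_group_def by (metis imageE)
  obtain ws' where "ws' \<in> W" "weyl_prod n ws' = weyl_prod n ws" "int (length ws') = ninv n (xw ws)"
    using exists_word[OF ws(1)] by blast
  then show ?thesis using ws weyl_length_eq[OF ws(1)] by (auto simp: reduced_word_def intro!: exI[of _ ws'])
qed

text \<open>A letter changes \<open>ninv\<close> by at most 1, so a word whose length equals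
  \<open>ninv\<close> has no letter to waste: each one must increase the count for the suffix to its
  right.\<close>

lemma reduced_step:
  assumes "reduced_word n (longest_elt n) (us @ p # vs)"
  shows "0 < root n p (xw vs)"
proof -
  have W: "us \<in> W" "p \<in> {1..n}" "vs \<in> W" using assms by (auto simp: reduced_word_def)
  have "int (length (us @ p # vs)) = ninv n (xw (us @ p # vs))" by (rule longest_reduced(2)[OF assms])
  also have "\<dots> \<le> int (length us) + ninv n (xw (p # vs))" by (rule ninv_le_length[OF W(1) n4])
  finally have "int (length vs) + 1 \<le> ninv n (xw (p # vs))" by simp
  moreover have "ninv n (xw vs) \<le> int (length vs)"
    using ninv_le_length[OF W(3) n4, of "[]"] by (simp add: ninv_rho)
  ultimately show ?thesis using ninv_sp[OF W(2) n4, of "xw vs"] by (auto simp: of_bool_def split: if_splits)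
qed

text \<open>For even \<open>n\<close> the longest element is -1. For odd \<open>n\<close> it fixes
  the last coordinate, because the number of sign changes has to be even.\<close>

lemma top_word_action:
  assumes "top_word ws"
  shows "\<exists>e. (- 1) ^ (n - 1) * e = 1 \<and> (\<forall>x. (\<forall>i\<in>{1..n - 1}. spw n ws x i = - x i) \<and> spw n ws x n = e * x n)"
proof -
  have W: "ws \<in> W" and a: "\<And>p. p \<in> {1..n} \<Longrightarrow> root n p (xw ws) \<le> 0"
    using assms by (auto simp: top_word_def)
  obtain s \<pi> where s: "signed n s \<pi>" "\<And>x i. i \<in> {1..n} \<Longrightarrow> spw n ws x i = s i * x (\<pi> i)"
    using spw_signed[OF W n4] by blast
  have pi: "1 \<le> \<pi> i" "\<pi> i \<le> n" "s i = 1 \<or> s i = - 1" if "i \<in> {1..n}" for i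
    using s(1) that by (auto simp: signed_def bij_betw_def)
  have 1: "\<pi> i = i \<and> s i = - 1" if "i \<in> {1..n - 1}" for i
  proof -
    have "i \<in> {1..n}" "i < n + 1" using that by auto
    then show ?thesis
      using antidominant(1)[OF W a that] s(2)[of i "rho n"] pi[of i] that by (auto simp: rho_def)
  qed
  have 2: "\<pi> n = n"
    using antidominant(2)[OF W a] s(2)[of n "rho n"] pi[of n] n4 by (auto simp: rho_def)
  have e: "{1..n} = insert n {1..n - 1}" using n4 by auto
  have "prod s {1..n} = s n * prod s {1..n - 1}" unfolding e using n4 by (subst prod.insert) auto
  also have "prod s {1..n - 1} = (\<Prod>i = 1..n - 1. - 1)" using 1 by (intro prod.cong) auto
  finally have "(- 1) ^ (n - 1) * s n = 1" using s(1) by (simp add: signed_def mult.commute)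
  then show ?thesis using 1 2 s(2) n4 by (intro exI[of _ "s n"]) auto
qed

end

section \<open>The factors of Theta as row operators\<close>

definition ybrow :: "nat \<Rightarrow> nat \<Rightarrow> complex \<Rightarrow> row \<Rightarrow> row" where
  "ybrow n i c r D = (if canf n i D then r D / c + r (fset n i D)
     else if cane n i D then c * r D else r D)"

definition sbrow :: "nat \<Rightarrow> nat \<Rightarrow> row \<Rightarrow> row" where
  "sbrow n i r D = (if canf n i D then r (fset n i D) else if cane n i D then - r (eset n i D) else r D)"

lemma ybrow_eq:
  assumes "i \<le> n" "2 \<le> n" "c \<noteq> 0"
  shows "ybrow n i c r = hrow n i (inverse c) (yrow n i c r)"
  using assms by (auto simp: fun_eq_iff ybrow_def hrow_cases yrow_def cane_imp canf_imp field_simps)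

lemma sbrow_eq: "sbrow n i r = xrow n i (- 1) (yrow n i 1 (xrow n i (- 1) r))"
  by (auto simp: fun_eq_iff sbrow_def xrow_def yrow_def cane_imp canf_imp)

lemma row_rep_y_bold:
  assumes "i \<in> {1..n}" "2 \<le> n" "c \<noteq> 0"
  shows "row_rep n (y_bold n i c) (ybrow n i c)"
  unfolding y_bold_def
  by (rule row_rep_eqI[OF row_rep_mult[OF row_rep_y[OF assms(1,2)] row_rep_h]])
     (use ybrow_eq[of i n c] assms in auto)

lemma row_rep_s_bar:
  assumes "i \<in> {1..n}" "2 \<le> n"
  shows "row_rep n (s_bar n i) (sbrow n i)"
  unfolding s_bar_def
  by (rule row_rep_eqI[OF row_rep_mult[OF row_rep_mult[OF row_rep_x[OF assms] row_rep_y[OF assms]] row_rep_x[OF assms]]])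
     (simp add: sbrow_eq)

definition brow :: "nat \<Rightarrow> (nat \<Rightarrow> complex) \<Rightarrow> row \<Rightarrow> row" where
  "brow n c r = fold (\<lambda>i. ybrow n i (c i)) [1..<n + 1] r"

definition req :: "nat \<Rightarrow> row \<Rightarrow> row \<Rightarrow> bool" where
  "req n r r' \<longleftrightarrow> (\<forall>D. D \<subseteq> {1..n} \<longrightarrow> r D = r' D)"

lemma req_refl: "req n r r" by (simp add: req_def)

lemma req_ybrow: "i \<in> {1..n} \<Longrightarrow> 2 \<le> n \<Longrightarrow> req n r r' \<Longrightarrow> req n (ybrow n i c r) (ybrow n i c r')"
  by (simp add: req_def ybrow_def fset_subset)

lemma req_fold:
  "(\<And>x r r'. x \<in> set xs \<Longrightarrow> req n r r' \<Longrightarrow> req n (F x r) (F x r')) \<Longrightarrow> req n r r' \<Longrightarrow>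
    req n (fold F xs r) (fold F xs r')"
  by (induction xs arbitrary: r r') auto

lemma req_brow: "2 \<le> n \<Longrightarrow> req n r r' \<Longrightarrow> req n (brow n c r) (brow n c r')"
  unfolding brow_def by (rule req_fold) (auto intro: req_ybrow)

section \<open>Extremal rows\<close>

definition pre :: "nat \<Rightarrow> nat set \<Rightarrow> int" where
  "pre i C = (\<Sum>a = 1..i. of_bool (a \<in> C))"

lemma pre_Suc: "pre (Suc i) C = pre i C + of_bool (Suc i \<in> C)"
  by (simp add: pre_def)

lemma pre_pos: "0 < i \<Longrightarrow> pre i C = pre (i - 1) C + of_bool (i \<in> C)"
  using pre_Suc[of "i - 1" C] by simp

text \<open>Dominance order on the weights of the spin representation: up to factors the conditions
  say that the coefficients of the simple roots in the difference are nonnegative integers.\<close>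

definition tle :: "nat \<Rightarrow> nat set \<Rightarrow> nat set \<Rightarrow> bool" where
  "tle n C A \<longleftrightarrow> (\<forall>i\<le>n. pre i C \<le> pre i A) \<and>
     pre (n - 1) C - of_bool (n \<in> C) \<le> pre (n - 1) A - of_bool (n \<in> A) \<and> even (pre n C - pre n A)"

lemma sum_of_bool_delta: "(\<Sum>a = 1..i. of_bool (a = (j :: nat))) = (of_bool (1 \<le> j \<and> j \<le> i) :: int)"
  by (induction i) (auto simp: of_bool_def)

lemma pre_eset:
  assumes "cane n j C" "j \<in> {1..n}" "2 \<le> n"
  shows "pre i (eset n j C) = pre i C +
    (if j < n then of_bool (j \<le> i) - of_bool (j + 1 \<le> i) else of_bool (n - 1 \<le> i) + of_bool (n \<le> i))"
proof (cases "j < n")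
  case True
  have "of_bool (a \<in> eset n j C) = (of_bool (a \<in> C) + of_bool (a = j) - of_bool (a = j + 1) :: int)" for a
    using assms True by (auto simp: cane_def eset_def up_def dn_def)
  then have "pre i (eset n j C) = pre i C + (\<Sum>a = 1..i. of_bool (a = j)) - (\<Sum>a = 1..i. of_bool (a = j + 1))"
    by (simp only: pre_def sum.distrib sum_subtractf)
  then show ?thesis using True assms by (simp only: sum_of_bool_delta) auto
next
  case False
  have "of_bool (a \<in> eset n j C) = (of_bool (a \<in> C) + of_bool (a = n - 1) + of_bool (a = n) :: int)" for a
    using assms False by (auto simp: cane_def eset_def up_def dn_def)
  then have "pre i (eset n j C) = pre i C + (\<Sum>a = 1..i. of_bool (a = n - 1)) + (\<Sum>a = 1..i. of_bool (a = n))"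
    by (simp only: pre_def sum.distrib)
  then show ?thesis using False assms by (simp only: sum_of_bool_delta) auto
qed

lemma mem_eset_n:
  assumes "cane n j C" "j \<in> {1..n}" "2 \<le> n"
  shows "n \<in> eset n j C \<longleftrightarrow> (if j = n then True else if j = n - 1 then False else n \<in> C)"
  using assms by (auto simp: cane_def eset_def up_def dn_def)

lemma tle_eset_mono:
  assumes "tle n C A" "cane n j C" "cane n j A" "j \<in> {1..n}" "2 \<le> n"
  shows "tle n (eset n j C) (eset n j A)"
proof -
  have mC: "(of_bool (n \<in> eset n j C) :: int) - of_bool (n \<in> C) = of_bool (n \<in> eset n j A) - of_bool (n \<in> A)"
    using assms(2-5) mem_eset_n[OF assms(2,4,5)] mem_eset_n[OF assms(3-5)]
    by (auto simp: cane_def up_def dn_def)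
  show ?thesis
    using assms(1) mC unfolding tle_def pre_eset[OF assms(2,4,5)] pre_eset[OF assms(3-5)]
    by (auto simp: algebra_simps)
qed

lemma tle_eset_self:
  assumes "cane n j A" "j \<in> {1..n}" "2 \<le> n"
  shows "tle n A (eset n j A)" "\<not> tle n (eset n j A) A"
proof -
  have m: "(of_bool (n \<in> eset n j A) :: int) = of_bool (n \<in> A) + of_bool (j = n) - of_bool (j = n - 1)"
    using assms mem_eset_n[OF assms] by (auto simp: cane_def up_def dn_def)
  show "tle n A (eset n j A)"
    unfolding tle_def pre_eset[OF assms] m using assms by (auto simp: of_bool_def)
  have "pre j (eset n j A) > pre j A" using assms by (auto simp: pre_eset[OF assms])
  then show "\<not> tle n (eset n j A) A" using assms by (force simp: tle_def)
qed

lemma tle_trans: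
  assumes "tle n A B" "tle n B C"
  shows "tle n A C"
  unfolding tle_def
proof (intro conjI allI impI)
  show "pre i A \<le> pre i C" if "i \<le> n" for i
    using assms that by (meson order.trans tle_def)
  show "pre (n - 1) A - of_bool (n \<in> A) \<le> pre (n - 1) C - of_bool (n \<in> C)"
    using assms unfolding tle_def by linarith
  have "even (pre n A - pre n B)" "even (pre n B - pre n C)" using assms by (auto simp: tle_def)
  then show "even (pre n A - pre n C)" by presburger
qed

text \<open>Write the difference of the weights of \<open>A\<close> and \<open>C\<close> as a sum of
  simple roots with coefficients \<open>m\<^sub>i \<ge> 0\<close>. Its value at
  \<open>h\<^sub>j\<close> is 1, and it equals \<open>2 * m\<^sub>j\<close> minus the coefficients
  at the neighbours of \<open>j\<close>. Hence \<open>m\<^sub>j \<ge> 1\<close>, and one copy of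
  \<open>\<alpha>\<^sub>j\<close> can be spent on raising \<open>C\<close>.\<close>

lemma tle_eset_zero:
  assumes le: "tle n C A" and C: "cane n j C" and A: "\<not> cane n j A" "\<not> canf n j A"
    and j: "j \<in> {1..n}" and n: "4 \<le> n"
  shows "tle n (eset n j C) A"
proof -
  have n2: "2 \<le> n" using n by simp
  have le': "pre i C \<le> pre i A" if "i \<le> n" for i using le that by (simp add: tle_def)
  have ev: "even (pre n C - pre n A)" using le by (simp add: tle_def)
  have p1: "pre n X = pre (n - 1) X + of_bool (n \<in> X)" for X using pre_pos[of n X] n by simp
  have p2: "pre (n - 1) X = pre (n - 2) X + of_bool (n - 1 \<in> X)" for X
    using pre_pos[of "n - 1" X] n by (simp add: numeral_2_eq_2 One_nat_def)
  have th: "pre (n - 1) C - of_bool (n \<in> C) \<le> pre (n - 1) A - of_bool (n \<in> A)"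
    using le by (simp add: tle_def)
  consider "j < n - 1" | "j = n - 1" | "j = n" using j by fastforce
  then show ?thesis
  proof cases
    case 1
    then have jn: "j < n" "j + 1 < n" by auto
    have a: "of_bool (j \<in> A) = (of_bool (j + 1 \<in> A) :: int)"
      using A jn by (auto simp: cane_def canf_def up_def dn_def)
    have c: "j \<notin> C" "j + 1 \<in> C" using C jn by (auto simp: cane_def up_def dn_def)
    have lt: "pre j C < pre j A"
      using le'[of "j - 1"] le'[of "j + 1"] pre_pos[of j C] pre_pos[of j A] pre_pos[of "j + 1" A] pre_pos[of "j + 1" C] a c j jn
      by (auto simp: of_bool_def split: if_splits)
    have jn': "j \<noteq> n" "j \<noteq> n - 1" "n - 1 \<noteq> j" "n \<noteq> j" using 1 by linarith+
    then have m: "n \<in> eset n j C \<longleftrightarrow> n \<in> C" using mem_eset_n[OF C j n2] by simp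
    have e: "pre i (eset n j C) = pre i C + of_bool (i = j)" for i
      unfolding pre_eset[OF C j n2] using jn(1) by auto
    have "pre i (eset n j C) \<le> pre i A" if "i \<le> n" for i
      using le'[OF that] lt by (cases "i = j") (auto simp: e)
    then show ?thesis
      unfolding tle_def using th ev m jn' by (simp add: e)
  next
    case 2
    have a: "of_bool (n - 1 \<in> A) = (of_bool (n \<in> A) :: int)"
      using A 2 n by (auto simp: cane_def canf_def up_def dn_def)
    have c: "n - 1 \<notin> C" "n \<in> C" using C 2 n by (auto simp: cane_def up_def dn_def)
    have l2: "pre (n - 2) C \<le> pre (n - 2) A" using le' by simp
    have m: "n \<notin> eset n j C" using mem_eset_n[OF C j n2] 2 n by simp
    \<comment> \<open>The parity condition in \<open>tle\<close> excludes equality of the counts up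
      to \<open>n - 2\<close>; this gains the missing unit.\<close>
    have k1: "pre (n - 1) C + 1 \<le> pre (n - 1) A"
    proof -
      have "pre (n - 2) C + 1 - pre (n - 2) A - 2 * of_bool (n \<in> A) = pre n C - pre n A"
        using p1[of C] p1[of A] p2[of C] p2[of A] a c by simp
      then have "odd (pre (n - 2) C - pre (n - 2) A)" using ev by presburger
      then have "pre (n - 2) C \<noteq> pre (n - 2) A" by auto
      then show ?thesis using l2 p2[of C] p2[of A] c by simp
    qed
    have k2: "pre (n - 2) C + 1 \<le> pre (n - 2) A"
    proof -
      have "pre (n - 2) C + 1 - pre (n - 2) A - 2 * of_bool (n \<in> A) = pre n C - pre n A"
        using p1[of C] p1[of A] p2[of C] p2[of A] a c by simp
      then have "odd (pre (n - 2) C - pre (n - 2) A)" using ev by presburger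
      then have "pre (n - 2) C \<noteq> pre (n - 2) A" by auto
      then show ?thesis using l2 by simp
    qed
    have "pre (n - 1) C + 1 \<le> pre (n - 1) A - of_bool (n \<in> A)"
      using k2 p2[of A] p2[of C] a c by simp
    then show ?thesis
      unfolding tle_def
    proof (intro conjI allI impI)
      have j: "j < n" using 2 n by simp
      show "pre i (eset n j C) \<le> pre i A" if i: "i \<le> n" for i
      proof -
        consider "i < n - 1" | "i = n - 1" | "i = n" using i by linarith
        then show ?thesis using le'[OF i] k1 2 j pre_eset[OF C \<open>j \<in> {1..n}\<close> n2, of i] by cases auto
      qed
      have "pre (n - 1) (eset n j C) = pre (n - 1) C + 1" "pre n (eset n j C) = pre n C"
        using pre_eset[OF C \<open>j \<in> {1..n}\<close> n2] 2 n j by auto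
      then show "pre (n - 1) (eset n j C) - of_bool (n \<in> eset n j C) \<le> pre (n - 1) A - of_bool (n \<in> A)"
        "even (pre n (eset n j C) - pre n A)"
        using \<open>pre (n - 1) C + 1 \<le> pre (n - 1) A - of_bool (n \<in> A)\<close> m ev by auto
    qed
  next
    case 3
    have a: "of_bool (n - 1 \<in> A) + of_bool (n \<in> A) = (1 :: int)"
      using A 3 n by (auto simp: cane_def canf_def up_def dn_def)
    have c: "n - 1 \<notin> C" "n \<notin> C" using C 3 n by (auto simp: cane_def up_def dn_def)
    have l2: "pre (n - 2) C \<le> pre (n - 2) A" using le' by simp
    have m: "n \<in> eset n j C" using mem_eset_n[OF C j n2] 3 n by simp
    have e: "pre n C - pre n A = pre (n - 2) C - pre (n - 2) A - 1"
      using p1[of C] p1[of A] p2[of C] p2[of A] a c by simp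
    then have "odd (pre (n - 2) C - pre (n - 2) A)" using ev by presburger
    then have "pre (n - 2) C \<noteq> pre (n - 2) A" by auto
    then have "pre (n - 2) C + 1 \<le> pre (n - 2) A" using l2 by simp
    then have k: "pre (n - 1) C + 1 \<le> pre (n - 1) A" "pre n C + 2 \<le> pre n A"
      using e p2[of C] p2[of A] c by auto
    have *: "pre i C + of_bool (n - 1 \<le> i) + of_bool (n \<le> i) \<le> pre i A" if i: "i \<le> n" for i
    proof -
      consider "i < n - 1" | "i = n - 1" | "i = n" using i by linarith
      then show ?thesis using k le'[OF i] n by cases (auto simp: of_bool_def)
    qed
    have e: "pre i (eset n j C) = pre i C + of_bool (n - 1 \<le> i) + of_bool (n \<le> i)" for i
      unfolding pre_eset[OF C j n2] using 3 by simp
    have "pre n (eset n j C) = pre n C + 2" "pre (n - 1) (eset n j C) = pre (n - 1) C + 1"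
      using n by (auto simp: e)
    moreover have "pre i (eset n j C) \<le> pre i A" if "i \<le> n" for i
      using *[OF that] e[of i] by simp
    ultimately show ?thesis
      unfolding tle_def using ev m th c by simp
  qed
qed

text \<open>\<open>A\<close> is the top of the support of the row, with its coefficient normalised
  to 1.\<close>

definition extremal :: "nat \<Rightarrow> row \<Rightarrow> nat set \<Rightarrow> bool" where
  "extremal n r A \<longleftrightarrow> A \<subseteq> {1..n} \<and> r A = 1 \<and> (\<forall>C. C \<subseteq> {1..n} \<longrightarrow> r C \<noteq> 0 \<longrightarrow> tle n C A)"

definition sset :: "nat \<Rightarrow> nat \<Rightarrow> nat set \<Rightarrow> nat set" where
  "sset n j A = (if canf n j A then fset n j A else if cane n j A then eset n j A else A)"

lemma tle_refl: "tle n A A" by (simp add: tle_def)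

lemma extremal_delta: "A \<subseteq> {1..n} \<Longrightarrow> extremal n (delta A) A"
  by (auto simp: extremal_def delta_def tle_refl)

text \<open>A letter that does not lower \<open>A\<close> either raises it, and then the unscaled
  term of \<open>ybrow\<close> carries the coefficient 1 to the new top, or it is orthogonal to
  \<open>A\<close>, and then the top is neither rescaled nor overtaken.\<close>

lemma extremal_step:
  assumes e: "extremal n r A" and j: "j \<in> {1..n}" and n: "4 \<le> n" and A: "\<not> canf n j A" and c: "c \<noteq> 0"
  shows "extremal n (ybrow n j c r) (sset n j A)"
proof (cases "cane n j A")
  case True
  have n2: "2 \<le> n" using n by simp
  have A': "sset n j A = eset n j A" using True A by (simp add: sset_def)
  have sub: "eset n j A \<subseteq> {1..n}" using e eset_subset[OF j n2] by (simp add: extremal_def)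
  have "r (eset n j A) = 0" using e tle_eset_self(2)[OF True j n2] sub by (auto simp: extremal_def)
  then have 1: "ybrow n j c r (eset n j A) = 1"
    using e True by (simp add: ybrow_def cane_imp extremal_def)
  have "tle n D (eset n j A)" if D: "D \<subseteq> {1..n}" "ybrow n j c r D \<noteq> 0" for D
  proof -
    from D(2) have "r D \<noteq> 0 \<or> (canf n j D \<and> r (fset n j D) \<noteq> 0)"
      by (auto simp: ybrow_def split: if_splits)
    then show ?thesis
    proof
      assume "r D \<noteq> 0"
      then show ?thesis using e D tle_trans[OF _ tle_eset_self(1)[OF True j n2]] by (auto simp: extremal_def)
    next
      assume *: "canf n j D \<and> r (fset n j D) \<noteq> 0"
      then have "tle n (fset n j D) A" using e D fset_subset[OF j n2] by (auto simp: extremal_def)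
      from tle_eset_mono[OF this _ True j n2] show ?thesis using * by (simp add: canf_imp)
    qed
  qed
  then show ?thesis using 1 sub by (simp add: A' extremal_def)
next
  case False
  have n2: "2 \<le> n" using n by simp
  have A': "sset n j A = A" using False A by (simp add: sset_def)
  have "tle n D A" if D: "D \<subseteq> {1..n}" "ybrow n j c r D \<noteq> 0" for D
  proof -
    from D(2) have "r D \<noteq> 0 \<or> (canf n j D \<and> r (fset n j D) \<noteq> 0)"
      by (auto simp: ybrow_def split: if_splits)
    then show ?thesis
    proof
      assume "r D \<noteq> 0"
      then show ?thesis using e D by (auto simp: extremal_def)
    next
      assume *: "canf n j D \<and> r (fset n j D) \<noteq> 0"
      then have "tle n (fset n j D) A" using e D fset_subset[OF j n2] by (auto simp: extremal_def)
      from tle_eset_zero[OF this _ False A j n] show ?thesis using * by (simp add: canf_imp)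
    qed
  qed
  then show ?thesis using e False A by (simp add: A' extremal_def ybrow_def)
qed

section \<open>Extremal weights along the blocks\<close>

fun adm :: "nat \<Rightarrow> nat list \<Rightarrow> nat set \<Rightarrow> bool" where
  "adm n [] A = True"
| "adm n (j # js) A = (\<not> canf n j A \<and> adm n js (sset n j A))"

lemma adm_append: "adm n (xs @ ys) A \<longleftrightarrow> adm n xs A \<and> adm n ys (fold (sset n) xs A)"
  by (induction xs arbitrary: A) auto

lemma extremal_fold:
  "extremal n r A \<Longrightarrow> set js \<subseteq> {1..n} \<Longrightarrow> 4 \<le> n \<Longrightarrow> (\<And>j. j \<in> set js \<Longrightarrow> c j \<noteq> 0) \<Longrightarrow> adm n js A \<Longrightarrow>
    extremal n (fold (\<lambda>i. ybrow n i (c i)) js r) (fold (sset n) js A)"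
proof (induction js arbitrary: r A)
  case (Cons j js)
  have "extremal n (ybrow n j (c j) r) (sset n j A)"
    by (rule extremal_step) (use Cons.prems in auto)
  from Cons.IH[OF this] Cons.prems show ?case by simp
qed simp

text \<open>The extremal weights met at the ends of blocks. Membership of \<open>n\<close> is a
  separate flag because every block toggles it.\<close>

definition tset :: "nat \<Rightarrow> nat \<Rightarrow> bool \<Rightarrow> nat set" where
  "tset n p e = {p..<n} \<union> (if e then {n} else {})"

lemma adm_idle:
  "(\<And>j. j \<in> set js \<Longrightarrow> \<not> canf n j A \<and> \<not> cane n j A) \<Longrightarrow> adm n js A \<and> fold (sset n) js A = A"
  by (induction js) (auto simp: sset_def)

text \<open>Letters below \<open>p\<close> are idle. Letter \<open>p\<close> fills position
  \<open>p\<close> and empties \<open>p + 1\<close>, and each further letter moves this gap up by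
  one position.\<close>

lemma tset_run:
  assumes "1 \<le> p" "p < n" "m < n" "p \<le> m"
  shows "adm n [1..<m] (tset n (p + 1) e) \<and>
    fold (sset n) [1..<m] (tset n (p + 1) e) = {p..<m} \<union> {m + 1..<n} \<union> (if e then {n} else {})"
  using assms(4,3)
proof (induction rule: dec_induct)
  case base
  have "adm n [1..<p] (tset n (p + 1) e) \<and> fold (sset n) [1..<p] (tset n (p + 1) e) = tset n (p + 1) e"
    by (rule adm_idle) (use assms in \<open>auto simp: tset_def canf_def cane_def up_def dn_def\<close>)
  then show ?case by (simp add: tset_def)
next
  case (step m)
  let ?S = "{p..<m} \<union> {m + 1..<n} \<union> (if e then {n} else {})"
  have IH: "adm n [1..<m] (tset n (p + 1) e)" "fold (sset n) [1..<m] (tset n (p + 1) e) = ?S"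
    using step by auto
  have "cane n m ?S" using step by (auto simp: cane_def up_def dn_def)
  then have "sset n m ?S = eset n m ?S" "\<not> canf n m ?S" by (auto simp: sset_def cane_imp)
  moreover have "eset n m ?S = {p..<Suc m} \<union> {Suc m + 1..<n} \<union> (if e then {n} else {})"
    using step assms by (auto simp: eset_def up_def dn_def)
  moreover have "[1..<Suc m] = [1..<m] @ [m]" using assms step by simp
  ultimately show ?case using IH by (simp add: adm_append)
qed

text \<open>When the gap has reached \<open>n - 1\<close>, exactly one of the last two letters
  closes it: letter \<open>n - 1\<close> does so by moving \<open>n\<close> down if \<open>n\<close>
  is present, and letter \<open>n\<close> by adding both elements if it is absent.\<close>

lemma block_run:
  assumes "1 \<le> p" "p < n" "2 \<le> n"
  shows "adm n [1..<n + 1] (tset n (p + 1) e)" "fold (sset n) [1..<n + 1] (tset n (p + 1) e) = tset n p (\<not> e)"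
proof -
  let ?S = "{p..<n - 1} \<union> (if e then {n} else {})"
  have s: "adm n [1..<n - 1] (tset n (p + 1) e)" "fold (sset n) [1..<n - 1] (tset n (p + 1) e) = ?S"
    using tset_run[of p n "n - 1" e] assms by auto
  have l: "[1..<n + 1] = [1..<n - 1] @ [n - 1, n]"
  proof -
    obtain k where "n = Suc (Suc k)" using assms(3) by (intro that[of "n - 2"]) simp
    then show ?thesis by (simp add: One_nat_def)
  qed
  have 1: "\<not> canf n (n - 1) ?S" using assms by (auto simp: canf_def up_def)
  have 2: "sset n (n - 1) ?S = (if e then {p..<n} else ?S)"
    using assms by (auto simp: sset_def canf_def cane_def up_def dn_def eset_def)
  have 3: "\<not> canf n n (if e then {p..<n} else ?S)" using assms by (auto simp: canf_def up_def)
  have 4: "sset n n (if e then {p..<n} else ?S) = tset n p (\<not> e)"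
    using assms by (auto simp: sset_def canf_def cane_def up_def dn_def eset_def tset_def)
  show "adm n [1..<n + 1] (tset n (p + 1) e)" "fold (sset n) [1..<n + 1] (tset n (p + 1) e) = tset n p (\<not> e)"
    unfolding l using s 1 2 3 4 by (simp_all add: adm_append)
qed

lemma extremal_block:
  assumes "extremal n r (tset n (p + 1) e)" "1 \<le> p" "p < n" "4 \<le> n" "\<And>i. i \<in> {1..n} \<Longrightarrow> c i \<noteq> 0"
  shows "extremal n (brow n c r) (tset n p (\<not> e))"
  unfolding brow_def block_run(2)[OF assms(2,3) _, of e, OF order.trans[OF _ assms(4)], symmetric, simplified]
  by (rule extremal_fold[OF assms(1)]) (use block_run(1)[of p n e] assms in auto)

lemma tset_subset: "1 \<le> p \<Longrightarrow> 1 \<le> n \<Longrightarrow> tset n p e \<subseteq> {1..n}"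
  by (auto simp: tset_def)

lemma extremal_blocks:
  assumes "1 \<le> p" "p + m \<le> n" "4 \<le> n" "1 \<le> a"
    and "\<And>b i. b \<in> {a..<a + m} \<Longrightarrow> i \<in> {1..n} \<Longrightarrow> c b i \<noteq> 0"
  shows "extremal n (fold (\<lambda>b. brow n (c b)) [a..<a + m] (delta (tset n (p + m) e))) (tset n p (e \<noteq> odd m))"
  using assms(1,2,5)
proof (induction m arbitrary: p)
  case 0
  have "tset n p e \<subseteq> {1..n}" using assms(3) 0 by (intro tset_subset) auto
  then show ?case using extremal_delta by simp
next
  case (Suc m)
  have "extremal n (fold (\<lambda>b. brow n (c b)) [a..<a + m] (delta (tset n (p + 1 + m) e))) (tset n (p + 1) (e \<noteq> odd m))"
    by (rule Suc.IH) (use Suc.prems in auto)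
  from extremal_block[OF this Suc.prems(1) _ assms(3), of "c (a + m)"] Suc.prems assms(4)
  show ?case by (simp add: add.commute add.left_commute One_nat_def)
qed

section \<open>The invariant pairing\<close>

text \<open>The exponent changes parity under every move by a simple root: neighbouring positions
  have exponents differing by 1, and the pair \<open>n - 1\<close>, \<open>n\<close> contributes 1
  and 0.\<close>

definition jsg :: "nat \<Rightarrow> nat set \<Rightarrow> complex" where
  "jsg n B = (- 1) ^ (\<Sum>a\<in>{1..n} - B. n - a)"

text \<open>Complementary sets carry opposite weights, so this is the invariant bilinear form of the
  full spin representation. The parity of \<open>n\<close> decides whether it pairs each half-spin
  summand with itself or with the other.\<close>

definition beta :: "nat \<Rightarrow> row \<Rightarrow> row \<Rightarrow> complex" where
  "beta n r r' = (\<Sum>B\<in>Pow {1..n}. jsg n B * r ({1..n} - B) * r' B)"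

lemma compl_can:
  assumes "i \<in> {1..n}" "2 \<le> n"
  shows "canf n i ({1..n} - B) \<longleftrightarrow> cane n i B" "cane n i ({1..n} - B) \<longleftrightarrow> canf n i B"
  using up_dn_subset[OF assms] unfolding canf_def cane_def by blast+

lemma compl_fset:
  assumes "i \<in> {1..n}" "2 \<le> n" "B \<subseteq> {1..n}"
  shows "canf n i B \<Longrightarrow> {1..n} - fset n i B = eset n i ({1..n} - B)"
    "cane n i B \<Longrightarrow> {1..n} - eset n i B = fset n i ({1..n} - B)"
  using up_dn_subset[OF assms(1,2)] up_dn_disj[of n i] assms(3) unfolding canf_def cane_def eset_def fset_def by blast+

lemma jsg_eset:
  assumes "cane n i B" "B \<subseteq> {1..n}" "i \<in> {1..n}" "2 \<le> n"
  shows "jsg n (eset n i B) = - jsg n B"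
proof (cases "i < n")
  case True
  let ?R = "{1..n} - B - {i}"
  have B: "i \<notin> B" "i + 1 \<in> B" using assms True by (auto simp: cane_def up_def dn_def)
  have 1: "{1..n} - B = insert i ?R" using B True assms by auto
  have 2: "{1..n} - eset n i B = insert (i + 1) ?R"
    using B True assms by (auto simp: eset_def up_def dn_def)
  have s1: "(\<Sum>a\<in>{1..n} - B. n - a) = (n - i) + (\<Sum>a\<in>?R. n - a)"
    by (subst 1, subst sum.insert) auto
  have s2: "(\<Sum>a\<in>{1..n} - eset n i B. n - a) = (n - (i + 1)) + (\<Sum>a\<in>?R. n - a)"
    by (subst 2, subst sum.insert) (use B in auto)
  have "n - i = Suc (n - (i + 1))" using True by simp
  then show ?thesis unfolding jsg_def s1 s2 by (simp only: power_add power_Suc) simp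
next
  case False
  then have i: "i = n" using assms by simp
  let ?R = "{1..n} - B - {n - 1, n}"
  have B: "n - 1 \<notin> B" "n \<notin> B" using assms i by (auto simp: cane_def up_def dn_def)
  have 1: "{1..n} - B = insert (n - 1) (insert n ?R)" using B assms by auto
  have 2: "{1..n} - eset n i B = ?R"
    using B i assms by (auto simp: eset_def up_def dn_def)
  have "(\<Sum>a\<in>{1..n} - B. n - a) = (n - (n - 1)) + ((n - n) + (\<Sum>a\<in>?R. n - a))"
    by (subst 1, subst sum.insert, use assms in auto)
  moreover have "n - (n - 1) = 1" using assms by simp
  ultimately show ?thesis unfolding jsg_def 2 by (simp add: One_nat_def)
qed

lemma jsg_fset:
  assumes "canf n i B" "B \<subseteq> {1..n}" "i \<in> {1..n}" "2 \<le> n"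
  shows "jsg n (fset n i B) = - jsg n B"
  using jsg_eset[of n i "fset n i B"] assms fset_subset[of i n B] by (simp add: canf_imp)

text \<open>Invariance under the Lie algebra generator: lowering and raising by \<open>i\<close>
  match the two sums term by term, and \<open>jsg\<close> changes sign in between.\<close>

lemma beta_cross:
  assumes i: "i \<in> {1..n}" and n: "2 \<le> n"
  shows "(\<Sum>B\<in>Pow {1..n}. jsg n B * (if canf n i B then r ({1..n} - B) * r' (fset n i B) else 0)) +
    (\<Sum>B\<in>Pow {1..n}. jsg n B * (if cane n i B then r (fset n i ({1..n} - B)) * r' B else 0)) = 0"
proof -
  let ?P = "{B \<in> Pow {1..n}. canf n i B}" and ?Q = "{B \<in> Pow {1..n}. cane n i B}"
  have "(\<Sum>B\<in>Pow {1..n}. jsg n B * (if canf n i B then r ({1..n} - B) * r' (fset n i B) else 0)) =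
      (\<Sum>B\<in>?P. jsg n B * (r ({1..n} - B) * r' (fset n i B)))"
    by (rule sum.mono_neutral_cong_right) auto
  also have "\<dots> = (\<Sum>B\<in>?Q. - (jsg n B * (r (fset n i ({1..n} - B)) * r' B)))"
    by (rule sum.reindex_bij_witness[of _ "eset n i" "fset n i"])
       (use i n in \<open>auto simp: canf_imp cane_imp compl_can compl_fset jsg_eset jsg_fset
          dest: subsetD[OF eset_subset[OF i n]] subsetD[OF fset_subset[OF i n]]\<close>)
  also have "(\<Sum>B\<in>?Q. - (jsg n B * (r (fset n i ({1..n} - B)) * r' B))) =
      - (\<Sum>B\<in>Pow {1..n}. jsg n B * (if cane n i B then r (fset n i ({1..n} - B)) * r' B else 0))"
    unfolding sum_negf by (intro arg_cong[where f = uminus] sum.mono_neutral_cong_left) auto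
  finally show ?thesis by simp
qed

lemma beta_cross':
  assumes i: "i \<in> {1..n}" and n: "2 \<le> n"
  shows "(\<Sum>B\<in>Pow {1..n}. jsg n B * (if cane n i B then r ({1..n} - B) * r' (eset n i B) else 0)) +
    (\<Sum>B\<in>Pow {1..n}. jsg n B * (if canf n i B then r (eset n i ({1..n} - B)) * r' B else 0)) = 0"
proof -
  let ?P = "{B \<in> Pow {1..n}. canf n i B}" and ?Q = "{B \<in> Pow {1..n}. cane n i B}"
  have "(\<Sum>B\<in>Pow {1..n}. jsg n B * (if canf n i B then r (eset n i ({1..n} - B)) * r' B else 0)) =
      (\<Sum>B\<in>?P. jsg n B * (r (eset n i ({1..n} - B)) * r' B))"
    by (rule sum.mono_neutral_cong_right) auto
  also have "\<dots> = (\<Sum>B\<in>?Q. - (jsg n B * (r ({1..n} - B) * r' (eset n i B))))"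
    by (rule sum.reindex_bij_witness[of _ "eset n i" "fset n i"])
       (use i n in \<open>auto simp: canf_imp cane_imp compl_can compl_fset jsg_eset jsg_fset
          dest: subsetD[OF eset_subset[OF i n]] subsetD[OF fset_subset[OF i n]]\<close>)
  also have "(\<Sum>B\<in>?Q. - (jsg n B * (r ({1..n} - B) * r' (eset n i B)))) =
      - (\<Sum>B\<in>Pow {1..n}. jsg n B * (if cane n i B then r ({1..n} - B) * r' (eset n i B) else 0))"
    unfolding sum_negf by (intro arg_cong[where f = uminus] sum.mono_neutral_cong_left) auto
  finally show ?thesis by simp
qed

text \<open>There is no term quadratic in \<open>t\<close>, because a set can be raised exactly when
  its complement can be lowered, and no set can be both. The linear terms cancel by
  \<open>beta_cross'\<close>.\<close>

lemma beta_x: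
  assumes i: "i \<in> {1..n}" and n: "2 \<le> n"
  shows "beta n (xrow n i t r) (xrow n i t r') = beta n r r'"
proof -
  have "beta n (xrow n i t r) (xrow n i t r') = (\<Sum>B\<in>Pow {1..n}. jsg n B * r ({1..n} - B) * r' B +
      t * (jsg n B * (if cane n i B then r ({1..n} - B) * r' (eset n i B) else 0) +
        jsg n B * (if canf n i B then r (eset n i ({1..n} - B)) * r' B else 0)))"
    unfolding beta_def
    by (intro sum.cong refl) (auto simp: xrow_def compl_can[OF i n] canf_imp cane_imp algebra_simps)
  also have "\<dots> = beta n r r'"
    unfolding sum.distrib sum_distrib_left[symmetric] beta_cross'[OF i n] by (simp add: beta_def)
  finally show ?thesis .
qed

lemma beta_y:
  assumes i: "i \<in> {1..n}" and n: "2 \<le> n"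
  shows "beta n (yrow n i t r) (yrow n i t r') = beta n r r'"
proof -
  have "beta n (yrow n i t r) (yrow n i t r') = (\<Sum>B\<in>Pow {1..n}. jsg n B * r ({1..n} - B) * r' B +
      t * (jsg n B * (if canf n i B then r ({1..n} - B) * r' (fset n i B) else 0) +
        jsg n B * (if cane n i B then r (fset n i ({1..n} - B)) * r' B else 0)))"
    unfolding beta_def
    by (intro sum.cong refl) (auto simp: yrow_def compl_can[OF i n] canf_imp cane_imp algebra_simps)
  also have "\<dots> = beta n r r'"
    unfolding sum.distrib sum_distrib_left[symmetric] beta_cross[OF i n] by (simp add: beta_def)
  finally show ?thesis .
qed

lemma beta_h:
  assumes i: "i \<in> {1..n}" and n: "2 \<le> n" and t: "t \<noteq> 0"
  shows "beta n (hrow n i t r) (hrow n i t r') = beta n r r'"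
  unfolding beta_def
  using assms compl_can[OF i n] by (intro sum.cong refl) (auto simp: hrow_cases canf_imp cane_imp)

lemma beta_ybrow:
  assumes "i \<in> {1..n}" "2 \<le> n" "c \<noteq> 0"
  shows "beta n (ybrow n i c r) (ybrow n i c r') = beta n r r'"
  using assms by (simp add: ybrow_eq beta_h beta_y)

lemma beta_sbrow:
  assumes "i \<in> {1..n}" "2 \<le> n"
  shows "beta n (sbrow n i r) (sbrow n i r') = beta n r r'"
  using assms by (simp add: sbrow_eq beta_x beta_y)

lemma beta_fold:
  "(\<And>x r r'. x \<in> set xs \<Longrightarrow> beta n (F x r) (F x r') = beta n r r') \<Longrightarrow>
    beta n (fold F xs r) (fold F xs r') = beta n r r'"
  by (induction xs arbitrary: r r') auto

lemma beta_brow: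
  "2 \<le> n \<Longrightarrow> (\<And>i. i \<in> {1..n} \<Longrightarrow> c i \<noteq> 0) \<Longrightarrow> beta n (brow n c r) (brow n c r') = beta n r r'"
  unfolding brow_def by (rule beta_fold) (auto intro: beta_ybrow)

lemma beta_cong: "req n r s \<Longrightarrow> req n r' s' \<Longrightarrow> beta n r r' = beta n s s'"
  unfolding beta_def by (intro sum.cong refl) (auto simp: req_def)

section \<open>The Clifford action of the vector representation\<close>

definition sg :: "nat \<Rightarrow> nat set \<Rightarrow> complex" where
  "sg j D = (- 1) ^ card (D \<inter> {..<j})"

text \<open>Right multiplication by the creation operator \<open>a\<^sub>j\<^sup>*\<close> and by \<open>(-1)\<^bsup>n - j\<^esup> a\<^sub>j\<close>.  The sign makes all structure
  constants of the lowering operators on the vector representation equal to \<open>1\<close>.\<close>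

definition crow :: "nat \<Rightarrow> row \<Rightarrow> row" where
  "crow j r D = (if j \<notin> D then sg j D * r (insert j D) else 0)"

definition arow :: "nat \<Rightarrow> nat \<Rightarrow> row \<Rightarrow> row" where
  "arow n j r D = (if j \<in> D then (- 1) ^ (n - j) * sg j D * r (D - {j}) else 0)"

lemma sg_insert: "finite D \<Longrightarrow> a \<notin> D \<Longrightarrow> sg j (insert a D) = (if a < j then - sg j D else sg j D)"
  by (auto simp: sg_def Int_insert_left)

lemma sg_Suc: "finite D \<Longrightarrow> sg (j + 1) D = (if j \<in> D then - sg j D else sg j D)"
proof -
  assume "finite D"
  have "D \<inter> {..<j + 1} = (if j \<in> D then insert j (D \<inter> {..<j}) else D \<inter> {..<j})" by (auto simp: less_Suc_eq One_nat_def)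
  then show ?thesis using \<open>finite D\<close> by (simp add: sg_def)
qed

text \<open>No position other than \<open>i\<close> and \<open>i + 1\<close> separates these two, so
  moving one to the other leaves the sign at \<open>z\<close> unchanged. For the last letter
  \<open>z\<close> lies below both removed positions.\<close>

lemma sg_fset:
  assumes "canf n i D" "finite D" "z \<notin> up n i \<union> dn n i" "z \<le> n"
  shows "sg z (fset n i D) = sg z D"
proof (cases "i < n")
  case True
  let ?E = "D - {i}"
  have D: "i \<in> D" "i + 1 \<notin> D" using assms True by (auto simp: canf_def up_def dn_def)
  have "sg z (fset n i D) = sg z (insert (i + 1) ?E)" using True by (simp add: fset_def up_def dn_def)
  also have "\<dots> = sg z (insert i ?E)"
    using assms True D by (simp add: sg_insert up_def dn_def del: insert_Diff_single)
  finally show ?thesis using D by (simp add: insert_absorb)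
next
  case False
  then have "(D - {n - 1, n}) \<inter> {..<z} = D \<inter> {..<z}"
    using assms by (auto simp: up_def)
  then show ?thesis using False by (simp add: sg_def fset_def up_def dn_def)
qed

lemma can_insert:
  assumes "z \<notin> up n i \<union> dn n i"
  shows "canf n i (insert z D) = canf n i D" "cane n i (insert z D) = cane n i D"
    "fset n i (insert z D) = insert z (fset n i D)"
    "canf n i (D - {z}) = canf n i D" "cane n i (D - {z}) = cane n i D"
    "fset n i (D - {z}) = fset n i D - {z}" "z \<in> fset n i D \<longleftrightarrow> z \<in> D"
  using assms by (auto simp: canf_def cane_def fset_def)

lemma cliff_commute:
  assumes "finite D" "z \<notin> up n i \<union> dn n i" "z \<le> n"
  shows "crow z (ybrow n i c r) D = ybrow n i c (crow z r) D"
    "arow n z (ybrow n i c r) D = ybrow n i c (arow n z r) D"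
  using sg_fset[OF _ assms] can_insert[OF assms(2)]
  by (simp_all add: crow_def arow_def ybrow_def distrib_left)

text \<open>The four possible occupations of two positions. All relations between Clifford operators
  and a letter are checked on these sets.\<close>

lemma split2:
  assumes "finite D"
  obtains D0 where "finite D0" "x \<notin> D0" "y \<notin> D0"
    "D = D0 \<or> D = insert x D0 \<or> D = insert y D0 \<or> D = insert x (insert y D0)"
proof
  show "D = D - {x, y} \<or> D = insert x (D - {x, y}) \<or> D = insert y (D - {x, y}) \<or>
      D = insert x (insert y (D - {x, y}))"
    by auto
qed (use assms in auto)

lemma cliff_values:
  assumes "finite D0" "a \<notin> D0" "b \<notin> D0" "b = a + 1" "b \<le> n"
  shows "crow a r D0 = sg a D0 * r (insert a D0)" "crow a r (insert a D0) = 0"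
    "crow a r (insert b D0) = sg a D0 * r (insert a (insert b D0))"
    "crow a r (insert a (insert b D0)) = 0"
    "crow b r D0 = sg a D0 * r (insert b D0)" "crow b r (insert b D0) = 0"
    "crow b r (insert a D0) = - sg a D0 * r (insert a (insert b D0))"
    "crow b r (insert a (insert b D0)) = 0"
    "arow n a r D0 = 0" "arow n a r (insert a D0) = - ((- 1) ^ (n - b)) * sg a D0 * r D0"
    "arow n a r (insert b D0) = 0"
    "arow n a r (insert a (insert b D0)) = - ((- 1) ^ (n - b)) * sg a D0 * r (insert b D0)"
    "arow n b r D0 = 0" "arow n b r (insert b D0) = (- 1) ^ (n - b) * sg a D0 * r D0"
    "arow n b r (insert a D0) = 0"
    "arow n b r (insert a (insert b D0)) = - ((- 1) ^ (n - b)) * sg a D0 * r (insert a D0)"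
proof -
  have s: "sg b D0 = sg a D0" using assms by (simp add: sg_Suc)
  have p: "n - a = Suc (n - b)" using assms by simp
  have ab: "a < b" "a \<noteq> b" "b \<noteq> a" "\<not> b < a" using assms by auto
  have c: "insert b (insert a D0) = insert a (insert b D0)" by (rule insert_commute)
  have d: "insert a (insert b D0) - {b} = insert a D0" "insert a (insert b D0) - {a} = insert b D0"
    "insert a D0 - {a} = D0" "insert b D0 - {b} = D0" using assms ab by auto
  note [simp] = assms(1-3) ab s c d sg_insert
  have "insert a D0 - {b} = insert a D0" using ab by auto
  show "crow a r D0 = sg a D0 * r (insert a D0)" "crow a r (insert a D0) = 0"
    "crow a r (insert b D0) = sg a D0 * r (insert a (insert b D0))"
    "crow a r (insert a (insert b D0)) = 0"
    "crow b r D0 = sg a D0 * r (insert b D0)" "crow b r (insert b D0) = 0"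
    "crow b r (insert a D0) = - sg a D0 * r (insert a (insert b D0))"
    "crow b r (insert a (insert b D0)) = 0"
    by (simp_all add: crow_def)
  show "arow n a r D0 = 0" "arow n a r (insert a D0) = - ((- 1) ^ (n - b)) * sg a D0 * r D0"
    "arow n a r (insert b D0) = 0"
    "arow n a r (insert a (insert b D0)) = - ((- 1) ^ (n - b)) * sg a D0 * r (insert b D0)"
    "arow n b r D0 = 0" "arow n b r (insert b D0) = (- 1) ^ (n - b) * sg a D0 * r D0"
    "arow n b r (insert a D0) = 0"
    "arow n b r (insert a (insert b D0)) = - ((- 1) ^ (n - b)) * sg a D0 * r (insert a D0)"
    unfolding arow_def p by simp_all
qed

lemma ybrow_values:
  assumes "i < n" "i \<notin> D0" "i + 1 \<notin> D0"
  shows "ybrow n i c r D0 = r D0" "ybrow n i c r (insert i D0) = r (insert i D0) / c + r (insert (i + 1) D0)"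
    "ybrow n i c r (insert (i + 1) D0) = c * r (insert (i + 1) D0)"
    "ybrow n i c r (insert i (insert (i + 1) D0)) = r (insert i (insert (i + 1) D0))"
  using assms by (simp_all add: ybrow_def canf_def cane_def fset_def up_def dn_def)

lemma ybrow_values_n:
  assumes "2 \<le> n" "n - 1 \<notin> D0" "n \<notin> D0"
  shows "ybrow n n c r D0 = c * r D0" "ybrow n n c r (insert (n - 1) D0) = r (insert (n - 1) D0)"
    "ybrow n n c r (insert n D0) = r (insert n D0)"
    "ybrow n n c r (insert (n - 1) (insert n D0)) = r (insert (n - 1) (insert n D0)) / c + r D0"
proof -
  have "insert (n - 1) (insert n D0) - {n - 1, n} = D0" "n - 1 \<noteq> n" using assms by auto
  then show "ybrow n n c r D0 = c * r D0" "ybrow n n c r (insert (n - 1) D0) = r (insert (n - 1) D0)"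
    "ybrow n n c r (insert n D0) = r (insert n D0)"
    "ybrow n n c r (insert (n - 1) (insert n D0)) = r (insert (n - 1) (insert n D0)) / c + r D0"
    using assms by (simp_all add: ybrow_def canf_def cane_def fset_def up_def dn_def)
qed

text \<open>The four coefficients are those of the same letter on the vector representation: two of
  the basis vectors are rescaled, and the other two also acquire the neighbour with coefficient
  1.\<close>

lemma cliff_i:
  assumes "finite D" "i < n" "1 \<le> i" "c \<noteq> 0"
  shows "crow i (ybrow n i c r) D = ybrow n i c (crow i r) D / c + ybrow n i c (crow (i + 1) r) D"
    "crow (i + 1) (ybrow n i c r) D = c * ybrow n i c (crow (i + 1) r) D"
    "arow n (i + 1) (ybrow n i c r) D = ybrow n i c (arow n (i + 1) r) D / c + ybrow n i c (arow n i r) D"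
    "arow n i (ybrow n i c r) D = c * ybrow n i c (arow n i r) D"
proof -
  obtain D0 where D: "finite D0" "i \<notin> D0" "i + 1 \<notin> D0"
    "D = D0 \<or> D = insert i D0 \<or> D = insert (i + 1) D0 \<or> D = insert i (insert (i + 1) D0)"
    using split2[OF assms(1)] by metis
  have l: "i + 1 \<le> n" using assms(2) by simp
  note v = cliff_values[OF D(1-3) refl l] ybrow_values[OF assms(2) D(2,3)]
  show "crow i (ybrow n i c r) D = ybrow n i c (crow i r) D / c + ybrow n i c (crow (i + 1) r) D"
    using D(4) assms(4) by (elim disjE) (simp_all only: v, simp_all add: field_simps)
  show "crow (i + 1) (ybrow n i c r) D = c * ybrow n i c (crow (i + 1) r) D"
    using D(4) assms(4) by (elim disjE) (simp_all only: v, simp_all add: field_simps)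
  show "arow n (i + 1) (ybrow n i c r) D = ybrow n i c (arow n (i + 1) r) D / c + ybrow n i c (arow n i r) D"
    using D(4) assms(4) by (elim disjE) (simp_all only: v, simp_all add: field_simps)
  show "arow n i (ybrow n i c r) D = c * ybrow n i c (arow n i r) D"
    using D(4) assms(4) by (elim disjE) (simp_all only: v, simp_all add: field_simps)
qed

text \<open>Since \<open>\<alpha>\<^sub>n = \<epsilon>\<^sub>n\<^sub>-\<^sub>1 +
  \<epsilon>\<^sub>n\<close>, the last letter mixes creation at \<open>n - 1\<close> with
  annihilation at \<open>n\<close> and conversely. It is the only letter that connects weights
  \<open>\<epsilon>\<^sub>j\<close> with weights \<open>-\<epsilon>\<^sub>j\<close>.\<close>

lemma cliff_n:
  assumes "finite D" "2 \<le> n" "c \<noteq> 0"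
  shows "crow (n - 1) (ybrow n n c r) D = ybrow n n c (crow (n - 1) r) D / c + ybrow n n c (arow n n r) D"
    "crow n (ybrow n n c r) D = ybrow n n c (crow n r) D / c + ybrow n n c (arow n (n - 1) r) D"
    "arow n n (ybrow n n c r) D = c * ybrow n n c (arow n n r) D"
    "arow n (n - 1) (ybrow n n c r) D = c * ybrow n n c (arow n (n - 1) r) D"
proof -
  obtain D0 where D: "finite D0" "n - 1 \<notin> D0" "n \<notin> D0"
    "D = D0 \<or> D = insert (n - 1) D0 \<or> D = insert n D0 \<or> D = insert (n - 1) (insert n D0)"
    using split2[OF assms(1)] by metis
  have l: "n = n - 1 + 1" using assms(2) by simp
  note v = cliff_values[OF D(1-3) l order.refl] ybrow_values_n[OF assms(2) D(2,3)]
  show "crow (n - 1) (ybrow n n c r) D = ybrow n n c (crow (n - 1) r) D / c + ybrow n n c (arow n n r) D"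
    using D(4) assms(3) by (elim disjE) (simp_all only: v, simp_all add: field_simps)
  show "crow n (ybrow n n c r) D = ybrow n n c (crow n r) D / c + ybrow n n c (arow n (n - 1) r) D"
    using D(4) assms(3) by (elim disjE) (simp_all only: v, simp_all add: field_simps)
  show "arow n n (ybrow n n c r) D = c * ybrow n n c (arow n n r) D"
    using D(4) assms(3) by (elim disjE) (simp_all only: v, simp_all add: field_simps)
  show "arow n (n - 1) (ybrow n n c r) D = c * ybrow n n c (arow n (n - 1) r) D"
    using D(4) assms(3) by (elim disjE) (simp_all only: v, simp_all add: field_simps)
qed

section \<open>The vector representation\<close>

text \<open>Vectors of the representation of dimension \<open>2 * n\<close>: the first component
  holds the coordinates at the creation operators, the second, called barred below, those at the
  signed annihilation operators.\<close>

type_synonym vec2 = "(nat \<Rightarrow> complex) \<times> (nat \<Rightarrow> complex)"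

definition gam :: "nat \<Rightarrow> vec2 \<Rightarrow> row \<Rightarrow> row" where
  "gam n w r D = (\<Sum>j = 1..n. fst w j * crow j r D) + (\<Sum>j = 1..n. snd w j * arow n j r D)"

definition vstep :: "nat \<Rightarrow> nat \<Rightarrow> complex \<Rightarrow> vec2 \<Rightarrow> vec2" where
  "vstep n i c w = (if i < n then
     ((fst w)(i := fst w i / c, i + 1 := fst w i + c * fst w (i + 1)),
      (snd w)(i + 1 := snd w (i + 1) / c, i := snd w (i + 1) + c * snd w i))
   else
     ((fst w)(n - 1 := fst w (n - 1) / c, n := fst w n / c),
      (snd w)(n := fst w (n - 1) + c * snd w n, n - 1 := fst w n + c * snd w (n - 1))))"

text \<open>A Clifford operator standing after a block passes its last letter first, hence the
  reversed order compared with \<open>brow\<close>.\<close>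

definition vblock :: "nat \<Rightarrow> (nat \<Rightarrow> complex) \<Rightarrow> vec2 \<Rightarrow> vec2" where
  "vblock n c w = foldr (\<lambda>i. vstep n i (c i)) [1..<n + 1] w"

definition evec :: "nat \<Rightarrow> vec2" where
  "evec j = (\<lambda>i. of_bool (i = j), \<lambda>_. 0)"

lemma ybrow_sum:
  "ybrow n i c (\<lambda>D. \<Sum>j\<in>J. f j * g j D) D = (\<Sum>j\<in>J. f j * ybrow n i c (g j) D)"
  by (simp add: ybrow_def sum_divide_distrib sum.distrib sum_distrib_left distrib_left mult.left_commute)

lemma ybrow_add: "ybrow n i c (\<lambda>D. r D + r' D) D = ybrow n i c r D + ybrow n i c r' D"
  by (simp add: ybrow_def add_divide_distrib distrib_left)

lemma sum_split2:
  fixes a b n :: nat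
  assumes "a \<in> {1..n}" "b \<in> {1..n}" "a \<noteq> b"
  shows "(\<Sum>j = 1..n. f j) = (f a + f b + (\<Sum>j\<in>{1..n} - {a, b}. f j) :: complex)"
proof -
  let ?R = "{1..n} - {a, b}"
  have "{1..n} = insert a (insert b ?R)" using assms by auto
  then have "(\<Sum>j = 1..n. f j) = sum f (insert a (insert b ?R))" by (rule arg_cong)
  also have "\<dots> = f a + sum f (insert b ?R)" by (rule sum.insert) (use assms in auto)
  also have "sum f (insert b ?R) = f b + sum f ?R" by (rule sum.insert) auto
  finally show ?thesis by (simp add: add.assoc)
qed

text \<open>The Clifford action is equivariant: what an operator picks up on passing a letter is the
  action of that letter on its vector. Only the coordinates \<open>a\<close> and
  \<open>a + 1\<close> are mixed.\<close>

lemma gam_ybrow: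
  assumes i: "i \<in> {1..n}" and n: "2 \<le> n" and c: "c \<noteq> 0" and D: "finite D"
  shows "gam n w (ybrow n i c r) D = ybrow n i c (gam n (vstep n i c w) r) D"
proof -
  define K where "K j = ybrow n i c (crow j r) D" for j
  define L where "L j = ybrow n i c (arow n j r) D" for j
  define a where "a = (if i < n then i else n - 1)"
  have a: "a \<in> {1..n}" "a + 1 \<in> {1..n}" "a \<noteq> a + 1" using i n by (auto simp: a_def)
  have rhs: "ybrow n i c (gam n w' r) D = (\<Sum>j = 1..n. fst w' j * K j) + (\<Sum>j = 1..n. snd w' j * L j)" for w'
    by (simp only: gam_def[abs_def] ybrow_add ybrow_sum K_def L_def)
  have rest: "crow j (ybrow n i c r) D = K j" "arow n j (ybrow n i c r) D = L j"
    if "j \<in> {1..n} - {a, a + 1}" for j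
    unfolding K_def L_def
    by (rule cliff_commute[OF D]; use that i n in \<open>auto simp: a_def up_def dn_def split: if_splits\<close>)+
  have keep: "fst (vstep n i c w) j = fst w j" "snd (vstep n i c w) j = snd w j"
    if "j \<in> {1..n} - {a, a + 1}" for j
  proof -
    have "(i < n \<and> a = i) \<or> (i = n \<and> a = n - 1 \<and> a + 1 = n)" using i n by (auto simp: a_def)
    then show "fst (vstep n i c w) j = fst w j" "snd (vstep n i c w) j = snd w j"
      using that by (elim disjE; simp add: vstep_def)+
  qed
  have "gam n w (ybrow n i c r) D =
      (fst w a * crow a (ybrow n i c r) D + fst w (a + 1) * crow (a + 1) (ybrow n i c r) D) +
      (snd w a * arow n a (ybrow n i c r) D + snd w (a + 1) * arow n (a + 1) (ybrow n i c r) D) +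
      ((\<Sum>j\<in>{1..n} - {a, a + 1}. fst w j * K j) + (\<Sum>j\<in>{1..n} - {a, a + 1}. snd w j * L j))"
  proof -
    have "(\<Sum>j\<in>{1..n} - {a, a + 1}. fst w j * crow j (ybrow n i c r) D) = (\<Sum>j\<in>{1..n} - {a, a + 1}. fst w j * K j)"
      "(\<Sum>j\<in>{1..n} - {a, a + 1}. snd w j * arow n j (ybrow n i c r) D) = (\<Sum>j\<in>{1..n} - {a, a + 1}. snd w j * L j)"
      by (intro sum.cong refl arg_cong2[where f = "(*)"] rest; assumption)+
    then show ?thesis unfolding gam_def sum_split2[OF a] by simp
  qed
  also have "(fst w a * crow a (ybrow n i c r) D + fst w (a + 1) * crow (a + 1) (ybrow n i c r) D) +
      (snd w a * arow n a (ybrow n i c r) D + snd w (a + 1) * arow n (a + 1) (ybrow n i c r) D) =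
      (fst (vstep n i c w) a * K a + fst (vstep n i c w) (a + 1) * K (a + 1)) +
      (snd (vstep n i c w) a * L a + snd (vstep n i c w) (a + 1) * L (a + 1))"
  proof (cases "i < n")
    case True
    then have "a = i" "1 \<le> i" using i by (auto simp: a_def)
    then show ?thesis
      using cliff_i[OF D True \<open>1 \<le> i\<close> c, of r] True unfolding K_def L_def \<open>a = i\<close>
      by (simp add: vstep_def algebra_simps)
  next
    case False
    then have "i = n" "a = n - 1" "a + 1 = n" using i n by (auto simp: a_def)
    then show ?thesis
      using cliff_n[OF D n c, of r] n unfolding K_def L_def \<open>a + 1 = n\<close> \<open>a = n - 1\<close> \<open>i = n\<close>
      by (simp add: vstep_def algebra_simps)
  qed
  also have "(fst (vstep n i c w) a * K a + fst (vstep n i c w) (a + 1) * K (a + 1)) +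
      (snd (vstep n i c w) a * L a + snd (vstep n i c w) (a + 1) * L (a + 1)) +
      ((\<Sum>j\<in>{1..n} - {a, a + 1}. fst w j * K j) + (\<Sum>j\<in>{1..n} - {a, a + 1}. snd w j * L j)) =
      (\<Sum>j = 1..n. fst (vstep n i c w) j * K j) + (\<Sum>j = 1..n. snd (vstep n i c w) j * L j)"
  proof -
    have "(\<Sum>j\<in>{1..n} - {a, a + 1}. fst w j * K j) = (\<Sum>j\<in>{1..n} - {a, a + 1}. fst (vstep n i c w) j * K j)"
      "(\<Sum>j\<in>{1..n} - {a, a + 1}. snd w j * L j) = (\<Sum>j\<in>{1..n} - {a, a + 1}. snd (vstep n i c w) j * L j)"
      by (intro sum.cong refl arg_cong2[where f = "(*)"] keep[symmetric]; assumption)+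
    then show ?thesis unfolding sum_split2[OF a] by simp
  qed
  finally show ?thesis unfolding rhs .
qed

lemma req_trans: "req n r s \<Longrightarrow> req n s t \<Longrightarrow> req n r t" by (simp add: req_def)

lemma finite_sub: "D \<subseteq> {1..n} \<Longrightarrow> finite (D :: nat set)" by (rule finite_subset) auto

lemma req_crow: "j \<in> {1..n} \<Longrightarrow> req n r r' \<Longrightarrow> req n (crow j r) (crow j r')"
  by (simp add: req_def crow_def)

lemma gam_steps:
  assumes "2 \<le> n"
  shows "set js \<subseteq> {1..n} \<Longrightarrow> (\<And>i. i \<in> set js \<Longrightarrow> c i \<noteq> 0) \<Longrightarrow>
    req n (gam n w (fold (\<lambda>i. ybrow n i (c i)) js r))
      (fold (\<lambda>i. ybrow n i (c i)) js (gam n (foldr (\<lambda>i. vstep n i (c i)) js w) r))"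
proof (induction js arbitrary: r)
  case (Cons j js)
  have "req n (gam n w (fold (\<lambda>i. ybrow n i (c i)) js (ybrow n j (c j) r)))
      (fold (\<lambda>i. ybrow n i (c i)) js (gam n (foldr (\<lambda>i. vstep n i (c i)) js w) (ybrow n j (c j) r)))"
    by (rule Cons.IH) (use Cons.prems in auto)
  moreover have "req n (gam n (foldr (\<lambda>i. vstep n i (c i)) js w) (ybrow n j (c j) r))
      (ybrow n j (c j) (gam n (vstep n j (c j) (foldr (\<lambda>i. vstep n i (c i)) js w)) r))"
    unfolding req_def
  proof (intro allI impI)
    fix D assume "D \<subseteq> {1..n}"
    then show "gam n (foldr (\<lambda>i. vstep n i (c i)) js w) (ybrow n j (c j) r) D =
        ybrow n j (c j) (gam n (vstep n j (c j) (foldr (\<lambda>i. vstep n i (c i)) js w)) r) D"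
      by (intro gam_ybrow finite_sub) (use Cons.prems assms in auto)
  qed
  then have "req n (fold (\<lambda>i. ybrow n i (c i)) js (gam n (foldr (\<lambda>i. vstep n i (c i)) js w) (ybrow n j (c j) r)))
      (fold (\<lambda>i. ybrow n i (c i)) js (ybrow n j (c j) (gam n (vstep n j (c j) (foldr (\<lambda>i. vstep n i (c i)) js w)) r)))"
  proof (rule req_fold[rotated])
    fix x r r' assume "x \<in> set js" "req n r r'"
    then show "req n (ybrow n x (c x) r) (ybrow n x (c x) r')"
      using Cons.prems assms by (intro req_ybrow) auto
  qed
  ultimately show ?case unfolding fold_Cons foldr_Cons o_apply by (rule req_trans)
qed (simp add: req_refl)

lemma gam_brow:
  assumes "2 \<le> n" "\<And>i. i \<in> {1..n} \<Longrightarrow> c i \<noteq> 0"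
  shows "req n (gam n w (brow n c r)) (brow n c (gam n (vblock n c w) r))"
  unfolding brow_def vblock_def by (rule gam_steps) (use assms in auto)

lemma gam_blocks:
  assumes "2 \<le> n"
  shows "(\<And>m i. m \<in> set ms \<Longrightarrow> i \<in> {1..n} \<Longrightarrow> c m i \<noteq> 0) \<Longrightarrow>
    req n (gam n w (fold (\<lambda>m. brow n (c m)) ms r))
      (fold (\<lambda>m. brow n (c m)) ms (gam n (foldr (\<lambda>m. vblock n (c m)) ms w) r))"
proof (induction ms arbitrary: r)
  case (Cons m ms)
  have "req n (gam n w (fold (\<lambda>m. brow n (c m)) ms (brow n (c m) r)))
      (fold (\<lambda>m. brow n (c m)) ms (gam n (foldr (\<lambda>m. vblock n (c m)) ms w) (brow n (c m) r)))"
    by (rule Cons.IH) (use Cons.prems in auto)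
  moreover have "req n (gam n (foldr (\<lambda>m. vblock n (c m)) ms w) (brow n (c m) r))
      (brow n (c m) (gam n (vblock n (c m) (foldr (\<lambda>m. vblock n (c m)) ms w)) r))"
    by (rule gam_brow) (use Cons.prems assms in auto)
  then have "req n (fold (\<lambda>m. brow n (c m)) ms (gam n (foldr (\<lambda>m. vblock n (c m)) ms w) (brow n (c m) r)))
      (fold (\<lambda>m. brow n (c m)) ms (brow n (c m) (gam n (vblock n (c m) (foldr (\<lambda>m. vblock n (c m)) ms w)) r)))"
    by (rule req_fold[rotated]) (use assms in \<open>auto intro: req_brow\<close>)
  ultimately show ?case unfolding fold_Cons foldr_Cons o_apply by (rule req_trans)
qed (simp add: req_refl)

lemma gam_evec: "j \<in> {1..n} \<Longrightarrow> gam n (evec j) r = crow j r"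
proof
  fix D assume j: "j \<in> {1..n}"
  have "(\<Sum>i = 1..n. of_bool (i = j) * crow i r D) = (\<Sum>i\<in>{j}. of_bool (i = j) * crow i r D)"
    by (rule sum.mono_neutral_right) (use j in auto)
  then show "gam n (evec j) r D = crow j r D" by (simp add: gam_def evec_def)
qed

text \<open>The composite of the creation operators \<open>a\<^sub>1\<^sup>*, \<dots>, a\<^sub>k\<^sup>*\<close>.\<close>

definition prow :: "nat \<Rightarrow> row \<Rightarrow> row" where
  "prow k r D = (if D \<inter> {1..k} = {} then r (D \<union> {1..k}) else 0)"

text \<open>Each new operator is evaluated at sets without smaller elements, so all its signs are
  1.\<close>

lemma fold_crow:
  assumes "k \<le> n"
  shows "req n (fold crow [1..<k + 1] r) (prow k r)"
  using assms
proof (induction k)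
  case 0 then show ?case by (simp add: req_def prow_def)
next
  case (Suc k)
  have "crow (k + 1) (prow k r) D = prow (k + 1) r D" if D: "D \<subseteq> {1..n}" for D
  proof (cases "D \<inter> {1..k + 1} = {}")
    case True
    then have *: "D \<inter> {..<k + 1} = {}" "k + 1 \<notin> D" "D \<inter> {1..k} = {}" using D by force+
    have "insert (k + 1) D \<union> {1..k} = D \<union> {1..k + 1}" by auto
    then show ?thesis using * True by (simp add: crow_def prow_def sg_def)
  next
    case False
    then have "k + 1 \<in> D \<or> insert (k + 1) D \<inter> {1..k} \<noteq> {}" by (auto simp: le_Suc_eq One_nat_def)
    then show ?thesis using False by (auto simp: crow_def prow_def)
  qed
  then have "req n (crow (k + 1) (prow k r)) (prow (k + 1) r)" by (simp add: req_def)
  moreover have "req n (crow (k + 1) (fold crow [1..<k + 1] r)) (crow (k + 1) (prow k r))"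
    by (rule req_crow) (use Suc in auto)
  ultimately show ?case by (auto simp: One_nat_def intro: req_trans)
qed

text \<open>The first \<open>k\<close> basis vectors span a subspace stable under the raising
  elements, which act on its top exterior power trivially. Combinatorially, a raising letter never
  moves an element into an initial segment and out of it at the same position; \<open>K\<close>
  expresses this.\<close>

lemma prow_xrow:
  assumes "k \<le> n - 2" "i \<in> {1..n}" "4 \<le> n"
  shows "prow k (xrow n i t r) D = xrow n i t (prow k r) D"
proof -
  have K: "up n i \<inter> {1..k} = {} \<Longrightarrow> dn n i \<inter> {1..k} = {}"
    using assms by (auto simp: up_def dn_def)
  have 1: "cane n i (D \<union> {1..k}) = (cane n i D \<and> eset n i D \<inter> {1..k} = {})" if "D \<inter> {1..k} = {}"
    using that K unfolding cane_def eset_def by blast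
  have 2: "eset n i (D \<union> {1..k}) = eset n i D \<union> {1..k}" if "D \<inter> {1..k} = {}" "cane n i (D \<union> {1..k})"
    using that K unfolding cane_def eset_def by blast
  have 3: "D \<inter> {1..k} = {}" if "cane n i D" "eset n i D \<inter> {1..k} = {}"
    using that K unfolding cane_def eset_def by blast
  show ?thesis using 1 2 3 by (auto simp: prow_def xrow_def)
qed

text \<open>The reflection \<open>s\<^sub>k\<close> sends
  \<open>\<epsilon>\<^sub>1 + \<dots> + \<epsilon>\<^sub>k\<close> to the sum in which
  \<open>\<epsilon>\<^sub>k\<close> is replaced by
  \<open>\<epsilon>\<^sub>k\<^sub>+\<^sub>1\<close>. Accordingly its representative exchanges the
  last creation operator for the next one, with sign 1.\<close>

lemma prow_sbrow:
  assumes "1 \<le> k" "k < n" "D \<subseteq> {1..n}"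
  shows "prow k (sbrow n k r) D = sbrow n k (crow (k + 1) (prow (k - 1) r)) D"
proof -
  have un: "X \<union> {1..k} = insert k (X \<union> {1..k - 1})" for X using assms by auto
  have it: "X \<inter> {1..k} = {} \<longleftrightarrow> k \<notin> X \<and> X \<inter> {1..k - 1} = {}" for X
  proof -
    have "{1..k} = insert k {1..k - 1}" using assms by auto
    then show ?thesis by auto
  qed
  have s: "sg (k + 1) X = 1" if "X \<subseteq> {1..n}" "X \<inter> {1..k - 1} = {}" "k \<notin> X" for X
  proof -
    have "x \<notin> X" if "x < k + 1" for x
    proof
      assume "x \<in> X"
      moreover from this have "1 \<le> x" "x \<noteq> k" using \<open>X \<subseteq> {1..n}\<close> \<open>k \<notin> X\<close> by auto
      ultimately have "x \<in> X \<inter> {1..k - 1}" using that by auto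
      then show False using \<open>X \<inter> {1..k - 1} = {}\<close> by simp
    qed
    then have "X \<inter> {..<k + 1} = {}" by auto
    then show ?thesis by (simp add: sg_def)
  qed
  show ?thesis
  proof (cases "D \<inter> {1..k - 1} = {}")
    case False
    then obtain z where z: "z \<in> D" "z \<in> {1..k - 1}" by blast
    then have zz: "z \<in> {1..k}" "z \<noteq> k" "z \<noteq> k + 1" by auto
    have "prow k (sbrow n k r) D = 0" using z zz by (auto simp: prow_def)
    moreover have "prow (k - 1) r (insert (k + 1) X) = 0" if "z \<in> X" for X
      using that z by (auto simp: prow_def)
    ultimately show ?thesis using z zz assms
      by (auto simp: sbrow_def crow_def fset_def eset_def up_def dn_def)
  next
    case True
    show ?thesis
    proof (cases "k \<in> D")
      case kD: True
      then have l: "prow k (sbrow n k r) D = 0" using assms by (auto simp: prow_def)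
      show ?thesis
        unfolding l using kD assms by (auto simp: sbrow_def crow_def fset_def eset_def canf_def cane_def up_def dn_def)
    next
      case kD: False
      have D0: "D \<inter> {1..k} = {}" using True kD it by simp
      show ?thesis
      proof (cases "k + 1 \<in> D")
        case kk: True
        have can: "\<not> canf n k D" "cane n k D" using kD kk assms by (auto simp: canf_def cane_def up_def dn_def)
        have can2: "\<not> canf n k (D \<union> {1..k})" "\<not> cane n k (D \<union> {1..k})"
          using kD kk assms by (auto simp: canf_def cane_def up_def dn_def)
        let ?E = "eset n k D"
        have E: "?E = insert k (D - {k + 1})" using assms by (auto simp: eset_def up_def dn_def)
        \<comment> \<open>The element \<open>k\<close> stands before \<open>k + 1\<close> and
          produces a sign, which cancels the one in \<open>sbrow\<close>.\<close>
        have "sg (k + 1) ?E = - sg (k + 1) (D - {k + 1})"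
          unfolding E using kD finite_sub[OF assms(3)] by (subst sg_insert) auto
        also have "sg (k + 1) (D - {k + 1}) = 1" using True kD assms(3) by (intro s) auto
        finally have sgE: "sg (k + 1) ?E = - 1" .
        have "insert (k + 1) ?E \<inter> {1..k - 1} = {}" using True assms unfolding E by auto
        moreover have "insert (k + 1) ?E \<union> {1..k - 1} = D \<union> {1..k}" unfolding E un using kk by auto
        moreover have "k + 1 \<notin> ?E" unfolding E by simp
        ultimately show ?thesis
          using D0 can can2 sgE by (simp add: prow_def sbrow_def crow_def)
      next
        case kk: False
        have can: "\<not> canf n k D" "\<not> cane n k D" using kD kk assms by (auto simp: canf_def cane_def up_def dn_def)
        have can2: "canf n k (D \<union> {1..k})"
          using kD kk assms by (auto simp: canf_def cane_def up_def dn_def)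
        have "fset n k (D \<union> {1..k}) = insert (k + 1) D \<union> {1..k - 1}"
          using kD assms by (auto simp: fset_def up_def dn_def)
        moreover have "insert (k + 1) D \<inter> {1..k - 1} = {}" using True by auto
        ultimately show ?thesis
          using D0 can can2 kk s[OF assms(3) True kD] by (simp add: prow_def sbrow_def crow_def)
      qed
    qed
  qed
qed

lemma foldr_upt_first: "a < b \<Longrightarrow> foldr F [a..<b] w = F a (foldr F [a + 1..<b] w)"
  by (subst upt_conv_Cons) (simp_all add: One_nat_def)

text \<open>Letters act from \<open>n\<close> down to \<open>j\<close>. An unbarred particle goes
  from \<open>l\<close> to \<open>l + 1\<close> by letter \<open>l\<close>, after letter
  \<open>l + 1\<close> has already acted, so it advances at most once. A barred one descends and can
  use all later letters; this is why the coordinate at \<open>n - 1\<close> spreads over the whole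
  barred part.\<close>

lemma vblock_unbarred:
  assumes n: "4 \<le> n" and v: "\<And>l. snd w l = 0" and u: "\<And>l. l = 0 \<or> n \<le> l \<Longrightarrow> fst w l = 0"
    and c: "\<And>i. i \<in> {1..n} \<Longrightarrow> c i \<noteq> 0" and j: "1 \<le> j" "j \<le> n - 1"
  defines "x \<equiv> foldr (\<lambda>i. vstep n i (c i)) [j..<n + 1] w"
  shows "\<And>l. l < j \<Longrightarrow> fst x l = fst w l" "\<And>l. n < l \<Longrightarrow> fst x l = 0"
    "j < n - 1 \<Longrightarrow> fst x j = fst w j / c j"
    "\<And>l. j < l \<Longrightarrow> l \<le> n - 2 \<Longrightarrow> fst x l = c (l - 1) / c l * fst w l + fst w (l - 1)"
    "fst x (n - 1) = (if j = n - 1 then fst w (n - 1) / (c (n - 1) * c n)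
       else c (n - 2) / (c (n - 1) * c n) * fst w (n - 1) + fst w (n - 2))"
    "fst x n = fst w (n - 1) / c n"
    "\<And>l. l < j \<Longrightarrow> snd x l = 0" "snd x j = fst w (n - 1)"
    "\<And>l. j < l \<Longrightarrow> l \<le> n \<Longrightarrow> snd x l = fst w (n - 1) / c (l - 1)"
    "\<And>l. n < l \<Longrightarrow> snd x l = 0"
proof -
  let ?x = "\<lambda>j. foldr (\<lambda>i. vstep n i (c i)) [j..<n + 1] w"
  define P where "P j x \<longleftrightarrow> (\<forall>l. l < j \<longrightarrow> fst x l = fst w l) \<and> (\<forall>l. n < l \<longrightarrow> fst x l = 0) \<and>
    (j < n - 1 \<longrightarrow> fst x j = fst w j / c j) \<and>
    (\<forall>l. j < l \<longrightarrow> l \<le> n - 2 \<longrightarrow> fst x l = c (l - 1) / c l * fst w l + fst w (l - 1)) \<and>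
    fst x (n - 1) = (if j = n - 1 then fst w (n - 1) / (c (n - 1) * c n)
       else c (n - 2) / (c (n - 1) * c n) * fst w (n - 1) + fst w (n - 2)) \<and>
    fst x n = fst w (n - 1) / c n \<and>
    (\<forall>l. l < j \<longrightarrow> snd x l = 0) \<and> snd x j = fst w (n - 1) \<and>
    (\<forall>l. j < l \<longrightarrow> l \<le> n \<longrightarrow> snd x l = fst w (n - 1) / c (l - 1)) \<and>
    (\<forall>l. n < l \<longrightarrow> snd x l = 0)" for j and x :: vec2
  have "P j (?x j)" using j(2,1)
  proof (induction rule: inc_induct)
    case base
    obtain m where m: "n = Suc m" using n by (cases n) auto
    have l: "[n - 1..<n + 1] = [n - 1, n]" by (simp add: m One_nat_def upt_rec)
    have cn: "c (n - 1) \<noteq> 0" "c n \<noteq> 0" using c n by auto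
    have un: "fst w n = 0" using u by simp
    show ?case
      unfolding P_def l using n cn un v u
      by (auto simp: vstep_def m One_nat_def) (metis Suc_leI diff_Suc_Suc diff_zero le_antisym)
  next
    case (step j)
    have P: "P (Suc j) (?x (Suc j))" using step by simp
    have e: "?x j = vstep n j (c j) (?x (Suc j))"
      unfolding Suc_eq_plus1 by (rule foldr_upt_first) (use step in linarith)
    have jn: "j < n" "Suc j \<le> n - 1" "1 \<le> j" using step by auto
    have cj: "c j \<noteq> 0" "c (n - 1) \<noteq> 0" "c n \<noteq> 0" using c[of j] c[of "n - 1"] c[of n] step n by auto
    define y where "y = ?x (Suc j)"
    have y: "\<And>l. l < Suc j \<Longrightarrow> fst y l = fst w l" "\<And>l. n < l \<Longrightarrow> fst y l = 0"
      "Suc j < n - 1 \<Longrightarrow> fst y (Suc j) = fst w (Suc j) / c (Suc j)"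
      "\<And>l. Suc j < l \<Longrightarrow> l \<le> n - 2 \<Longrightarrow> fst y l = c (l - 1) / c l * fst w l + fst w (l - 1)"
      "fst y (n - 1) = (if Suc j = n - 1 then fst w (n - 1) / (c (n - 1) * c n)
       else c (n - 2) / (c (n - 1) * c n) * fst w (n - 1) + fst w (n - 2))"
      "fst y n = fst w (n - 1) / c n"
      "\<And>l. l < Suc j \<Longrightarrow> snd y l = 0" "snd y (Suc j) = fst w (n - 1)"
      "\<And>l. Suc j < l \<Longrightarrow> l \<le> n \<Longrightarrow> snd y l = fst w (n - 1) / c (l - 1)"
      "\<And>l. n < l \<Longrightarrow> snd y l = 0"
      using P unfolding P_def y_def by blast+
    have fx: "fst (?x j) l = (if l = Suc j then fst w j + c j * fst y (Suc j) else if l = j then fst w j / c j else fst y l)" for l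
      unfolding e y_def[symmetric] using jn y(1)[of j] by (simp add: vstep_def One_nat_def)
    have sx: "snd (?x j) l = (if l = j then fst w (n - 1) else if l = Suc j then fst w (n - 1) / c j else snd y l)" for l
      unfolding e y_def[symmetric] using jn y(7)[of j] y(8) by (simp add: vstep_def One_nat_def)
    show ?case
      unfolding P_def
    proof (intro conjI allI impI)
      show "fst (?x j) l = fst w l" if "l < j" for l using that y(1)[of l] by (simp add: fx)
      show "fst (?x j) l = 0" if "n < l" for l using that y(2)[of l] jn by (simp add: fx)
      show "fst (?x j) j = fst w j / c j" by (simp add: fx)
      show "fst (?x j) l = c (l - 1) / c l * fst w l + fst w (l - 1)" if "j < l" "l \<le> n - 2" for l
      proof (cases "l = Suc j")
        case True
        then have "Suc j < n - 1" using that n by simp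
        then show ?thesis using True y(3) by (simp add: fx)
      next
        case False then show ?thesis using that y(4)[of l] by (simp add: fx)
      qed
      show "fst (?x j) (n - 1) = (if j = n - 1 then fst w (n - 1) / (c (n - 1) * c n)
       else c (n - 2) / (c (n - 1) * c n) * fst w (n - 1) + fst w (n - 2))"
      proof (cases "Suc j = n - 1")
        case True
        then have "j = n - 2" "j \<noteq> n - 1" using n by auto
        moreover have "fst (?x j) (n - 1) = fst w j + c j * fst y (n - 1)" using fx[of "n - 1"] True by simp
        ultimately show ?thesis using y(5) True by simp
      next
        case False then show ?thesis using y(5) jn by (simp add: fx)
      qed
      have "n \<noteq> Suc j" "n \<noteq> j" using jn by linarith+
      then show "fst (?x j) n = fst w (n - 1) / c n" using y(6) by (simp add: fx)
      show "snd (?x j) l = 0" if "l < j" for l using that y(7)[of l] by (simp add: sx)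
      show "snd (?x j) j = fst w (n - 1)" by (simp add: sx)
      show "snd (?x j) l = fst w (n - 1) / c (l - 1)" if "j < l" "l \<le> n" for l
        using that y(9)[of l] by (cases "l = Suc j") (auto simp: sx)
      show "snd (?x j) l = 0" if "n < l" for l using that y(10)[of l] jn by (simp add: sx)
    qed
  qed
  then have "P j x" by (simp add: x_def)
  then show "\<And>l. l < j \<Longrightarrow> fst x l = fst w l" "\<And>l. n < l \<Longrightarrow> fst x l = 0"
    "j < n - 1 \<Longrightarrow> fst x j = fst w j / c j"
    "\<And>l. j < l \<Longrightarrow> l \<le> n - 2 \<Longrightarrow> fst x l = c (l - 1) / c l * fst w l + fst w (l - 1)"
    "fst x (n - 1) = (if j = n - 1 then fst w (n - 1) / (c (n - 1) * c n)
       else c (n - 2) / (c (n - 1) * c n) * fst w (n - 1) + fst w (n - 2))"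
    "fst x n = fst w (n - 1) / c n"
    "\<And>l. l < j \<Longrightarrow> snd x l = 0" "snd x j = fst w (n - 1)"
    "\<And>l. j < l \<Longrightarrow> l \<le> n \<Longrightarrow> snd x l = fst w (n - 1) / c (l - 1)"
    "\<And>l. n < l \<Longrightarrow> snd x l = 0"
    unfolding P_def by blast+
qed

text \<open>To end at the barred coordinate 1 a barred particle at \<open>l\<close> stays once,
  under letter \<open>l\<close>, and descends under all smaller letters; this gives the factor
  \<open>c l\<close>. The other terms enter through the last two letters.\<close>

lemma vblock_first_row:
  assumes n: "4 \<le> n"
  shows "snd (vblock n c w) 1 = fst w (n - 1) + c n * snd w n + c (n - 1) * fst w n +
    c (n - 1) * c n * snd w (n - 1) + (\<Sum>l = 1..n - 2. c l * snd w l)"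
proof -
  have *: "snd (foldr (\<lambda>i. vstep n i (c i)) [1..<j + 1] x) 1 = snd x (j + 1) + (\<Sum>l = 1..j. c l * snd x l)"
    if "j \<le> n - 1" for j x
    using that
  proof (induction j arbitrary: x)
    case (Suc j)
    have jn: "Suc j < n" using Suc.prems n by simp
    have "foldr (\<lambda>i. vstep n i (c i)) [1..<Suc j + 1] x =
        foldr (\<lambda>i. vstep n i (c i)) [1..<j + 1] (vstep n (Suc j) (c (Suc j)) x)"
      by (simp add: One_nat_def)
    also have "snd \<dots> 1 = snd (vstep n (Suc j) (c (Suc j)) x) (j + 1) +
        (\<Sum>l = 1..j. c l * snd (vstep n (Suc j) (c (Suc j)) x) l)"
      by (rule Suc.IH) (use Suc.prems in simp)
    also have "(\<Sum>l = 1..j. c l * snd (vstep n (Suc j) (c (Suc j)) x) l) = (\<Sum>l = 1..j. c l * snd x l)"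
      by (rule sum.cong) (use jn in \<open>auto simp: vstep_def\<close>)
    also have "snd (vstep n (Suc j) (c (Suc j)) x) (j + 1) = snd x (j + 2) + c (Suc j) * snd x (Suc j)"
      using jn by (simp add: vstep_def One_nat_def)
    finally show ?case by (simp add: One_nat_def)
  qed simp
  have l: "[1..<n + 1] = [1..<(n - 1) + 1] @ [n]" using n by (simp add: One_nat_def)
  have "snd (vblock n c w) 1 = snd (foldr (\<lambda>i. vstep n i (c i)) [1..<(n - 1) + 1] (vstep n n (c n) w)) 1"
    unfolding vblock_def l by simp
  also have "\<dots> = snd (vstep n n (c n) w) n + (\<Sum>l = 1..n - 1. c l * snd (vstep n n (c n) w) l)"
    using *[of "n - 1" "vstep n n (c n) w"] n by simp
  also have "(\<Sum>l = 1..n - 1. c l * snd (vstep n n (c n) w) l) =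
      c (n - 1) * snd (vstep n n (c n) w) (n - 1) + (\<Sum>l = 1..n - 2. c l * snd (vstep n n (c n) w) l)"
  proof -
    have "{1..n - 1} = insert (n - 1) {1..n - 2}" "\<not> n - 1 \<le> n - 2" using n by auto
    then show ?thesis using n by simp
  qed
  also have "(\<Sum>l = 1..n - 2. c l * snd (vstep n n (c n) w) l) = (\<Sum>l = 1..n - 2. c l * snd w l)"
    by (rule sum.cong) (use n in \<open>auto simp: vstep_def\<close>)
  finally show ?thesis using n by (simp add: vstep_def algebra_simps)
qed

section \<open>Peeling off blocks\<close>

lemma pre_member: "a \<in> {1..i} \<Longrightarrow> a \<in> C \<Longrightarrow> 1 \<le> pre i C"
  unfolding pre_def using member_le_sum[of a "{1..i}" "\<lambda>a. of_bool (a \<in> C) :: int"] by simp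

lemma pre_empty: "C \<inter> {1..i} = {} \<Longrightarrow> pre i C = 0"
  unfolding pre_def by (rule sum.neutral) auto

lemma pre_last:
  assumes "2 \<le> n"
  shows "pre n C = pre (n - 2) C + of_bool (n - 1 \<in> C) + of_bool (n \<in> C)"
proof -
  have "n - 1 - 1 = n - 2" by simp
  then show ?thesis using pre_pos[of n C] pre_pos[of "n - 1" C] assms by simp
qed

text \<open>The top of the row after the block has no element up to \<open>n - 2\<close>, and
  comparison of prefix counts extends this to the whole support. Creation operators at these
  positions therefore give zero. Only the one at \<open>n - 1\<close> contributes, and parity leaves
  a single set.\<close>

lemma peel_block:
  assumes n: "4 \<le> n" and c: "\<And>i. i \<in> {1..n} \<Longrightarrow> c i \<noteq> 0"
    and v: "\<And>l. snd w l = 0" and u: "fst w n = 0" "fst w (n - 1) = 1"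
  shows "req n (gam n w (brow n c (delta (tset n n e)))) (delta (tset n n (\<not> e)))"
  unfolding req_def
proof (intro allI impI)
  fix D assume D: "D \<subseteq> {1..n}"
  define X where "X = brow n c (delta (tset n n e))"
  define S where "S = tset n (n - 1) (\<not> e)"
  have X: "extremal n X S"
    unfolding X_def S_def
    using extremal_block[of n "delta (tset n n e)" "n - 1" e c] extremal_delta[OF tset_subset[of n n e]] n c by simp
  have S0: "S \<inter> {1..n - 2} = {}" using n by (auto simp: S_def tset_def)
  have small: "C \<inter> {1..n - 2} = {} \<and> even (pre n C - pre n S)" if "C \<subseteq> {1..n}" "X C \<noteq> 0" for C
  proof -
    have t: "tle n C S" using X that by (auto simp: extremal_def)
    then have "pre (n - 2) C \<le> pre (n - 2) S" by (simp add: tle_def)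
    then show ?thesis using pre_member[of _ "n - 2" C] pre_empty[OF S0] t by (fastforce simp: tle_def)
  qed
  have zero: "fst w j * crow j X D = 0" if "j \<in> {1..n}" "j \<noteq> n - 1" for j
  proof (cases "j = n")
    case True then show ?thesis using u by simp
  next
    case False
    then have "j \<in> {1..n - 2}" using that by auto
    then have "X (insert j D) = 0" using small[of "insert j D"] D that by auto
    then show ?thesis by (simp add: crow_def)
  qed
  have "(\<Sum>j = 1..n. fst w j * crow j X D) = (\<Sum>j\<in>{n - 1}. fst w j * crow j X D)"
    by (rule sum.mono_neutral_right) (use n zero in auto)
  then have g: "gam n w X D = crow (n - 1) X D" using u v by (simp add: gam_def)
  have "crow (n - 1) X D = delta (tset n n (\<not> e)) D"
  proof (cases "D = tset n n (\<not> e)")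
    case True
    have "insert (n - 1) D = S" using n unfolding True S_def by (auto simp: tset_def)
    moreover have "n - 1 \<notin> D" "D \<inter> {..<n - 1} = {}" using n unfolding True by (auto simp: tset_def)
    ultimately show ?thesis using X True by (simp add: crow_def sg_def delta_def extremal_def)
  next
    case False
    have "crow (n - 1) X D = 0"
    proof (rule ccontr)
      assume "crow (n - 1) X D \<noteq> 0"
      then have nD: "n - 1 \<notin> D" and X0: "X (insert (n - 1) D) \<noteq> 0" by (auto simp: crow_def split: if_splits)
      have s: "insert (n - 1) D \<inter> {1..n - 2} = {}" "even (pre n (insert (n - 1) D) - pre n S)"
        using small[OF _ X0] D n by auto
      have "pre n (insert (n - 1) D) = 1 + of_bool (n \<in> D)" "pre n S = 1 + of_bool (\<not> e)"
        using pre_last[of n "insert (n - 1) D"] pre_last[of n S] pre_empty[OF s(1)] pre_empty[OF S0] n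
        by (auto simp: S_def tset_def)
      then have "n \<in> D \<longleftrightarrow> \<not> e" using s(2) by (auto simp: of_bool_def split: if_splits)
      moreover have "D \<subseteq> {n}"
      proof
        fix x assume x: "x \<in> D"
        then have "x \<in> {1..n}" "x \<notin> {1..n - 2}" "x \<noteq> n - 1" using D s(1) nD by auto
        then show "x \<in> {n}" by auto
      qed
      ultimately have "D = tset n n (\<not> e)" by (auto simp: tset_def)
      then show False using False by simp
    qed
    then show ?thesis using False by (simp add: delta_def)
  qed
  then show "gam n w (brow n c (delta (tset n n e))) D = delta (tset n n (\<not> e)) D"
    using g by (simp add: X_def)
qed

text \<open>No set in the support of \<open>r\<close> contains 1, so its complement does. Since 1 is
  missing from the starting set, only the barred coordinate 1 of \<open>w\<close> can supply
  it.\<close>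

lemma last_pairing:
  assumes n: "4 \<le> n" and r: "extremal n r (tset n 2 (\<not> e))"
  shows "beta n (gam n w (delta (tset n n e))) r = snd w 1"
proof -
  define L where "L = tset n n e"
  define S where "S = tset n 2 (\<not> e)"
  define g where "g = gam n w (delta L)"
  have L: "1 \<notin> L" "L \<subseteq> {n}" using n by (auto simp: L_def tset_def)
  have S: "S \<subseteq> {1..n}" "{1..n} - S = insert 1 L" using n by (auto simp: S_def L_def tset_def)
  have c0: "crow j (delta L) D = 0" if "1 \<in> D" for j D
    using that L by (auto simp: crow_def delta_def)
  have a0: "arow n j (delta L) D = 0" if "1 \<in> D" "j \<noteq> 1 \<or> D \<noteq> insert 1 L" for j D
  proof (rule ccontr)
    assume "arow n j (delta L) D \<noteq> 0"
    then have "j \<in> D" "D - {j} = L" by (auto simp: arow_def delta_def split: if_splits)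
    then show False using that L by auto
  qed
  have g0: "g D = 0" if "1 \<in> D" "D \<noteq> insert 1 L" for D
    using c0[OF that(1)] a0[of D] that by (simp add: g_def gam_def)
  have "(\<Sum>j = 1..n. snd w j * arow n j (delta L) (insert 1 L)) =
      (\<Sum>j\<in>{1}. snd w j * arow n j (delta L) (insert 1 L))"
    by (rule sum.mono_neutral_right) (use n a0 in auto)
  moreover have "arow n 1 (delta L) (insert 1 L) = (- 1) ^ (n - 1)"
  proof -
    have "insert 1 L \<inter> {..<1} = {}" using L n by auto
    then show ?thesis using L by (simp add: arow_def delta_def sg_def)
  qed
  ultimately have g1: "g (insert 1 L) = snd w 1 * (- 1) ^ (n - 1)"
    using c0 by (simp add: g_def gam_def)
  have z: "jsg n B * g ({1..n} - B) * r B = 0" if B: "B \<subseteq> {1..n}" "B \<noteq> S" for B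
  proof (cases "r B = 0")
    case False
    then have "tle n B S" using r B by (auto simp: extremal_def S_def)
    then have "pre 1 B \<le> pre 1 S" using n by (simp add: tle_def)
    moreover have "S \<inter> {1..1} = {}" using n by (auto simp: S_def tset_def)
    ultimately have "1 \<notin> B" using pre_member[of 1 1 B] pre_empty[of S 1] by auto
    moreover have "{1..n} - B \<noteq> insert 1 L" using B S by blast
    ultimately have "g ({1..n} - B) = 0" using n by (intro g0) auto
    then show ?thesis by simp
  qed simp
  have "beta n g r = (\<Sum>B\<in>{S}. jsg n B * g ({1..n} - B) * r B)"
    unfolding beta_def by (rule sum.mono_neutral_right) (use S z in auto)
  also have "\<dots> = jsg n S * g (insert 1 L)" using r S by (simp add: extremal_def S_def)
  \<comment> \<open>This sign cancels the one built into \<open>arow\<close>.\<close>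
  also have "jsg n S = (- 1) ^ (n - 1)"
  proof -
    have "(\<Sum>a\<in>insert 1 L. n - a) = (n - 1) + (\<Sum>a\<in>L. n - a)"
      using L by (subst sum.insert) (auto intro: finite_subset)
    also have "(\<Sum>a\<in>L. n - a) = 0" using L by (intro sum.neutral) auto
    finally show ?thesis by (simp add: jsg_def S)
  qed
  finally have "beta n g r = (- 1) ^ (n - 1) * (snd w 1 * (- 1) ^ (n - 1))" unfolding g1 .
  also have "\<dots> = snd w 1 * ((- 1) ^ (n - 1) * (- 1) ^ (n - 1))" by (simp only: mult_ac)
  also have "(- 1) ^ (n - 1) * (- 1) ^ (n - 1) = (1 :: complex)" by (simp flip: power_add)
  finally show ?thesis by (simp add: g_def L_def)
qed

text \<open>Every block advances the leading coordinate by one with coefficient 1. The coordinate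
  just behind it collects one summand for each block in which the particle stays, namely at position
  \<open>p + n - 1 - b\<close> in block \<open>b\<close>.\<close>

lemma vblocks_top:
  fixes c :: "nat \<Rightarrow> nat \<Rightarrow> complex"
  assumes n: "4 \<le> n" and c: "\<And>b i. b \<in> {a..<n} \<Longrightarrow> i \<in> {1..n} \<Longrightarrow> c b i \<noteq> 0"
    and c0: "\<And>b. b \<in> {a..<n} \<Longrightarrow> c b 0 = 1" and a: "a \<le> n" and p: "1 \<le> p" "p + (n - a) \<le> n - 1"
  defines "W \<equiv> foldr (\<lambda>m. vblock n (c m)) [a..<n] (evec p)"
  shows "snd W l = 0" "l = 0 \<or> p + (n - a) < l \<Longrightarrow> fst W l = 0" "fst W (p + (n - a)) = 1"
    "fst W (p + (n - a) - 1) = (\<Sum>b = a..<n. c b (p + n - 1 - b - 1) / c b (p + n - 1 - b))"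
proof -
  let ?W = "\<lambda>a. foldr (\<lambda>m. vblock n (c m)) [a..<n] (evec p)"
  define P where "P a W \<longleftrightarrow> (\<forall>l. snd W l = 0) \<and> (\<forall>l. l = 0 \<or> p + (n - a) < l \<longrightarrow> fst W l = 0) \<and>
    fst W (p + (n - a)) = 1 \<and>
    fst W (p + (n - a) - 1) = (\<Sum>b = a..<n. c b (p + n - 1 - b - 1) / c b (p + n - 1 - b))"
    for a and W :: vec2
  have "P a (?W a)"
    using a c c0 p(2)
  proof (induction rule: inc_induct)
    case base then show ?case using p by (auto simp: P_def evec_def)
  next
    case (step a)
    define y where "y = ?W (Suc a)"
    define t where "t = p + (n - Suc a)"
    have t: "p + (n - a) = Suc t" "t \<le> n - 2" "1 \<le> t" using step p by (auto simp: t_def)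
    have "P (Suc a) y" unfolding y_def using step by (intro step.IH) auto
    then have y: "\<And>l. snd y l = 0" "\<And>l. l = 0 \<or> t < l \<Longrightarrow> fst y l = 0" "fst y t = 1"
      "fst y (t - 1) = (\<Sum>b = Suc a..<n. c b (p + n - 1 - b - 1) / c b (p + n - 1 - b))"
      by (auto simp: P_def t_def)
    have ca: "\<And>i. i \<in> {1..n} \<Longrightarrow> c a i \<noteq> 0" "c a 0 = 1" using step by auto
    have W: "?W a = vblock n (c a) y"
      using foldr_upt_first[of a n "\<lambda>m. vblock n (c m)" "evec p"] step by (simp add: y_def One_nat_def)
    have yz: "fst y l = 0" if "l = 0 \<or> n \<le> l" for l using y(2)[of l] that t n by auto
    note vb = vblock_unbarred[of n y "c a" 1, OF n y(1) yz ca(1), folded vblock_def]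
    have n1: "1 \<le> n - 1" "1 < n - 1" "1 \<noteq> n - 1" using n by auto
    have yn: "fst y (n - 1) = 0" using y(2)[of "n - 1"] t n by auto
    have f: "fst (?W a) l = c a (l - 1) / c a l * fst y l + fst y (l - 1)" if l: "1 \<le> l" "l \<le> n - 1" for l
    proof -
      consider "l = 1" | "1 < l" "l \<le> n - 2" | "l = n - 1" "l \<noteq> 1" using l by linarith
      then show ?thesis
      proof cases
        case 1 then show ?thesis using vb(3) n1 ca yz[of 0] W by simp
      next
        case 2 then show ?thesis using vb(4)[of l] n1 W by simp
      next
        case 3
        then have "l - 1 = n - 2" by simp
        then show ?thesis using vb(5) n1 W 3 yn by simp
      qed
    qed
    show ?case
      unfolding P_def t
    proof (intro conjI allI impI)
      show "snd (?W a) l = 0" for l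
      proof -
        consider "l < 1" | "l = 1" | "1 < l" "l \<le> n" | "n < l" by linarith
        then show ?thesis using vb(7)[of l] vb(8) vb(9)[of l] vb(10)[of l] n1 yn W by cases auto
      qed
      show "fst (?W a) l = 0" if l: "l = 0 \<or> Suc t < l" for l
      proof -
        consider "l = 0" | "Suc t < l" "l \<le> n - 1" | "l = n" | "n < l" using l by linarith
        then show ?thesis
        proof cases
          case 1 then show ?thesis using vb(1)[of 0] n1 yz[of 0] W by simp
        next
          case 2 then show ?thesis using f[of l] y(2)[of l] y(2)[of "l - 1"] t by simp
        next
          case 3 then show ?thesis using vb(6) n1 yn W by simp
        next
          case 4 then show ?thesis using vb(2)[of l] n1 W by simp
        qed
      qed
      show "fst (?W a) (Suc t) = 1" using f[of "Suc t"] y(2)[of "Suc t"] y(3) t by simp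
      have ia: "p + n - 1 - a = t" using step p by (simp add: t_def)
      have "fst (?W a) t = c a (t - 1) / c a t + fst y (t - 1)" using f[of t] y(3) t by simp
      also have "\<dots> = (\<Sum>b = a..<n. c b (p + n - 1 - b - 1) / c b (p + n - 1 - b))"
        using step sum.atLeast_Suc_lessThan[of a n "\<lambda>b. c b (p + n - 1 - b - 1) / c b (p + n - 1 - b)"]
        unfolding y(4) ia by simp
      finally show "fst (?W a) (Suc t - 1) = (\<Sum>b = a..<n. c b (p + n - 1 - b - 1) / c b (p + n - 1 - b))"
        by simp
    qed
  qed
  then show "snd W l = 0" "l = 0 \<or> p + (n - a) < l \<Longrightarrow> fst W l = 0" "fst W (p + (n - a)) = 1"
    "fst W (p + (n - a) - 1) = (\<Sum>b = a..<n. c b (p + n - 1 - b - 1) / c b (p + n - 1 - b))"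
    unfolding P_def W_def by blast+
qed

section \<open>Matrix entries for given parameters\<close>

locale params =
  fixes n :: nat and c :: "nat \<Rightarrow> nat \<Rightarrow> complex"
  assumes n4: "4 \<le> n"
    and cnz: "m \<in> {1..n - 1} \<Longrightarrow> i \<in> {1..n} \<Longrightarrow> c m i \<noteq> 0"
    and c0: "m \<in> {1..n - 1} \<Longrightarrow> c m 0 = 1"
begin

abbreviation "blocks \<equiv> fold (\<lambda>m. brow n (c m))"
abbreviation "vblocks \<equiv> foldr (\<lambda>m. vblock n (c m))"

text \<open>The blocks \<open>n - 1\<close> down to \<open>k + 2\<close> bring the particle from
  \<open>k + 1\<close> to \<open>n - 1\<close> with coefficient 1, or to \<open>n - 2\<close> with
  the last sum as coefficient. Block \<open>k\<close> must then deliver it to the barred coordinate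
  1, and the positions possible between the blocks \<open>k + 1\<close> and \<open>k\<close> yield
  the remaining terms.\<close>

lemma vector_coefficient:
  assumes k: "1 \<le> k" "k \<le> n - 2"
  shows "snd (vblocks [k..<n] (evec (k + 1))) 1 =
    (\<Sum>j = 1..n - 2. c k j / c (k + 1) (j - 1)) + c k (n - 1) * c k n / c (k + 1) (n - 2)
    + c (k + 1) (n - 2) / (c (k + 1) (n - 1) * c (k + 1) n)
    + c k n / c (k + 1) (n - 1) + c k (n - 1) / c (k + 1) n
    + (\<Sum>j = k + 1..n - 2. c (n + k - j) (j - 1) / c (n + k - j) j)"
proof -
  define W where "W = vblocks [k + 2..<n] (evec (k + 1))"
  define X where "X = vblock n (c (k + 1)) W"
  have top: "k + 1 + (n - (k + 2)) = n - 1" using k n4 by simp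
  have q: "\<And>b i. b \<in> {k + 2..<n} \<Longrightarrow> i \<in> {1..n} \<Longrightarrow> c b i \<noteq> 0" "\<And>b. b \<in> {k + 2..<n} \<Longrightarrow> c b 0 = 1"
    using cnz c0 by auto
  have q2: "k + 2 \<le> n" "1 \<le> k + 1" "k + 1 + (n - (k + 2)) \<le> n - 1" using k n4 by auto
  have n2: "n - 1 - 1 = n - 2" by simp
  note W = vblocks_top[of n "k + 2" c "k + 1", OF n4 q q2, folded W_def, unfolded top n2]
  have W4: "fst W (n - 2) = (\<Sum>b = k + 2..<n. c b (k + 1 + n - 1 - b - 1) / c b (k + 1 + n - 1 - b))"
    by (rule W(4))
  have "(\<Sum>b = k + 2..<n. c b (k + 1 + n - 1 - b - 1) / c b (k + 1 + n - 1 - b)) =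
      (\<Sum>j = k + 1..n - 2. c (n + k - j) (j - 1) / c (n + k - j) j)"
    by (rule sum.reindex_bij_witness[of _ "\<lambda>j. n + k - j" "\<lambda>b. n + k - b"]) (use k n4 in \<open>auto simp: algebra_simps\<close>)
  note W2 = W4[unfolded this]
  have Wz: "fst W l = 0" if "l = 0 \<or> n \<le> l" for l using W(2)[of l] that n4 by auto
  have kk: "k \<in> {1..n - 1}" "k + 1 \<in> {1..n - 1}" using k n4 by auto
  have n1: "1 \<le> n - 1" "1 < n - 1" "1 \<noteq> n - 1" using n4 by auto
  note vb = vblock_unbarred[of n W "c (k + 1)" 1, OF n4 W(1) Wz cnz[OF kk(2)], folded vblock_def X_def]
  have X: "fst X (n - 1) = c (k + 1) (n - 2) / (c (k + 1) (n - 1) * c (k + 1) n) + fst W (n - 2)"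
    "fst X n = 1 / c (k + 1) n" "snd X n = 1 / c (k + 1) (n - 1)"
    using vb(5,6) vb(9)[of n] n1 W(3) n4 by auto
  have Xl: "snd X l = 1 / c (k + 1) (l - 1)" if "1 \<le> l" "l \<le> n - 1" for l
  proof (cases "l = 1")
    case True then show ?thesis using vb(8) n1 W(3) c0[OF kk(2)] by simp
  next
    case False then show ?thesis using vb(9)[of l] that n1 W(3) by auto
  qed
  have "[k..<n] = k # (k + 1) # [k + 2..<n]"
    using k n4 by (simp add: upt_conv_Cons One_nat_def numeral_2_eq_2)
  then have "vblocks [k..<n] (evec (k + 1)) = vblock n (c k) X" by (simp add: X_def W_def)
  then have "snd (vblocks [k..<n] (evec (k + 1))) 1 = fst X (n - 1) + c k n * snd X n + c k (n - 1) * fst X n +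
    c k (n - 1) * c k n * snd X (n - 1) + (\<Sum>l = 1..n - 2. c k l * snd X l)"
    using vblock_first_row[OF n4, of "c k" X] by simp
  also have "snd X (n - 1) = 1 / c (k + 1) (n - 2)"
  proof -
    have "n - 1 - 1 = n - 2" by simp
    then show ?thesis using Xl[of "n - 1"] n4 by simp
  qed
  also have "(\<Sum>l = 1..n - 2. c k l * snd X l) = (\<Sum>j = 1..n - 2. c k j / c (k + 1) (j - 1))"
    using Xl by (intro sum.cong) auto
  finally show ?thesis unfolding X W2 by simp
qed

lemma pairing_value:
  assumes k: "1 \<le> k" "k \<le> n - 2"
  shows "beta n (crow (k + 1) (prow (k - 1) (blocks [1..<n] (delta (tset n n e)))))
      (blocks [1..<n] (delta (tset n (k + 1) (\<not> e)))) = snd (vblocks [k..<n] (evec (k + 1))) 1"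
proof -
  have n2: "2 \<le> n" using n4 by simp
  \<comment> \<open>The second row is only split at \<open>m\<close>: the blocks from
    \<open>m\<close> on are those still shared with the first row, and invariance of
    \<open>beta\<close> can remove only shared blocks.\<close>
  define rr where "rr m = blocks [1..<m] (delta (tset n (k + 1) (\<not> e)))" for m
  \<comment> \<open>Each peeled block toggles membership of \<open>n\<close> in the starting set of
    the first row.\<close>
  define ee where "ee m = (e \<noteq> odd (m - 1))" for m :: nat
  define V where "V m = beta n (crow (k + 1) (fold crow [m..<k] (blocks [m..<n] (delta (tset n n (ee m))))))
      (blocks [m..<n] (rr m))" for m
  have creq: "req n (fold crow js r) (fold crow js r')" if "set js \<subseteq> {1..n}" "req n r r'" for js r r'
    by (rule req_fold[OF _ that(2)]) (use that(1) in \<open>auto intro!: req_crow\<close>)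
  have kn: "k + 1 \<in> {1..n}" using k n4 by auto
  have peel: "V m = V (Suc m)" if m: "1 \<le> m" "m < k" for m
  proof -
    have mn: "m < n" "m \<in> {1..n}" "m \<in> {1..n - 1}" "Suc m \<le> n" using m k by auto
    let ?w = "vblocks [Suc m..<n] (evec m)"
    have t: "m + (n - Suc m) = n - 1" using mn by simp
    have q: "\<And>b i. b \<in> {Suc m..<n} \<Longrightarrow> i \<in> {1..n} \<Longrightarrow> c b i \<noteq> 0" "\<And>b. b \<in> {Suc m..<n} \<Longrightarrow> c b 0 = 1"
      using cnz c0 by auto
    note vt = vblocks_top[of n "Suc m" c m, OF n4 q mn(4) m(1) eq_refl[OF t], unfolded t]
    have w: "\<And>l. snd ?w l = 0" "fst ?w n = 0" "fst ?w (n - 1) = 1"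
      using vt(1) vt(2)[of n] vt(3) n4 by auto
    have e: "ee (Suc m) = (\<not> ee m)" using m by (auto simp: ee_def)
    have b: "blocks [m..<n] r = blocks [Suc m..<n] (brow n (c m) r)" for r
      using mn by (simp add: upt_conv_Cons)
    have rb: "req n (blocks [Suc m..<n] r) (blocks [Suc m..<n] r')" if "req n r r'" for r r'
      by (rule req_fold[OF _ that]) (use n2 in \<open>auto intro: req_brow\<close>)
    have 1: "req n (crow m (blocks [m..<n] (delta (tset n n (ee m)))))
        (blocks [Suc m..<n] (delta (tset n n (ee (Suc m)))))"
    proof -
      have "req n (gam n (evec m) (blocks [Suc m..<n] (brow n (c m) (delta (tset n n (ee m))))))
          (blocks [Suc m..<n] (gam n ?w (brow n (c m) (delta (tset n n (ee m))))))"
        by (rule gam_blocks[OF n2]) (use m cnz in auto)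
      moreover have "req n (gam n ?w (brow n (c m) (delta (tset n n (ee m))))) (delta (tset n n (ee (Suc m))))"
        unfolding e by (rule peel_block[OF n4 cnz[OF mn(3)] w])
      note rb[OF this]
      ultimately have "req n (gam n (evec m) (blocks [Suc m..<n] (brow n (c m) (delta (tset n n (ee m))))))
          (blocks [Suc m..<n] (delta (tset n n (ee (Suc m)))))"
        by (rule req_trans)
      then show ?thesis by (simp only: b gam_evec[OF mn(2)])
    qed
    have f: "fold crow [m..<k] r = fold crow [Suc m..<k] (crow m r)" for r
      using m by (simp add: upt_conv_Cons)
    have 2: "req n (crow (k + 1) (fold crow [m..<k] (blocks [m..<n] (delta (tset n n (ee m))))))
       (crow (k + 1) (fold crow [Suc m..<k] (blocks [Suc m..<n] (delta (tset n n (ee (Suc m)))))))"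
      unfolding f using k by (intro req_crow[OF kn] creq 1) auto
    have 3: "blocks [m..<n] (rr m) = blocks [Suc m..<n] (rr (Suc m))"
      unfolding b using m by (simp add: rr_def)
    show ?thesis unfolding V_def 3 by (rule beta_cong[OF 2 req_refl])
  qed
  have "V m = V k" if "m \<le> k" "1 \<le> m" for m
    using that
  proof (induction rule: inc_induct)
    case (step m)
    have "V m = V (Suc m)" by (rule peel) (use step.prems step.hyps in auto)
    also have "\<dots> = V k" by (rule step.IH) simp
    finally show ?case .
  qed simp
  then have V: "V 1 = V k" using k by blast
  have "V k = snd (vblocks [k..<n] (evec (k + 1))) 1"
  proof -
    let ?w = "vblocks [k..<n] (evec (k + 1))"
    have "req n (gam n (evec (k + 1)) (blocks [k..<n] (delta (tset n n (ee k)))))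
        (blocks [k..<n] (gam n ?w (delta (tset n n (ee k)))))"
      by (rule gam_blocks[OF n2]) (use k cnz in auto)
    then have "V k = beta n (blocks [k..<n] (gam n ?w (delta (tset n n (ee k))))) (blocks [k..<n] (rr k))"
      unfolding V_def gam_evec[OF kn] by (simp add: beta_cong[OF _ req_refl])
    also have "\<dots> = beta n (gam n ?w (delta (tset n n (ee k)))) (rr k)"
      by (rule beta_fold) (use n2 k cnz in \<open>auto intro!: beta_brow\<close>)
    also have "extremal n (rr k) (tset n 2 (\<not> ee k))"
    proof -
      have "extremal n (blocks [1..<1 + (k - 1)] (delta (tset n (2 + (k - 1)) (\<not> e)))) (tset n 2 ((\<not> e) \<noteq> odd (k - 1)))"
        by (rule extremal_blocks) (use n4 k cnz in auto)
      moreover have "1 + (k - 1) = k" "2 + (k - 1) = k + 1" using k by auto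
      ultimately show ?thesis by (simp add: rr_def ee_def One_nat_def)
    qed
    then have "beta n (gam n ?w (delta (tset n n (ee k)))) (rr k) = snd ?w 1"
      by (rule last_pairing[OF n4])
    finally show ?thesis .
  qed
  moreover have "V 1 = beta n (crow (k + 1) (prow (k - 1) (blocks [1..<n] (delta (tset n n e)))))
      (blocks [1..<n] (delta (tset n (k + 1) (\<not> e))))"
  proof -
    have "req n (fold crow [1..<k] (blocks [1..<n] (delta (tset n n e)))) (prow (k - 1) (blocks [1..<n] (delta (tset n n e))))"
      using fold_crow[of "k - 1" n "blocks [1..<n] (delta (tset n n e))"] k by simp
    then have "req n (crow (k + 1) (fold crow [1..<k] (blocks [1..<n] (delta (tset n n e)))))
        (crow (k + 1) (prow (k - 1) (blocks [1..<n] (delta (tset n n e)))))"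
      by (rule req_crow[OF kn])
    then show ?thesis unfolding V_def by (simp add: ee_def rr_def beta_cong[OF _ req_refl])
  qed
  ultimately show ?thesis using V by simp
qed

text \<open>In the last block all letters but \<open>n\<close> carry the top with coefficient 1 to
  \<open>{1..n - 2}\<close>. Letter \<open>n\<close> could raise this set; the entry at the set
  itself is then only multiplied by the parameter.\<close>

lemma spin_entry_n:
  assumes "e = odd (n - 2)"
  shows "blocks [1..<n] (delta (tset n n e)) {1..n - 2} = c (n - 1) n"
proof -
  have e: "extremal n (blocks [1..<1 + (n - 2)] (delta (tset n (2 + (n - 2)) e))) (tset n 2 (e \<noteq> odd (n - 2)))"
    by (rule extremal_blocks) (use n4 cnz in auto)
  have "1 \<le> n - 1" "Suc (n - 1) = n" using n4 by auto
  then have a4: "[1..<n] = [1..<n - 1] @ [n - 1]" using upt_Suc_append[of 1 "n - 1"] by simp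
  have a: "1 + (n - 2) = n - 1" "2 + (n - 2) = n" "(e \<noteq> odd (n - 2)) = False"
    using n4 assms by simp_all
  define r where "r = blocks [1..<n - 1] (delta (tset n n e))"
  have r: "extremal n r (tset n (1 + 1) False)" using e unfolding a r_def by simp
  have s: "adm n [1..<n - 1] (tset n (1 + 1) False)"
    "fold (sset n) [1..<n - 1] (tset n (1 + 1) False) = {1..<n - 1}"
    using tset_run[of 1 n "n - 1" False] n4 by auto
  have l: "[1..<n + 1] = ([1..<n - 1] @ [n - 1]) @ [n]"
  proof -
    obtain k where "n = Suc (Suc k)" using n4 by (intro that[of "n - 2"]) simp
    then show ?thesis by (simp add: One_nat_def)
  qed
  have cn: "n - 1 \<in> {1..n - 1}" using n4 by auto
  have can: "\<not> canf n (n - 1) {1..<n - 1}" "\<not> cane n (n - 1) {1..<n - 1}"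
    using n4 by (auto simp: canf_def cane_def up_def dn_def)
  have set: "{1..<n - 1} = {1..n - 2}" using n4 by auto
  let ?js = "[1..<n - 1] @ [n - 1]"
  have "extremal n (fold (\<lambda>i. ybrow n i (c (n - 1) i)) ?js r) (fold (sset n) ?js (tset n (1 + 1) False))"
    by (rule extremal_fold[OF r _ n4]) (use s can cnz[OF cn] n4 in \<open>auto simp: adm_append\<close>)
  then have v: "fold (\<lambda>i. ybrow n i (c (n - 1) i)) ?js r {1..n - 2} = 1"
    using s can by (simp add: sset_def set extremal_def)
  have "cane n n {1..n - 2}" using n4 by (auto simp: cane_def up_def dn_def)
  then show ?thesis
    unfolding a4 using v by (simp add: l brow_def r_def[symmetric] ybrow_def cane_imp)
qed

text \<open>Here letter \<open>n - 1\<close> rescales the top reached by the previous letters, and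
  letter \<open>n\<close> is orthogonal to it.\<close>

lemma spin_entry_n1:
  assumes "e = even (n - 2)"
  shows "blocks [1..<n] (delta (tset n n e)) ({1..n - 2} \<union> {n}) = c (n - 1) (n - 1)"
proof -
  have e: "extremal n (blocks [1..<1 + (n - 2)] (delta (tset n (2 + (n - 2)) e))) (tset n 2 (e \<noteq> odd (n - 2)))"
    by (rule extremal_blocks) (use n4 cnz in auto)
  have "1 \<le> n - 1" "Suc (n - 1) = n" using n4 by auto
  then have a4: "[1..<n] = [1..<n - 1] @ [n - 1]" using upt_Suc_append[of 1 "n - 1"] by simp
  have a: "1 + (n - 2) = n - 1" "2 + (n - 2) = n" "(e \<noteq> odd (n - 2)) = True"
    using n4 assms by simp_all
  define r where "r = blocks [1..<n - 1] (delta (tset n n e))"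
  have r: "extremal n r (tset n (1 + 1) True)" using e unfolding a r_def by simp
  have s: "adm n [1..<n - 1] (tset n (1 + 1) True)"
    "fold (sset n) [1..<n - 1] (tset n (1 + 1) True) = {1..<n - 1} \<union> {n}"
    using tset_run[of 1 n "n - 1" True] n4 by auto
  have l: "[1..<n + 1] = [1..<n - 1] @ [n - 1, n]"
  proof -
    obtain k where "n = Suc (Suc k)" using n4 by (intro that[of "n - 2"]) simp
    then show ?thesis by (simp add: One_nat_def)
  qed
  have cn: "n - 1 \<in> {1..n - 1}" using n4 by auto
  have set: "{1..<n - 1} = {1..n - 2}" using n4 by auto
  have can: "cane n (n - 1) ({1..n - 2} \<union> {n})" "\<not> canf n n ({1..n - 2} \<union> {n})" "\<not> cane n n ({1..n - 2} \<union> {n})"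
    using n4 by (auto simp: canf_def cane_def up_def dn_def)
  have "extremal n (fold (\<lambda>i. ybrow n i (c (n - 1) i)) [1..<n - 1] r) (fold (sset n) [1..<n - 1] (tset n (1 + 1) True))"
    by (rule extremal_fold[OF r _ n4]) (use s cnz[OF cn] n4 in auto)
  then have v: "fold (\<lambda>i. ybrow n i (c (n - 1) i)) [1..<n - 1] r ({1..n - 2} \<union> {n}) = 1"
    using s by (simp add: set extremal_def)
  then show ?thesis
    unfolding a4 using can v by (simp add: l brow_def r_def[symmetric] ybrow_def cane_imp)
qed

end

section \<open>The fundamental minors\<close>

text \<open>The rows at \<open>{1..n}\<close> and \<open>{1..k}\<close> have weights adding up to
  \<open>\<Lambda>\<^sub>k\<close>. They are paired with the highest weight vector of the tensor
  square, and the factor \<open>jsg\<close> normalises the value at the identity to 1.\<close>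

definition fmin :: "nat \<Rightarrow> nat \<Rightarrow> complex mat \<Rightarrow> complex" where
  "fmin n k g = jsg n {1..k} * beta n (prow k (ent g {1..n})) (ent g {1..k})"

lemma ent_poly: "A \<subseteq> {1..n} \<Longrightarrow> B \<subseteq> {1..n} \<Longrightarrow> (\<lambda>g. ent g A B) \<in> mat_polynomials (2 ^ n)"
  unfolding ent_def by (intro mat_polynomials.entry idx_lt)

lemma fmin_poly:
  assumes "k \<le> n"
  shows "fmin n k \<in> mat_polynomials (2 ^ n)"
proof -
  have k: "{1..k} \<subseteq> {1..n}" using assms by auto
  have "(\<lambda>g. prow k (ent g {1..n}) ({1..n} - B)) \<in> mat_polynomials (2 ^ n)" if "B \<subseteq> {1..n}" for B
    unfolding prow_def using k that
    by (cases "({1..n} - B) \<inter> {1..k} = {}") (auto intro!: ent_poly mat_polynomials.const)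
  then show ?thesis
    unfolding fmin_def[abs_def] beta_def using k
    by (intro mat_polynomials.mult mat_polynomials.const mat_poly_sum ent_poly) auto
qed

lemma ent_mult_row:
  assumes "g \<in> carrier_mat (2 ^ n) (2 ^ n)" "row_rep n v F" "A \<subseteq> {1..n}" "D \<subseteq> {1..n}"
  shows "ent (g * v) A D = F (ent g A) D"
  using assms by (simp add: ent_mult[OF assms(1) row_rep_carrier[OF assms(2)]] row_rep_def)

lemma req_ent_mult:
  assumes "g \<in> carrier_mat (2 ^ n) (2 ^ n)" "row_rep n v F" "A \<subseteq> {1..n}"
  shows "req n (ent (g * v) A) (F (ent g A))"
  using ent_mult_row[OF assms] by (simp add: req_def)

lemma req_prow: "k \<le> n \<Longrightarrow> req n r r' \<Longrightarrow> req n (prow k r) (prow k r')"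
  by (auto simp: req_def prow_def)

lemma fmin_mult:
  assumes "g \<in> carrier_mat (2 ^ n) (2 ^ n)" "row_rep n v F" "k \<le> n"
  shows "fmin n k (g * v) = jsg n {1..k} * beta n (prow k (F (ent g {1..n}))) (F (ent g {1..k}))"
  unfolding fmin_def
  by (intro arg_cong[where f = "(*) _"] beta_cong req_prow req_ent_mult) (use assms in auto)

lemma tle_antisym:
  assumes "tle n A B" "tle n B A" "A \<subseteq> {1..n}" "B \<subseteq> {1..n}"
  shows "A = B"
proof -
  have e: "pre i A = pre i B" if "i \<le> n" for i
    using assms(1,2) that by (meson order.antisym tle_def)
  have "i \<in> A \<longleftrightarrow> i \<in> B" if "i \<in> {1..n}" for i
  proof -
    have "of_bool (i \<in> A) = (of_bool (i \<in> B) :: int)"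
      using e[of i] e[of "i - 1"] pre_pos[of i A] pre_pos[of i B] that by auto
    then show ?thesis by auto
  qed
  with assms(3,4) show ?thesis by blast
qed

lemma tle_full:
  assumes "tle n {1..n} D" "D \<subseteq> {1..n}"
  shows "D = {1..n}"
proof (rule ccontr)
  assume "D \<noteq> {1..n}"
  then obtain a where a: "a \<in> {1..n}" "a \<notin> D" using assms(2) by blast
  have "pre n D < pre n {1..n}"
    unfolding pre_def by (rule sum_strict_mono_ex1) (use a in auto)
  moreover have "pre n {1..n} \<le> pre n D" using assms(1) by (simp add: tle_def)
  ultimately show False by simp
qed

text \<open>All terms of the highest weight vector behind \<open>fmin\<close> have the same weight:
  the elements outside \<open>{1..k}\<close> cancel between the two tensor factors, which leaves
  \<open>\<Lambda>\<^sub>k\<close>.\<close>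

lemma h_compl:
  assumes "j \<in> {1..n}" "{1..k} \<subseteq> B" "B \<subseteq> {1..n}" "1 \<le> k" "k \<le> n - 2" "4 \<le> n"
  shows "h_eigenvalue n j (({1..n} - B) \<union> {1..k}) + h_eigenvalue n j B = of_bool (j = k)"
proof -
  have m: "(of_bool (i \<in> ({1..n} - B) \<union> {1..k}) :: int) = 1 - of_bool (i \<in> B) + of_bool (i \<le> k)"
    if "i \<in> {1..n}" for i
  proof -
    have "i \<le> k \<Longrightarrow> i \<in> B" using that assms(2) by auto
    then show ?thesis using that by auto
  qed
  show ?thesis
  proof (cases "j < n")
    case True
    then have "j \<in> {1..n}" "j + 1 \<in> {1..n}" using assms by auto
    then show ?thesis using True m[of j] m[of "j + 1"] by (auto simp: h_eigenvalue_def of_bool_def)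
  next
    case False
    then have "j = n" "n - 1 \<in> {1..n}" "n \<in> {1..n}" "\<not> n \<le> k" "\<not> n - 1 \<le> k" "n \<noteq> k" using assms by auto
    then show ?thesis using m[of n] m[of "n - 1"] by (simp add: h_eigenvalue_def)
  qed
qed

section \<open>Values of the minors on the big cell\<close>

context type_d
begin

text \<open>On rows the lowering root elements only raise weights, and they keep the diagonal equal
  to 1.\<close>

lemma U_minus_triangular:
  assumes "u \<in> U_minus n"
  shows "A \<subseteq> {1..n} \<Longrightarrow> D \<subseteq> {1..n} \<Longrightarrow> ent u A D \<noteq> 0 \<Longrightarrow> tle n A D"
    "A \<subseteq> {1..n} \<Longrightarrow> ent u A A = 1"
proof -
  let ?Q = "{u \<in> CM. (\<forall>A D. A \<subseteq> {1..n} \<longrightarrow> D \<subseteq> {1..n} \<longrightarrow> ent u A D \<noteq> 0 \<longrightarrow> tle n A D) \<and>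
    (\<forall>A. A \<subseteq> {1..n} \<longrightarrow> ent u A A = 1)}"
  have "U_minus n \<subseteq> ?Q"
  proof (rule U_minus_closed)
    show "1\<^sub>m (2 ^ n) \<in> ?Q"
      using row_rep_ent[OF row_rep_one, of _ n] by (auto simp: delta_def tle_refl)
  next
    fix i t assume i: "i \<in> {1..n}"
    have e: "ent (y_elt n i t) A D = yrow n i t (delta A) D" if "A \<subseteq> {1..n}" "D \<subseteq> {1..n}" for A D
      using row_rep_ent[OF row_rep_y[OF i n2]] that by simp
    have "tle n A D" if "A \<subseteq> {1..n}" "D \<subseteq> {1..n}" "ent (y_elt n i t) A D \<noteq> 0" for A D
    proof -
      have "D = A \<or> (canf n i D \<and> fset n i D = A)"
      proof (rule ccontr)
        assume "\<not> (D = A \<or> (canf n i D \<and> fset n i D = A))"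
        then have "D \<noteq> A" "canf n i D \<Longrightarrow> fset n i D \<noteq> A" by auto
        then have "ent (y_elt n i t) A D = 0" by (simp add: e[OF that(1,2)] yrow_def delta_def)
        then show False using that(3) by simp
      qed
      then show ?thesis
        using tle_eset_self(1)[of n i A, OF _ i n2] by (auto simp: tle_refl canf_imp)
    qed
    moreover have "ent (y_elt n i t) A A = 1" if "A \<subseteq> {1..n}" for A
      using e[OF that that] canf_imp(5)[of n i A] by (auto simp: yrow_def delta_def)
    ultimately show "y_elt n i t \<in> ?Q" using y_CM[OF i] by blast
  next
    fix a b assume ab: "a \<in> ?Q" "b \<in> ?Q"
    then have c: "a \<in> CM" "b \<in> CM" by auto
    have "tle n A D" if AD: "A \<subseteq> {1..n}" "D \<subseteq> {1..n}" "ent (a * b) A D \<noteq> 0" for A D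
    proof -
      obtain C where "C \<in> Pow {1..n}" "ent a A C * ent b C D \<noteq> 0"
        using AD(3) unfolding ent_mult[OF c AD(1,2)] by (metis (mono_tags, lifting) sum.neutral)
      then have "C \<subseteq> {1..n}" "ent a A C \<noteq> 0" "ent b C D \<noteq> 0" by auto
      then have "tle n A C" "tle n C D" using ab AD by auto
      then show ?thesis by (rule tle_trans)
    qed
    moreover have "ent (a * b) A A = 1" if A: "A \<subseteq> {1..n}" for A
    proof -
      have "ent (a * b) A A = (\<Sum>C\<in>{A}. ent a A C * ent b C A)"
        unfolding ent_mult[OF c A A]
      proof (rule sum.mono_neutral_right)
        show "\<forall>C\<in>Pow {1..n} - {A}. ent a A C * ent b C A = 0"
        proof (rule ballI, rule ccontr)
          fix C assume C: "C \<in> Pow {1..n} - {A}" "ent a A C * ent b C A \<noteq> 0"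
          then have "tle n A C" "tle n C A" using ab A by auto
          then have "A = C" using tle_antisym C A by blast
          then show False using C by simp
        qed
      qed (use A in auto)
      then show ?thesis using ab A by simp
    qed
    ultimately show "a * b \<in> ?Q" using mm_closed[OF c] by blast
  qed
  with assms have "u \<in> ?Q" by blast
  then show "A \<subseteq> {1..n} \<Longrightarrow> D \<subseteq> {1..n} \<Longrightarrow> ent u A D \<noteq> 0 \<Longrightarrow> tle n A D"
    "A \<subseteq> {1..n} \<Longrightarrow> ent u A A = 1" by auto
qed

lemma U_plus_invariant:
  assumes "\<And>g i t. g \<in> CM \<Longrightarrow> i \<in> {1..n} \<Longrightarrow> p (g * x_elt n i t) = p g"
    and "v \<in> U_plus n" "g \<in> CM"
  shows "p (g * v) = p g"
proof -
  let ?Q = "{v \<in> CM. \<forall>g\<in>CM. p (g * v) = p g}"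
  have "U_plus n \<subseteq> ?Q"
  proof (rule U_plus_closed)
    show "1\<^sub>m (2 ^ n) \<in> ?Q" by auto
    show "x_elt n i t \<in> ?Q" if "i \<in> {1..n}" for i t using assms(1) that x_CM by auto
    show "a * b \<in> ?Q" if "a \<in> ?Q" "b \<in> ?Q" for a b
    proof -
      have "p (g * (a * b)) = p g" if "g \<in> CM" for g
      proof -
        have "g * (a * b) = g * a * b" using \<open>a \<in> ?Q\<close> \<open>b \<in> ?Q\<close> that by (intro mm_assoc[symmetric]) auto
        then show ?thesis using \<open>a \<in> ?Q\<close> \<open>b \<in> ?Q\<close> that mm_closed[of g a] by auto
      qed
      then show ?thesis using that mm_closed by auto
    qed
  qed
  then show ?thesis using assms by blast
qed

text \<open>The factors are stripped from the right: both \<open>prow\<close> and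
  \<open>beta\<close> are compatible with the raising elements, the torus acts by
  \<open>\<Lambda>\<^sub>k\<close>, and for \<open>u\<close> triangularity leaves the full set as
  the only entry in the first row, which forces \<open>B = {1..k}\<close>.\<close>

lemma fmin_cell:
  assumes k: "1 \<le> k" "k \<le> n - 2" and u: "u \<in> U_minus n" and \<tau>: "nz \<tau>" and v: "v \<in> U_plus n"
  shows "fmin n k (u * torus_elt n \<tau> * v) = \<tau> k"
proof -
  have kn: "k \<le> n" using k by simp
  have uC: "u \<in> CM" using u U_minus_spin spin_CM by blast
  have TC: "u * torus_elt n \<tau> \<in> CM" using uC torus_carrier by (rule mm_closed)
  have "fmin n k (u * torus_elt n \<tau> * v) = fmin n k (u * torus_elt n \<tau>)"
  proof (rule U_plus_invariant[OF _ v TC])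
    fix g i t assume g: "g \<in> CM" and i: "i \<in> {1..n}"
    have "prow k (xrow n i t r) = xrow n i t (prow k r)" for r
      using prow_xrow[OF k(2) i n4] by (rule ext)
    then show "fmin n k (g * x_elt n i t) = fmin n k g"
      unfolding fmin_mult[OF g row_rep_x[OF i n2] kn] by (simp add: beta_x[OF i n2] fmin_def)
  qed
  also have "fmin n k (u * torus_elt n \<tau>) = \<tau> k * fmin n k u"
  proof -
    have ch: "torus_char n \<tau> (({1..n} - B) \<union> {1..k}) * torus_char n \<tau> B = \<tau> k"
      if B: "B \<subseteq> {1..n}" "({1..n} - B) \<inter> {1..k} = {}" for B
    proof -
      have "{1..k} \<subseteq> {1..n}" using kn by auto
      then have "{1..k} \<subseteq> B" using B(2) by blast
      then have "torus_char n \<tau> (({1..n} - B) \<union> {1..k}) * torus_char n \<tau> B = (\<Prod>j = 1..n. \<tau> j powi of_bool (j = k))"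
        unfolding torus_char_def prod.distrib[symmetric]
        using \<tau> h_compl[OF _ _ B(1) k n4] by (intro prod.cong refl) (simp flip: power_int_add)
      also have "\<dots> = (\<Prod>j\<in>{k}. \<tau> j powi of_bool (j = k))"
        by (rule prod.mono_neutral_right) (use k kn in auto)
      finally show ?thesis by simp
    qed
    have "beta n (prow k (trow n \<tau> r)) (trow n \<tau> r') = \<tau> k * beta n (prow k r) r'" for r r'
      unfolding beta_def sum_distrib_left
    proof (intro sum.cong refl)
      fix B assume B: "B \<in> Pow {1..n}"
      show "jsg n B * prow k (trow n \<tau> r) ({1..n} - B) * trow n \<tau> r' B =
          \<tau> k * (jsg n B * prow k r ({1..n} - B) * r' B)"
        using ch[of B] B by (auto simp: prow_def trow_def mult_ac)
    qed
    then show ?thesis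
      unfolding fmin_mult[OF uC row_rep_torus kn] by (simp add: fmin_def)
  qed
  also have "fmin n k u = 1"
  proof -
    let ?K = "{1..k}"
    have K: "?K \<subseteq> {1..n}" using kn by auto
    have r: "ent u {1..n} D = 0" if "D \<subseteq> {1..n}" "D \<noteq> {1..n}" for D
      using U_minus_triangular(1)[OF u order.refl that(1)] tle_full[OF _ that(1)] that(2) by blast
    have z: "jsg n B * prow k (ent u {1..n}) ({1..n} - B) * ent u ?K B = 0"
      if B: "B \<subseteq> {1..n}" "B \<noteq> ?K" for B
    proof -
      have "prow k (ent u {1..n}) ({1..n} - B) = 0"
      proof (cases "({1..n} - B) \<inter> ?K = {}")
        case True
        have "({1..n} - B) \<union> ?K \<noteq> {1..n}"
        proof
          assume *: "({1..n} - B) \<union> ?K = {1..n}"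
          have "B \<subseteq> ?K" using * B by blast
          moreover have "?K \<subseteq> B" using True K by blast
          ultimately show False using B by simp
        qed
        then show ?thesis using r[of "({1..n} - B) \<union> ?K"] K by (simp add: prow_def)
      qed (simp add: prow_def)
      then show ?thesis by simp
    qed
    have "beta n (prow k (ent u {1..n})) (ent u ?K) =
        (\<Sum>B\<in>{?K}. jsg n B * prow k (ent u {1..n}) ({1..n} - B) * ent u ?K B)"
      unfolding beta_def by (rule sum.mono_neutral_right) (use K z in auto)
    moreover have "({1..n} - ?K) \<union> ?K = {1..n}" "({1..n} - ?K) \<inter> ?K = {}" using K by auto
    ultimately have "beta n (prow k (ent u {1..n})) (ent u ?K) = jsg n ?K"
      using U_minus_triangular(2)[OF u order.refl] U_minus_triangular(2)[OF u K] by (simp add: prow_def)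
    then show ?thesis by (simp add: fmin_def jsg_def flip: power_add)
  qed
  finally show ?thesis by simp
qed

lemma principal_minor_fmin:
  assumes "1 \<le> k" "k \<le> n - 2" "g \<in> carrier GG"
  shows "principal_minor n k g = fmin n k g"
  by (rule principal_minor_eqI[OF fmin_poly fmin_cell[OF assms(1,2)] assms(3)]) (use assms in auto)

text \<open>The hypotheses say that \<open>A\<close> is a highest weight of weight
  \<open>\<Lambda>\<^sub>k\<close> in a half-spin summand, where the minor is a diagonal matrix
  entry.\<close>

lemma spin_minor:
  assumes A: "A \<subseteq> {1..n}" and top: "\<And>i. i \<in> {1..n} \<Longrightarrow> \<not> cane n i A"
    and h: "\<And>j. j \<in> {1..n} \<Longrightarrow> h_eigenvalue n j A = of_bool (j = k)" and k: "k \<in> {1..n}"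
    and g: "g \<in> carrier GG"
  shows "principal_minor n k g = ent g A A"
proof (rule principal_minor_eqI[OF ent_poly[OF A A] _ g])
  fix u \<tau> v assume u: "u \<in> U_minus n" and \<tau>: "nz \<tau>" and v: "v \<in> U_plus n"
  have uC: "u \<in> CM" using u U_minus_spin spin_CM by blast
  have TC: "u * torus_elt n \<tau> \<in> CM" using uC torus_carrier by (rule mm_closed)
  have "ent (u * torus_elt n \<tau> * v) A A = ent (u * torus_elt n \<tau>) A A"
    by (rule U_plus_invariant[where p = "\<lambda>g. ent g A A", OF _ v TC])
       (use top in \<open>simp add: ent_mult_row[OF _ row_rep_x[OF _ n2] A A] xrow_def\<close>)
  also have "\<dots> = torus_char n \<tau> A * ent u A A"
    by (simp add: ent_mult_row[OF uC row_rep_torus A A] trow_def)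
  also have "torus_char n \<tau> A = (\<Prod>j = 1..n. \<tau> j powi of_bool (j = k))"
    unfolding torus_char_def by (intro prod.cong refl) (simp add: h)
  also have "\<dots> = (\<Prod>j\<in>{k}. \<tau> j powi of_bool (j = k))"
    by (rule prod.mono_neutral_right) (use k in auto)
  finally show "ent (u * torus_elt n \<tau> * v) A A = \<tau> k" using U_minus_triangular(2)[OF u A] by simp
qed

lemma principal_minor_n: "g \<in> carrier GG \<Longrightarrow> principal_minor n n g = ent g {1..n} {1..n}"
  by (rule spin_minor) (use n4 in \<open>auto simp: cane_def up_def dn_def h_eigenvalue_def\<close>)

lemma principal_minor_n1: "g \<in> carrier GG \<Longrightarrow> principal_minor n (n - 1) g = ent g {1..n - 1} {1..n - 1}"
  by (rule spin_minor) (use n4 in \<open>auto simp: cane_def up_def dn_def h_eigenvalue_def\<close>)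

end

section \<open>Representatives of Weyl group elements\<close>

definition sinv :: "nat \<Rightarrow> nat \<Rightarrow> complex mat" where
  "sinv n i = x_elt n i 1 * y_elt n i (- 1) * x_elt n i 1"

definition sirow :: "nat \<Rightarrow> nat \<Rightarrow> row \<Rightarrow> row" where
  "sirow n i r D = (if cane n i D then r (eset n i D) else if canf n i D then - r (fset n i D) else r D)"

lemma row_rep_sinv:
  assumes "i \<in> {1..n}" "2 \<le> n"
  shows "row_rep n (sinv n i) (sirow n i)"
  unfolding sinv_def
  by (rule row_rep_eqI[OF row_rep_mult[OF row_rep_mult[OF row_rep_x[OF assms] row_rep_y[OF assms]] row_rep_x[OF assms]]])
     (auto simp: sirow_def xrow_def yrow_def cane_imp canf_imp)

lemma sinv_s_bar:
  assumes "i \<in> {1..n}" "2 \<le> n"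
  shows "sinv n i * s_bar n i = 1\<^sub>m (2 ^ n)"
  by (rule row_rep_unique[OF row_rep_mult[OF row_rep_sinv[OF assms] row_rep_s_bar[OF assms]] row_rep_one])
     (auto simp: sirow_def sbrow_def cane_imp canf_imp)

text \<open>The inverse representative permutes weight vectors up to sign, and the sign is -1
  exactly when the letter raises the weight.\<close>

lemma sirow_delta:
  "sirow n i (\<lambda>D. s * delta A D) = (\<lambda>D. (if cane n i A then - s else s) * delta (sset n i A) D)"
proof (rule ext)
  fix D
  have K: "\<not> cane n i A \<Longrightarrow> canf n i D \<Longrightarrow> fset n i D \<noteq> A" "\<not> canf n i A \<Longrightarrow> cane n i D \<Longrightarrow> eset n i D \<noteq> A"
    "canf n i D \<Longrightarrow> D \<noteq> eset n i A \<Longrightarrow> fset n i D \<noteq> A" "cane n i D \<Longrightarrow> D \<noteq> fset n i A \<Longrightarrow> eset n i D \<noteq> A"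
    using cane_imp[of n i D] canf_imp[of n i D] by metis+
  consider "cane n i A" | "canf n i A" | "\<not> cane n i A" "\<not> canf n i A" by blast
  then show "sirow n i (\<lambda>D. s * delta A D) D = (if cane n i A then - s else s) * delta (sset n i A) D"
  proof cases
    case 1
    note c = cane_imp[OF 1]
    show ?thesis
    proof (cases "D = eset n i A")
      case False
      have "\<not> cane n i D \<Longrightarrow> D \<noteq> A" using 1 by auto
      then show ?thesis using K c 1 False by (simp add: sirow_def delta_def sset_def)
    qed (use c 1 in \<open>simp add: sirow_def delta_def sset_def\<close>)
  next
    case 2
    note c = canf_imp[OF 2]
    show ?thesis
    proof (cases "D = fset n i A")
      case False
      have "\<not> canf n i D \<Longrightarrow> D \<noteq> A" using 2 by auto
      then show ?thesis using K c 2 False by (simp add: sirow_def delta_def sset_def)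
    qed (use c 2 in \<open>simp add: sirow_def delta_def sset_def\<close>)
  next
    case 3
    have "cane n i D \<or> canf n i D \<Longrightarrow> D \<noteq> A" using 3 by auto
    then show ?thesis using K 3 by (auto simp: sirow_def delta_def sset_def)
  qed
qed

primrec winv :: "nat \<Rightarrow> nat list \<Rightarrow> complex mat" where
  "winv n [] = 1\<^sub>m (2 ^ n)"
| "winv n (p # ws) = winv n ws * sinv n p"

primrec wirow :: "nat \<Rightarrow> nat list \<Rightarrow> row \<Rightarrow> row" where
  "wirow n [] r = r"
| "wirow n (p # ws) r = sirow n p (wirow n ws r)"

lemma row_rep_winv:
  "ws \<in> lists {1..n} \<Longrightarrow> 2 \<le> n \<Longrightarrow> row_rep n (winv n ws) (wirow n ws)"
proof (induction ws)
  case Nil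
  show ?case by (simp, rule row_rep_eqI[OF row_rep_one]) simp
next
  case (Cons p ws)
  then have "row_rep n (winv n ws) (wirow n ws)" "row_rep n (sinv n p) (sirow n p)"
    by (auto intro!: row_rep_sinv)
  show ?case
    unfolding winv.simps by (rule row_rep_eqI[OF row_rep_mult[OF \<open>row_rep n (winv n ws) (wirow n ws)\<close>
      \<open>row_rep n (sinv n p) (sirow n p)\<close>]]) simp
qed

text \<open>Twice the weight of the basis vector, so that integral signed permutations
  apply.\<close>

definition sgnvec :: "nat set \<Rightarrow> nat \<Rightarrow> int" where
  "sgnvec A i = (if i \<in> A then 1 else - 1)"

lemma sgnvec_sset:
  assumes "p \<in> {1..n}" "2 \<le> n"
  shows "sgnvec (sset n p A) = sp n p (sgnvec A)"
proof (cases "p < n")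
  case True
  have m: "i \<in> sset n p A \<longleftrightarrow> (if i = p then p + 1 \<in> A else if i = p + 1 then p \<in> A else i \<in> A)" for i
    using True by (cases "p \<in> A"; cases "p + 1 \<in> A")
      (simp_all add: sset_def canf_def cane_def fset_def eset_def up_def dn_def)
  show ?thesis using True by (simp add: fun_eq_iff sgnvec_def sp_def m)
next
  case False
  then have p: "p = n" "n - 1 \<noteq> n" "n \<noteq> n - 1" using assms by auto
  have m: "i \<in> sset n n A \<longleftrightarrow> (if i = n - 1 then n \<notin> A else if i = n then n - 1 \<notin> A else i \<in> A)" for i
    using p by (cases "n - 1 \<in> A"; cases "n \<in> A")
      (simp_all add: sset_def canf_def cane_def fset_def eset_def up_def dn_def)
  show ?thesis using p(2,3) unfolding p(1) by (simp add: fun_eq_iff sgnvec_def sp_def m)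
qed

lemma root_sgnvec:
  assumes "p \<in> {1..n}" "2 \<le> n"
  shows "root n p (sgnvec A) < 0 \<longleftrightarrow> cane n p A"
  using assms by (auto simp: root_def sgnvec_def cane_def up_def dn_def)

text \<open>With \<open>x\<close> the image of \<open>rho\<close> under the part of the word already
  applied, a root counted here remains to be crossed, and the letter that crosses it raises the
  weight \<open>a\<close>.\<close>

definition nneg :: "nat \<Rightarrow> (nat \<Rightarrow> int) \<Rightarrow> (nat \<Rightarrow> int) \<Rightarrow> int" where
  "nneg n x a = rsum n (\<lambda>x a. of_bool (0 < x \<and> a < 0)) x a"

lemma nneg_nonneg: "0 \<le> nneg n x a"
  unfolding nneg_def rsum_def by (intro sum_nonneg) auto

context weyl
begin

text \<open>The sign counts the letters that raise the weight; each letter of a reduced word of the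
  longest element corresponds to one positive root.\<close>

lemma wirow_delta:
  assumes "us @ ws = vs" "reduced_word n (longest_elt n) vs"
  shows "wirow n ws (delta A) = (\<lambda>D. (- 1) ^ nat (nneg n (rho n) (sgnvec A)) *
      (- 1) ^ nat (nneg n (xw ws) (sgnvec (foldr (sset n) ws A))) * delta (foldr (sset n) ws A) D)"
  using assms(1)
proof (induction ws arbitrary: us)
  case Nil then show ?case by (simp flip: power_add)
next
  case (Cons p ws)
  have n2: "2 \<le> n" using n4 by simp
  have p: "p \<in> {1..n}" using Cons.prems assms(2) by (auto simp: reduced_word_def)
  have r: "0 < root n p (xw ws)" using reduced_step[of us p ws] Cons.prems assms(2) by simp
  let ?B = "foldr (sset n) ws A"
  have IH: "wirow n ws (delta A) = (\<lambda>D. (- 1) ^ nat (nneg n (rho n) (sgnvec A)) *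
      (- 1) ^ nat (nneg n (xw ws) (sgnvec ?B)) * delta ?B D)"
    using Cons.IH[of "us @ [p]"] Cons.prems by simp
  \<comment> \<open>The root \<open>p\<close> is positive on \<open>xw ws\<close>, so of the two
    corrections in \<open>rsum_sp\<close> only the first can be nonzero, and it is so exactly when
    the letter raises the weight.\<close>
  have "nneg n (xw (p # ws)) (sgnvec (sset n p ?B)) = nneg n (xw ws) (sgnvec ?B) - of_bool (cane n p ?B)"
    unfolding sgnvec_sset[OF p n2] nneg_def spw_simps(2) rsum_sp[OF p n4]
    using r root_sgnvec[OF p n2, of ?B] by simp
  then have e: "nneg n (xw ws) (sgnvec ?B) = nneg n (xw (p # ws)) (sgnvec (sset n p ?B)) + of_bool (cane n p ?B)"
    by simp
  have s: "(- 1 :: complex) ^ nat (nneg n (xw ws) (sgnvec ?B)) =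
      (if cane n p ?B then - 1 else 1) * (- 1) ^ nat (nneg n (xw (p # ws)) (sgnvec (sset n p ?B)))"
    unfolding e using nneg_nonneg[of n "xw (p # ws)" "sgnvec (sset n p ?B)"]
    by (auto simp: nat_add_distrib One_nat_def)
  show ?case
    unfolding wirow.simps IH sirow_delta s by (auto simp: fun_eq_iff)
qed

lemma foldr_sset: "ws \<in> W \<Longrightarrow> sgnvec (foldr (sset n) ws A) = spw n ws (sgnvec A)"
proof (induction ws)
  case (Cons p ws)
  then have "p \<in> {1..n}" "2 \<le> n" using n4 by auto
  with Cons show ?case by (simp add: sgnvec_sset)
qed simp

lemma foldr_sset_subset: "ws \<in> W \<Longrightarrow> A \<subseteq> {1..n} \<Longrightarrow> foldr (sset n) ws A \<subseteq> {1..n}"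
proof (induction ws)
  case (Cons p ws)
  then have "p \<in> {1..n}" "2 \<le> n" using n4 by auto
  with Cons show ?case by (simp add: sset_def fset_subset eset_subset)
qed simp

lemma longest_sset:
  assumes "reduced_word n (longest_elt n) ws" "A \<subseteq> {1..n}"
  shows "foldr (sset n) ws A = ({1..<n} - A) \<union> (if (n \<in> A) = odd n then {n} else {})"
proof -
  have top: "top_word ws" by (rule longest_reduced(1)[OF assms(1)])
  then have W: "ws \<in> W" by (simp add: top_word_def)
  obtain e :: int where e: "(- 1) ^ (n - 1) * e = 1"
    and a: "\<And>x i. i \<in> {1..n - 1} \<Longrightarrow> spw n ws x i = - x i" "\<And>x. spw n ws x n = e * x n"
    using top_word_action[OF top] by blast
  have e1: "e = (if odd n then 1 else - 1)"
  proof (cases "odd n")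
    case True
    then have "even (n - 1)" by simp
    then show ?thesis using e True by simp
  next
    case False
    then have "odd (n - 1)" using n4 by simp
    then show ?thesis using e False by simp
  qed
  let ?B = "foldr (sset n) ws A"
  have m: "i \<in> ?B \<longleftrightarrow> i \<notin> A" if "i \<in> {1..n - 1}" for i
    using fun_cong[OF foldr_sset[OF W, of A], of i] a(1)[OF that, of "sgnvec A"]
    by (auto simp: sgnvec_def split: if_splits)
  have mn: "n \<in> ?B \<longleftrightarrow> (n \<in> A) = odd n"
    using fun_cong[OF foldr_sset[OF W, of A], of n] a(2)[of "sgnvec A"] e1
    by (auto simp: sgnvec_def split: if_splits)
  show ?thesis
    unfolding set_eq_iff
  proof
    fix i
    consider "i \<in> {1..n - 1}" | "i = n" | "i \<notin> {1..n}" by fastforce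
    then show "i \<in> ?B \<longleftrightarrow> i \<in> ({1..<n} - A) \<union> (if (n \<in> A) = odd n then {n} else {})"
    proof cases
      case 1
      then have "i \<in> {1..<n}" "i \<noteq> n" by auto
      then show ?thesis using m[OF 1] by auto
    next
      case 2 then show ?thesis using mn by auto
    next
      case 3 then show ?thesis using foldr_sset_subset[OF W assms(2)] n4 by auto
    qed
  qed
qed

text \<open>The longest element makes every positive root negative on the image of
  \<open>rho\<close>, so no raising letters remain.\<close>

lemma nneg_top:
  assumes "reduced_word n (longest_elt n) ws"
  shows "nneg n (xw ws) a = 0"
proof -
  have top: "top_word ws" by (rule longest_reduced(1)[OF assms])
  then have W: "ws \<in> W" and r: "\<And>p. p \<in> {1..n} \<Longrightarrow> root n p (xw ws) \<le> 0" by (auto simp: top_word_def)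
  have x: "xw ws i = - rho n i" if "i \<in> {1..n - 1}" for i by (rule antidominant(1)[OF W r that])
  have xn: "\<bar>xw ws n\<bar> = 1" by (rule antidominant(2)[OF W r])
  have "\<not> 0 < xw ws i - xw ws j \<and> \<not> 0 < xw ws i + xw ws j" if "1 \<le> i" "i < j" "j \<le> n" for i j
    using x[of i] x[of j] xn that by (cases "j = n") (auto simp: rho_def)
  then show ?thesis
    unfolding nneg_def rsum_def by (intro sum.neutral) (auto simp: pairs_def)
qed

lemma nneg_rho:
  "nneg n (rho n) a = (\<Sum>(i, j)\<in>pairs n. of_bool (a i - a j < 0) + of_bool (a i + a j < 0))"
  unfolding nneg_def rsum_def by (intro sum.cong refl) (auto simp: pairs_def rho_def)

text \<open>No positive root is negative on a highest weight, hence no letter raises and the sign is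
  1.\<close>

lemma wirow_spin:
  assumes "reduced_word n (longest_elt n) ws" "A = {1..n} \<or> A = {1..n - 1}"
  shows "wirow n ws (delta A) = delta (tset n n ((n \<in> A) = odd n))"
proof -
  have A: "A \<subseteq> {1..n}" using assms(2) by auto
  have "nneg n (rho n) (sgnvec A) = 0"
    unfolding nneg_rho using assms(2) by (intro sum.neutral) (auto simp: pairs_def sgnvec_def)
  moreover have "({1..<n} - A) \<union> (if (n \<in> A) = odd n then {n} else {}) = tset n n ((n \<in> A) = odd n)"
    using assms(2) by (auto simp: tset_def)
  ultimately show ?thesis
    using wirow_delta[of "[]" ws ws A] assms(1)
    by (simp add: nneg_top[OF assms(1)] longest_sset[OF assms(1) A])
qed

text \<open>The positive roots negative on this weight are
  \<open>\<epsilon>\<^sub>i + \<epsilon>\<^sub>j\<close> with \<open>k < i < j\<close>. There are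
  \<open>n - i\<close> of them for each \<open>i\<close>, which is the exponent of
  \<open>jsg\<close>.\<close>

lemma wirow_fund:
  assumes "reduced_word n (longest_elt n) ws" "k \<le> n - 2"
  shows "wirow n ws (delta {1..k}) = (\<lambda>D. jsg n {1..k} * delta (tset n (k + 1) (even n)) D)"
proof -
  have A: "{1..k} \<subseteq> {1..n}" using assms(2) by auto
  have "nneg n (rho n) (sgnvec {1..k}) = (\<Sum>(i, j)\<in>pairs n. of_bool (k < i))"
    unfolding nneg_rho by (intro sum.cong refl) (auto simp: pairs_def sgnvec_def)
  also have "\<dots> = (\<Sum>p\<in>pairs n. of_bool (k < fst p))" by (simp add: case_prod_beta)
  also have "\<dots> = int (card (pairs n \<inter> {p. k < fst p}))" by (subst sum_of_bool_eq) (rule finite_pairs, simp)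
  also have "pairs n \<inter> {p. k < fst p} = Sigma {k + 1..n} (\<lambda>i. {i + 1..n})"
    by (auto simp: pairs_def)
  also have "card (Sigma {k + 1..n} (\<lambda>i. {i + 1..n})) = (\<Sum>i\<in>{k + 1..n}. n - i)"
    by simp
  also have "{k + 1..n} = {1..n} - {1..k}" by auto
  finally have "nneg n (rho n) (sgnvec {1..k}) = int (\<Sum>i\<in>{1..n} - {1..k}. n - i)" .
  then have "nat (nneg n (rho n) (sgnvec {1..k})) = (\<Sum>i\<in>{1..n} - {1..k}. n - i)" by (simp only: nat_int)
  moreover have "({1..<n} - {1..k}) \<union> (if (n \<in> {1..k}) = odd n then {n} else {}) = tset n (k + 1) (even n)"
    using assms(2) n4 by (auto simp: tset_def)
  ultimately show ?thesis
    using wirow_delta[of "[]" ws ws "{1..k}"] assms(1)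
    by (simp add: nneg_top[OF assms(1)] longest_sset[OF assms(1) A] jsg_def)
qed

text \<open>\<open>w_bar\<close> chooses an unspecified reduced word, so its uniqueness is required.
  The root \<open>k\<close> becomes negative on \<open>rho\<close> under reflection \<open>k\<close>
  but stays positive under any other simple reflection, since off-diagonal Cartan integers are not
  positive.\<close>

lemma reduced_simple:
  assumes "k \<in> {1..n}" "reduced_word n (simple_refl n k) ws"
  shows "ws = [k]"
proof -
  have s: "simple_refl n j = weyl_prod n [j]" for j by (simp add: weyl_prod_def)
  have rp: "0 < root n j (rho n)" if "j \<in> {1..n}" for j using that n4 by (auto simp: root_def rho_def)
  have len: "int (weyl_length n (simple_refl n k)) = 1"
    unfolding s using weyl_length_eq[of "[k]"] assms(1) rp[OF assms(1)] ninv_sp[OF assms(1) n4, of "rho n"]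
    by (simp add: ninv_rho)
  then have "length ws = 1" using assms(2) by (simp add: reduced_word_def)
  then obtain j where ws: "ws = [j]" by (auto simp: length_Suc_conv One_nat_def)
  then have j: "j \<in> {1..n}" "weyl_prod n [j] = weyl_prod n [k]" using assms(2) by (auto simp: reduced_word_def s)
  have "sp n j (rho n) i = sp n k (rho n) i" if "i \<in> {1..n}" for i
    using weyl_prod_eqD[OF j(2) _ _ n4 that, of "rho n"] j(1) assms(1) by simp
  then have "root n k (sp n j (rho n)) = root n k (sp n k (rho n))"
    using assms(1) n4 by (auto simp: root_def)
  then have *: "root n k (rho n) - root n j (rho n) * cartan n k j = - root n k (rho n)"
    using root_sp[OF assms(1) j(1) n4] root_sp_self[OF assms(1) n4] by simp
  have "j = k"
  proof (rule ccontr)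
    assume "j \<noteq> k"
    then have "cartan n k j \<le> 0" by (auto simp: cartan_def)
    then have "root n j (rho n) * cartan n k j \<le> 0" using rp[OF j(1)] by (simp add: mult_le_0_iff)
    then show False using * rp[OF assms(1)] by linarith
  qed
  then show ?thesis using ws by simp
qed

lemma w_bar_simple:
  assumes "k \<in> {1..n}"
  shows "w_bar n (simple_refl n k) = s_bar n k"
proof -
  have n2: "2 \<le> n" using n4 by simp
  have s: "simple_refl n k = weyl_prod n [k]" by (simp add: weyl_prod_def)
  obtain ws where ws: "ws \<in> W" "weyl_prod n ws = simple_refl n k"
    "int (length ws) = ninv n (xw [k])"
    using exists_word[of "[k]"] assms s by auto
  then have "reduced_word n (simple_refl n k) ws"
    using weyl_length_eq[of "[k]"] assms s by (auto simp: reduced_word_def)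
  then have "reduced_word n (simple_refl n k) (SOME ws. reduced_word n (simple_refl n k) ws)" by (rule someI)
  then have "(SOME ws. reduced_word n (simple_refl n k) ws) = [k]" by (rule reduced_simple[OF assms])
  then show ?thesis
    using row_rep_carrier[OF row_rep_s_bar[OF assms n2]] by (simp add: w_bar_def mat_list_prod_def)
qed

end

section \<open>Evaluation of the minors\<close>

lemma fold_concat_pairs:
  "fold F (concat (map (\<lambda>m. map (Pair m) is) ms)) r = fold (\<lambda>m. fold (\<lambda>i. F (m, i)) is) ms r"
  by (induction ms arbitrary: r) (simp_all add: fold_map comp_def)

lemma (in params) row_rep_Theta: "row_rep n (Theta_minus n c) (blocks [1..<n])"
proof -
  let ?xs = "concat (map (\<lambda>m. map (Pair m) [1..<n + 1]) [1..<n])"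
  have n2: "2 \<le> n" using n4 by simp
  have "row_rep n (mat_list_prod (2 ^ n) (map (\<lambda>p. y_bold n (snd p) (c (fst p) (snd p))) ?xs))
      (fold (\<lambda>p. ybrow n (snd p) (c (fst p) (snd p))) ?xs)"
    by (rule row_rep_list, rule row_rep_y_bold) (use n2 cnz in auto)
  moreover have "map (\<lambda>p. y_bold n (snd p) (c (fst p) (snd p))) ?xs =
      concat (map (\<lambda>m. map (\<lambda>i. y_bold n i (c m i)) [1..<n + 1]) [1..<n])"
    by (simp add: map_concat comp_def)
  ultimately show ?thesis
    unfolding Theta_minus_def fold_concat_pairs[abs_def] by (simp add: brow_def[abs_def])
qed

lemma brow_scale: "brow n c (\<lambda>D. s * r D) = (\<lambda>D. s * brow n c r D)"
proof -
  have y: "ybrow n i d (\<lambda>D. s * r D) = (\<lambda>D. s * ybrow n i d r D)" for i d r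
    by (auto simp: ybrow_def fun_eq_iff distrib_left)
  have "fold (\<lambda>i. ybrow n i (c i)) js (\<lambda>D. s * r D) = (\<lambda>D. s * fold (\<lambda>i. ybrow n i (c i)) js r D)" for js
    by (induction js arbitrary: r) (simp_all add: y)
  then show ?thesis unfolding brow_def .
qed

lemma blocks_scale:
  "fold (\<lambda>m. brow n (c m)) ms (\<lambda>D. s * r D) = (\<lambda>D. s * fold (\<lambda>m. brow n (c m)) ms r D)"
  by (induction ms arbitrary: r) (simp_all add: brow_scale)

lemma sbrow_scale: "sbrow n i (\<lambda>D. s * r D) = (\<lambda>D. s * sbrow n i r D)"
  by (auto simp: sbrow_def fun_eq_iff)

lemma beta_scale: "beta n r (\<lambda>D. s * r' D) = s * beta n r r'"
  unfolding beta_def sum_distrib_left by (intro sum.cong) (auto simp: mult_ac)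

locale minors = type_d n + weyl n + params n c for n c
begin

lemma gen_minor_eq:
  assumes k: "k \<in> {1..n}"
  obtains ws M where "reduced_word n (longest_elt n) ws" "M \<in> carrier GG"
    "row_rep n M (\<lambda>r. sbrow n k (blocks [1..<n] (wirow n ws r)))"
    "gen_minor n i (longest_elt n) (simple_refl n k) (Theta_minus n c) = principal_minor n i M"
proof -
  define ws where "ws = (SOME ws. reduced_word n (longest_elt n) ws)"
  have red: "reduced_word n (longest_elt n) ws" unfolding ws_def by (rule someI_ex[OF ex_longest_reduced])
  then have W: "ws \<in> W" by (simp add: reduced_word_def)
  have sb: "s_bar n p \<in> carrier GG" "sinv n p \<in> carrier GG" if "p \<in> {1..n}" for p
    unfolding s_bar_def sinv_def by (intro spin_mult x_spin y_spin that)+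
  have wC: "mat_list_prod (2 ^ n) (map (s_bar n) vs) \<in> carrier GG" if "vs \<in> W" for vs
    using that sb by (intro spin_list) auto
  have iC: "winv n vs \<in> carrier GG" if "vs \<in> W" for vs
    using that
  proof (induction vs)
    case (Cons p vs)
    then have "p \<in> {1..n}" by auto
    then show ?case using Cons sb(2) by (auto intro: spin_mult)
  qed (simp add: spin_one)
  have wi: "winv n vs * mat_list_prod (2 ^ n) (map (s_bar n) vs) = 1\<^sub>m (2 ^ n)" if "vs \<in> W" for vs
    using that
  proof (induction vs)
    case Nil then show ?case by (simp add: mat_list_prod_def)
  next
    case (Cons p vs)
    then have p: "p \<in> {1..n}" and vs: "vs \<in> W" by auto
    let ?w = "mat_list_prod (2 ^ n) (map (s_bar n) vs)"
    have c: "winv n vs \<in> CM" "sinv n p \<in> CM" "s_bar n p \<in> CM" "?w \<in> CM"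
      using iC[OF vs] wC[OF vs] sb[OF p] spin_CM by auto
    have "winv n (p # vs) * mat_list_prod (2 ^ n) (map (s_bar n) (p # vs)) =
        winv n vs * sinv n p * (s_bar n p * ?w)"
      by (simp add: mat_list_prod_def)
    also have "\<dots> = winv n vs * ((sinv n p * s_bar n p) * ?w)"
      using c by (simp add: mm_assoc mm_closed)
    also have "\<dots> = 1\<^sub>m (2 ^ n)"
      unfolding sinv_s_bar[OF p n2] using c Cons.IH vs by simp
    finally show ?case .
  qed
  have inv: "inv\<^bsub>GG\<^esub> (w_bar n (longest_elt n)) = winv n ws"
    unfolding w_bar_def ws_def[symmetric] using wC[OF W] iC[OF W] wi[OF W] by (intro spin_inv_eq)
  let ?M = "winv n ws * Theta_minus n c * s_bar n k"
  have "y_bold n i a \<in> carrier GG" if "i \<in> {1..n}" "a \<noteq> 0" for i a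
    unfolding y_bold_def using that by (intro spin_mult y_spin coroot_spin) auto
  then have "Theta_minus n c \<in> carrier GG"
  proof -
    have "Theta_minus n c = mat_list_prod (2 ^ n) (map (\<lambda>M. M) (concat (map (\<lambda>m. map (\<lambda>i. y_bold n i (c m i)) [1..<n + 1]) [1..<n])))"
      by (simp add: Theta_minus_def)
    also have "\<dots> \<in> carrier GG"
      using \<open>\<And>i a. i \<in> {1..n} \<Longrightarrow> a \<noteq> 0 \<Longrightarrow> y_bold n i a \<in> carrier GG\<close> cnz by (intro spin_list) auto
    finally show ?thesis .
  qed
  then have MC: "?M \<in> carrier GG" using iC[OF W] sb[OF k] by (intro spin_mult)
  have rr: "row_rep n ?M (\<lambda>r. sbrow n k (blocks [1..<n] (wirow n ws r)))"
    by (rule row_rep_mult[OF row_rep_mult[OF row_rep_winv[OF W n2] row_rep_Theta] row_rep_s_bar[OF k n2]])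
  show ?thesis
    by (rule that[OF red MC rr]) (simp add: gen_minor_def inv w_bar_simple[OF k])
qed

lemma gen_minor_fund:
  assumes k: "1 \<le> k" "k \<le> n - 2"
  shows "gen_minor n k (longest_elt n) (simple_refl n k) (Theta_minus n c) =
    snd (vblocks [k..<n] (evec (k + 1))) 1"
proof -
  have kn: "k \<in> {1..n}" "k < n" "k \<le> n" using k n4 by auto
  obtain ws M where red: "reduced_word n (longest_elt n) ws" and M: "M \<in> carrier GG"
    "row_rep n M (\<lambda>r. sbrow n k (blocks [1..<n] (wirow n ws r)))"
    and g: "gen_minor n k (longest_elt n) (simple_refl n k) (Theta_minus n c) = principal_minor n k M"
    using gen_minor_eq[OF kn(1), of k] by blast
  let ?r = "blocks [1..<n] (delta (tset n n (odd n)))"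
  let ?r' = "blocks [1..<n] (delta (tset n (k + 1) (\<not> odd n)))"
  have 1: "req n (ent M {1..n}) (sbrow n k ?r)"
  proof -
    have "wirow n ws (delta {1..n}) = delta (tset n n (odd n))"
      using wirow_spin[OF red, of "{1..n}"] n4 by simp
    then show ?thesis using row_rep_ent[OF M(2) order.refl] by (simp add: req_def)
  qed
  have 2: "req n (ent M {1..k}) (\<lambda>D. jsg n {1..k} * sbrow n k ?r' D)"
  proof -
    have K: "{1..k} \<subseteq> {1..n}" using kn by auto
    show ?thesis
      using row_rep_ent[OF M(2) K] unfolding wirow_fund[OF red k(2)] blocks_scale sbrow_scale
      by (simp add: req_def)
  qed
  have "fmin n k M = jsg n {1..k} * beta n (prow k (sbrow n k ?r)) (\<lambda>D. jsg n {1..k} * sbrow n k ?r' D)"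
    unfolding fmin_def by (intro arg_cong[where f = "(*) _"] beta_cong req_prow 1 2 kn)
  also have "\<dots> = beta n (prow k (sbrow n k ?r)) (sbrow n k ?r')"
    unfolding beta_scale by (simp add: jsg_def flip: power_add mult.assoc)
  also have "\<dots> = beta n (sbrow n k (crow (k + 1) (prow (k - 1) ?r))) (sbrow n k ?r')"
    by (rule beta_cong[OF _ req_refl]) (use prow_sbrow[OF k(1) kn(2)] in \<open>simp add: req_def\<close>)
  also have "\<dots> = beta n (crow (k + 1) (prow (k - 1) ?r)) ?r'"
    by (rule beta_sbrow[OF kn(1) n2])
  also have "\<dots> = snd (vblocks [k..<n] (evec (k + 1))) 1"
    by (rule pairing_value[OF k])
  finally show ?thesis using g principal_minor_fmin[OF k M(1)] by simp
qed

lemma gen_minor_n: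
  "gen_minor n n (longest_elt n) (simple_refl n n) (Theta_minus n c) = c (n - 1) n"
proof -
  have nn: "n \<in> {1..n}" using n4 by simp
  obtain ws M where red: "reduced_word n (longest_elt n) ws" and M: "M \<in> carrier GG"
    "row_rep n M (\<lambda>r. sbrow n n (blocks [1..<n] (wirow n ws r)))"
    and g: "gen_minor n n (longest_elt n) (simple_refl n n) (Theta_minus n c) = principal_minor n n M"
    using gen_minor_eq[OF nn, of n] by blast
  have w: "wirow n ws (delta {1..n}) = delta (tset n n (odd n))"
    using wirow_spin[OF red, of "{1..n}"] n4 by simp
  \<comment> \<open>The representative of the last reflection moves the column from
    \<open>{1..n}\<close> to \<open>{1..n - 2}\<close>, without a sign.\<close>
  have "canf n n {1..n}" "fset n n {1..n} = {1..n - 2}" using n4 by (auto simp: canf_def fset_def up_def dn_def)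
  moreover have "odd n = odd (n - 2)" using n4 by simp
  ultimately have "ent M {1..n} {1..n} = c (n - 1) n"
    using row_rep_ent[OF M(2), of "{1..n}" "{1..n}"] spin_entry_n[of "odd n"] by (simp add: w sbrow_def)
  then show ?thesis using g principal_minor_n[OF M(1)] by simp
qed

lemma gen_minor_n1:
  "gen_minor n (n - 1) (longest_elt n) (simple_refl n (n - 1)) (Theta_minus n c) = c (n - 1) (n - 1)"
proof -
  have nn: "n - 1 \<in> {1..n}" using n4 by auto
  obtain ws M where red: "reduced_word n (longest_elt n) ws" and M: "M \<in> carrier GG"
    "row_rep n M (\<lambda>r. sbrow n (n - 1) (blocks [1..<n] (wirow n ws r)))"
    and g: "gen_minor n (n - 1) (longest_elt n) (simple_refl n (n - 1)) (Theta_minus n c) = principal_minor n (n - 1) M"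
    using gen_minor_eq[OF nn, of "n - 1"] by blast
  have "n \<notin> {1..n - 1}" using n4 by auto
  then have o: "((n \<in> {1..n - 1}) = odd n) = even n" by blast
  have w: "wirow n ws (delta {1..n - 1}) = delta (tset n n (even n))"
    using wirow_spin[OF red, of "{1..n - 1}"] unfolding o by simp
  have "canf n (n - 1) {1..n - 1}" "fset n (n - 1) {1..n - 1} = {1..n - 2} \<union> {n}"
    using n4 by (auto simp: canf_def fset_def up_def dn_def)
  moreover have "even n = even (n - 2)" "{1..n - 1} \<subseteq> {1..n}" using n4 by auto
  ultimately have "ent M {1..n - 1} {1..n - 1} = c (n - 1) (n - 1)"
    using row_rep_ent[OF M(2), of "{1..n - 1}" "{1..n - 1}"] spin_entry_n1[of "even n"] by (simp add: w sbrow_def)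
  then show ?thesis using g principal_minor_n1[OF M(1)] by simp
qed

end

theorem theorem9p1:
  fixes n :: nat and c :: "nat \<Rightarrow> nat \<Rightarrow> complex"
  assumes "n \<ge> 4"
    and "\<And>m i. m \<in> {1..n - 1} \<Longrightarrow> i \<in> {1..n} \<Longrightarrow> c m i \<noteq> 0"
    and "\<And>m. m \<in> {1..n - 1} \<Longrightarrow> c m 0 = 1"
  shows "(\<forall>k \<in> {1..n - 2}.
        gen_minor n k (longest_elt n) (simple_refl n k) (Theta_minus n c) =
          (\<Sum>j = 1..n - 2. c k j / c (k + 1) (j - 1))
          + c k (n - 1) * c k n / c (k + 1) (n - 2)
          + c (k + 1) (n - 2) / (c (k + 1) (n - 1) * c (k + 1) n)
          + c k n / c (k + 1) (n - 1)
          + c k (n - 1) / c (k + 1) n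
          + (\<Sum>j = k + 1..n - 2. c (n + k - j) (j - 1) / c (n + k - j) j))
    \<and> gen_minor n (n - 1) (longest_elt n) (simple_refl n (n - 1)) (Theta_minus n c) = c (n - 1) (n - 1)
    \<and> gen_minor n n (longest_elt n) (simple_refl n n) (Theta_minus n c) = c (n - 1) n"
proof -
  interpret minors n c
    by unfold_locales (use assms in auto)
  show ?thesis
    using gen_minor_fund vector_coefficient gen_minor_n gen_minor_n1 by simp
qed

end
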